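(* For all $n\in\mathbb N$, $L>0$, $z\in\mathbb C\setminus[0,\infty)$ and $\psi_1,\psi_2\in L^2(\mathbb R^d)$, $$T_{n,L}[z;\psi_1,\psi_2]=\int_{(\Lambda_L^* )^{n+1}}\sum_{A\in\mathcal A_n}\mathcal P_{A,L}(k_1,\dots,k_{n+1})\,\overline{\hat\psi_{1,\#}(k_1)}\,\hat\psi_{2,\#}(k_{n+1})\prod_{j=1}^{n+1}(\nu(k_j)-z)^{-1}\,d(k_1,\dots,k_{n+1}).$$
   Context: For $L>0$: $\Lambda_L=[-L/2,L/2)^d$, $\Lambda_L^*=(\frac1L\mathbb Z)^d$, and for $g$ on $(\Lambda_L^* )^m$, $\int_{(\Lambda_L^* )^m}g(k)dk:=|\Lambda_L|^{-m}\sum_{k\in(\Lambda_L^* )^m}g(k)$. For $h:\mathbb R^d\to\mathbb C$, $h_\#$ is the $L$-periodic extension of $h|_{\Lambda_L}$ and $\hat h_\#(p)=\int_{\Lambda_L}e^{-2\pi ip\cdot x}h(x)dx$, $p\in\Lambda_L^*$. Inner products on $L^2(\Lambda_L)$ are antilinear in the first argument. $\nu(p)=\frac12|p|^2$; $K_L$ is the self-adjoint operator with $\widehat{K_Lf}(p)=\nu(p)\hat f(p)$ on $\{f:\nu\hat f\in\ell^2(\Lambda_L^* )\}$, $R_L(z)=(K_L-z)^{-1}$. $B$ is a real Schwartz function on $\mathbb R^d$ with compact support or invariant under each reflection $x_j\mapsto-x_j$. $M$ Poisson with mean $|\Lambda_L|$, $y_{L,\gamma}$ i.i.d. uniform on $\Lambda_L$,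 $v_\gamma$ i.i.d. real with $m_k=\mathbf E v_\gamma^k<\infty$ for all $k$, all independent; $V_L(x)=\sum_{\gamma=1}^Mv_\gamma B_\#(x-y_{L,\gamma})$; $\mathbf E_L$ joint expectation; $T_{n,L}[z;\psi_1,\psi_2]:=\mathbf E_L\langle\psi_{1,\#},R_L(z)[V_LR_L(z)]^n\psi_{2,\#}\rangle$. $\mathcal A_n$ is the set of partitions of $\{1,\dots,n\}$; $\delta_{*,L}(u)=|\Lambda_L|$ if $u=0$ and $0$ otherwise; for $A\in\mathcal A_n$ and $k=(k_1,\dots,k_{n+1})\in(\Lambda_L^* )^{n+1}$, $\mathcal P_{A,L}(k)=\prod_{a\in A}\Big\{m_{|a|}\,\delta_{*,L}\Big(\sum_{l\in a}(k_l-k_{l+1})\Big)\prod_{l\in a}\hat B_\#(k_l-k_{l+1})\Big\}$. *)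

theory Defs
  imports "HOL-Probability.Probability" "HOL-Library.Disjoint_Sets"
begin

definition box_L :: "real \<Rightarrow> (real^'d) set" where
  "box_L L = {x. \<forall>i. - L / 2 \<le> x $ i \<and> x $ i < L / 2}"

definition vol_L :: "real \<Rightarrow> 'd::finite itself \<Rightarrow> real" where
  "vol_L L _ = L ^ CARD('d)"

definition dual_L :: "real \<Rightarrow> (real^'d) set" where
  "dual_L L = {p. \<forall>i. \<exists>k::int. p $ i = of_int k / L}"

text \<open>L-periodic extension of the restriction of h to Lambda_L.\<close>
definition perext :: "real \<Rightarrow> (real^'d \<Rightarrow> 'b) \<Rightarrow> real^'d \<Rightarrow> 'b" where
  "perext L h x = h (\<chi> i. x $ i - L * of_int \<lfloor>x $ i / L + 1 / 2\<rfloor>)"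

definition fourier_L :: "real \<Rightarrow> (real^'d \<Rightarrow> complex) \<Rightarrow> real^'d \<Rightarrow> complex" where
  "fourier_L L h p = integral (box_L L) (\<lambda>x. exp (- (2 * pi * \<i> * complex_of_real (p \<bullet> x))) * perext L h x)"

definition inner_L :: "real \<Rightarrow> (real^'d \<Rightarrow> complex) \<Rightarrow> (real^'d \<Rightarrow> complex) \<Rightarrow> complex" where
  "inner_L L f g = integral (box_L L) (\<lambda>x. cnj (f x) * g x)"

definition L2_on :: "(real^'d) set \<Rightarrow> (real^'d \<Rightarrow> complex) \<Rightarrow> bool" where
  "L2_on S f \<longleftrightarrow> f measurable_on S \<and> (\<lambda>x. (cmod (f x))\<^sup>2) integrable_on S"

definition nu :: "real^'d \<Rightarrow> real" where
  "nu p = (norm p)\<^sup>2 / 2"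

text \<open>Resolvent R_L(z) = (K_L - z)^{-1}: the element of L^2(Lambda_L) whose
  Fourier coefficients are hat f(p) / (nu(p) - z) (determined up to a.e. equality).\<close>
definition resolv_L :: "real \<Rightarrow> complex \<Rightarrow> (real^'d \<Rightarrow> complex) \<Rightarrow> real^'d \<Rightarrow> complex" where
  "resolv_L L z f = (SOME g. L2_on (box_L L) g \<and>
      (\<forall>p\<in>dual_L L. fourier_L L g p = fourier_L L f p / (complex_of_real (nu p) - z)))"

definition resolv_chain :: "real \<Rightarrow> complex \<Rightarrow> (real^'d \<Rightarrow> real) \<Rightarrow> nat \<Rightarrow> (real^'d \<Rightarrow> complex) \<Rightarrow> real^'d \<Rightarrow> complex" where
  "resolv_chain L z V n f = ((\<lambda>w. resolv_L L z (\<lambda>x. complex_of_real (V x) * w x)) ^^ n) (resolv_L L z f)"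

definition partial_j :: "'d::finite \<Rightarrow> (real^'d \<Rightarrow> real) \<Rightarrow> real^'d \<Rightarrow> real" where
  "partial_j j f x = deriv (\<lambda>t. f (x + t *\<^sub>R axis j 1)) 0"

fun iter_partial :: "'d::finite list \<Rightarrow> (real^'d \<Rightarrow> real) \<Rightarrow> real^'d \<Rightarrow> real" where
  "iter_partial [] f = f"
| "iter_partial (j # js) f = partial_j j (iter_partial js f)"

definition schwartz :: "(real^'d::finite \<Rightarrow> real) \<Rightarrow> bool" where
  "schwartz f \<longleftrightarrow> (\<forall>js x. iter_partial js f differentiable (at x)) \<and>
     (\<forall>js (N::nat). bounded (range (\<lambda>x. (1 + norm x) ^ N * iter_partial js f x)))"

definition reflect_j :: "'d::finite \<Rightarrow> real^'d \<Rightarrow> real^'d" where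
  "reflect_j j x = (\<chi> i. if i = j then - x $ i else x $ i)"

definition sample_space :: "real \<Rightarrow> real measure \<Rightarrow> (nat \<times> (nat \<Rightarrow> real^'d::finite) \<times> (nat \<Rightarrow> real)) measure" where
  "sample_space L mu = measure_pmf (poisson_pmf (vol_L L TYPE('d))) \<Otimes>\<^sub>M
     ((\<Pi>\<^sub>M \<gamma>\<in>UNIV. uniform_measure lborel (box_L L)) \<Otimes>\<^sub>M (\<Pi>\<^sub>M \<gamma>\<in>UNIV. mu))"

definition V_L :: "real \<Rightarrow> (real^'d \<Rightarrow> real) \<Rightarrow> nat \<times> (nat \<Rightarrow> real^'d) \<times> (nat \<Rightarrow> real) \<Rightarrow> real^'d \<Rightarrow> real" where
  "V_L L B \<omega> x = (\<Sum>\<gamma>\<in>{1..fst \<omega>}. snd (snd \<omega>) \<gamma> * perext L B (x - fst (snd \<omega>) \<gamma>))"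

definition T_nL :: "real \<Rightarrow> real measure \<Rightarrow> (real^'d::finite \<Rightarrow> real) \<Rightarrow> nat \<Rightarrow> complex
    \<Rightarrow> (real^'d \<Rightarrow> complex) \<Rightarrow> (real^'d \<Rightarrow> complex) \<Rightarrow> complex" where
  "T_nL L mu B n z \<psi>1 \<psi>2 = integral\<^sup>L (sample_space L mu)
     (\<lambda>\<omega>. inner_L L (perext L \<psi>1) (resolv_chain L z (V_L L B \<omega>) n (perext L \<psi>2)))"

definition moment :: "real measure \<Rightarrow> nat \<Rightarrow> real" where
  "moment mu k = integral\<^sup>L mu (\<lambda>v. v ^ k)"

definition delta_L :: "real \<Rightarrow> real^'d::finite \<Rightarrow> complex" where
  "delta_L L u = (if u = 0 then complex_of_real (vol_L L TYPE('d)) else 0)"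

text \<open>P_{A,L}(k) with k : {1..n+1} -> Lambda_L^*.\<close>
definition P_AL :: "real \<Rightarrow> real measure \<Rightarrow> (real^'d::finite \<Rightarrow> real) \<Rightarrow> nat set set \<Rightarrow> (nat \<Rightarrow> real^'d) \<Rightarrow> complex" where
  "P_AL L mu B A k = (\<Prod>a\<in>A. complex_of_real (moment mu (card a)) *
      delta_L L (\<Sum>l\<in>a. k l - k (l + 1)) *
      (\<Prod>l\<in>a. fourier_L L (\<lambda>x. complex_of_real (B x)) (k l - k (l + 1))))"

end

theory Submission
  imports Defs
begin

text \<open>
  The characters of the dual lattice form a complete orthogonal system of the box, by
  Stone--Weierstrass on the torus. Parseval's identity therefore turns the inner product, for each
  realisation of the potential, into a sum over momenta \<open>(k\<^sub>1, \<dots>, k\<^sub>n\<^sub>+\<^sub>1)\<close> in which the potential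
  enters through products of its Fourier coefficients: the coefficient of the profile times the random
  sum of \<open>v\<^sub>\<gamma> exp (- 2 \<pi> i p \<cdot> y\<^sub>\<gamma>)\<close>.

  This sum converges absolutely although the periodic extension of the profile may jump at the faces
  of the box. Its coefficients decay like the product of the \<open>1 / (1 + |L p\<^sub>i|)\<close>, and the resolvent
  factors contribute a power \<open>(1 + |L k\<^sub>i|) powr (- 1 / d)\<close> in each coordinate, which is just enough
  for the kernel between neighbouring momenta to pass Schur's test. The bound factors into a summable
  function of the momenta and a power of the sum of the \<open>|v\<^sub>\<gamma>|\<close>, so expectation and sum commute.

  Finally, the expectation of a product of the random sums is expanded over maps from \<open>{1..n}\<close> to the
  labels \<open>\<gamma>\<close> and grouped by the partition into fibres. Independence gives one moment and one momentum
  constraint per block, and the factorial moments of the Poisson variable give one factor of the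
  volume per block.
\<close>

section \<open>Square-integrable functions and orthogonal sequences\<close>

text \<open>The obstacle is that the profile is cut to the box before it is periodised, so its
  coefficients are controlled only by \<open>decay L p\<close>, whose sum over the dual lattice
  diverges. Each weight 1 / |nu(k) - z| is split into two square roots, one for each neighbouring
  kernel. Such a square root is at most C / (1 + |L k_i|) for every coordinate i at once; the
  geometric mean of these d bounds is a product over the coordinates, and this turns decay in the
  length of k into decay that fits a product kernel. Any exponent e > 0 bounds the sum over n of (1
  + |n|)^(-e) / (1 + |m - n|) uniformly in m, so 1 / d is enough in every dimension.

  The resolvent is given by choosing a representative with prescribed Fourier coefficients. All that
  is known of it is read off from these coefficients, for each realisation separately, so the
  dependence of the representative on the sample is never examined.\<close>

definition sq_integrable :: "'a measure \<Rightarrow> ('a \<Rightarrow> complex) \<Rightarrow> bool" where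
  "sq_integrable M f \<longleftrightarrow> f \<in> borel_measurable M \<and> integrable M (\<lambda>x. (cmod (f x))\<^sup>2)"

lemma sq_integrable_measurable: "sq_integrable M f \<Longrightarrow> f \<in> borel_measurable M"
  by (simp add: sq_integrable_def)

lemma mult_le_sum_squares: "a \<ge> 0 \<Longrightarrow> b \<ge> 0 \<Longrightarrow> a * b \<le> a\<^sup>2 + b\<^sup>2" for a b :: real
  using sum_squares_bound[of a b] mult_nonneg_nonneg[of a b] by linarith

lemma sq_integrable_mult:
  assumes "sq_integrable M f" "sq_integrable M g"
  shows "integrable M (\<lambda>x. f x * g x)"
proof (rule Bochner_Integration.integrable_bound)
  show "integrable M (\<lambda>x. (cmod (f x))\<^sup>2 + (cmod (g x))\<^sup>2)"
    using assms by (simp add: sq_integrable_def)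
  show "(\<lambda>x. f x * g x) \<in> borel_measurable M"
    using assms by (auto simp: sq_integrable_def)
  show "AE x in M. norm (f x * g x) \<le> norm ((cmod (f x))\<^sup>2 + (cmod (g x))\<^sup>2)"
    by (auto simp: norm_mult mult_le_sum_squares)
qed

lemma sq_integrable_cnj:
  assumes "sq_integrable M f" shows "sq_integrable M (\<lambda>x. cnj (f x))"
proof -
  have "cnj \<in> borel_measurable borel"
    by (intro borel_measurable_continuous_onI continuous_intros)
  then have "(\<lambda>x. cnj (f x)) \<in> borel_measurable M"
    using assms measurable_compose by (auto simp: sq_integrable_def)
  then show ?thesis using assms by (simp add: sq_integrable_def)
qed

lemma sq_integrable_cmult: "sq_integrable M f \<Longrightarrow> sq_integrable M (\<lambda>x. c * f x)"
  by (auto simp: sq_integrable_def norm_mult power_mult_distrib)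

lemma sq_integrable_add:
  assumes "sq_integrable M f" "sq_integrable M g"
  shows "sq_integrable M (\<lambda>x. f x + g x)"
  unfolding sq_integrable_def
proof
  show "integrable M (\<lambda>x. (cmod (f x + g x))\<^sup>2)"
  proof (rule Bochner_Integration.integrable_bound)
    show "integrable M (\<lambda>x. 2 * (cmod (f x))\<^sup>2 + 2 * (cmod (g x))\<^sup>2)"
      using assms by (simp add: sq_integrable_def)
    have "(cmod (a + b))\<^sup>2 \<le> 2 * (cmod a)\<^sup>2 + 2 * (cmod b)\<^sup>2" for a b
    proof -
      have "(cmod (a + b))\<^sup>2 \<le> (cmod a + cmod b)\<^sup>2"
        by (simp add: norm_triangle_ineq power_mono)
      also have "\<dots> \<le> 2 * (cmod a)\<^sup>2 + 2 * (cmod b)\<^sup>2"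
        using sum_squares_bound[of "cmod a" "cmod b"] by (simp add: power2_sum)
      finally show ?thesis .
    qed
    then show "AE x in M. norm ((cmod (f x + g x))\<^sup>2) \<le> norm (2 * (cmod (f x))\<^sup>2 + 2 * (cmod (g x))\<^sup>2)"
      by auto
  qed (use assms in \<open>auto simp: sq_integrable_def\<close>)
qed (use assms in \<open>auto simp: sq_integrable_def\<close>)

lemma sq_integrable_diff:
  assumes "sq_integrable M f" "sq_integrable M g"
  shows "sq_integrable M (\<lambda>x. f x - g x)"
  using sq_integrable_add[OF assms(1) sq_integrable_cmult[OF assms(2), of "-1"]] by simp

lemma sq_integrable_sum:
  assumes "\<And>i. i \<in> I \<Longrightarrow> sq_integrable M (f i)"
  shows "sq_integrable M (\<lambda>x. \<Sum>i\<in>I. f i x)"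
proof (cases "finite I")
  case True
  then show ?thesis
    using assms by (induction I rule: finite_induct) (auto intro: sq_integrable_add simp: sq_integrable_def[of M "\<lambda>x. 0"])
next
  case False
  then show ?thesis by (simp add: sq_integrable_def)
qed

lemma sq_integrable_bounded_mult:
  assumes "sq_integrable M f" "h \<in> borel_measurable M" "\<And>x. x \<in> space M \<Longrightarrow> cmod (h x) \<le> C"
  shows "sq_integrable M (\<lambda>x. h x * f x)"
  unfolding sq_integrable_def
proof
  show "integrable M (\<lambda>x. (cmod (h x * f x))\<^sup>2)"
  proof (rule Bochner_Integration.integrable_bound)
    show "integrable M (\<lambda>x. C\<^sup>2 * (cmod (f x))\<^sup>2)"
      using assms by (simp add: sq_integrable_def)
    show "AE x in M. norm ((cmod (h x * f x))\<^sup>2) \<le> norm (C\<^sup>2 * (cmod (f x))\<^sup>2)"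
      using assms(3) by (auto simp: norm_mult power_mult_distrib intro!: mult_right_mono power_mono)
  qed (use assms in \<open>auto simp: sq_integrable_def\<close>)
qed (use assms in \<open>auto simp: sq_integrable_def\<close>)

lemma (in finite_measure) sq_integrable_bounded:
  assumes "h \<in> borel_measurable M" "\<And>x. x \<in> space M \<Longrightarrow> cmod (h x) \<le> C"
  shows "sq_integrable M h"
  using sq_integrable_bounded_mult[of M "\<lambda>x. 1" h C] assms
  by (simp add: sq_integrable_def)

lemma (in finite_measure) sq_integrable_imp_integrable:
  assumes "sq_integrable M f" shows "integrable M f"
  using sq_integrable_mult[OF assms, of "\<lambda>x. 1"] by (simp add: sq_integrable_def)

lemma integral_Cauchy_Schwarz:
  assumes f: "sq_integrable M f" and g: "sq_integrable M g"
  shows "(\<integral>x. cmod (f x) * cmod (g x) \<partial>M)\<^sup>2 \<le> (\<integral>x. (cmod (f x))\<^sup>2 \<partial>M) * (\<integral>x. (cmod (g x))\<^sup>2 \<partial>M)"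
proof -
  have [measurable]: "f \<in> borel_measurable M" "g \<in> borel_measurable M"
    using f g by (auto simp: sq_integrable_def)
  have i: "integrable M (\<lambda>x. cmod (f x) * cmod (g x))"
    using integrable_norm[OF sq_integrable_mult[OF f g]] by (simp add: norm_mult)
  have nf: "(\<integral>\<^sup>+x. ennreal ((cmod (h x))\<^sup>2) \<partial>M) = ennreal (\<integral>x. (cmod (h x))\<^sup>2 \<partial>M)" if "sq_integrable M h" for h
    using that by (intro nn_integral_eq_integral) (auto simp: sq_integrable_def)
  have "(\<integral>\<^sup>+x. ennreal (cmod (f x)) * ennreal (cmod (g x)) \<partial>M)\<^sup>2
      \<le> (\<integral>\<^sup>+x. (ennreal (cmod (f x)))\<^sup>2 \<partial>M) * (\<integral>\<^sup>+x. (ennreal (cmod (g x)))\<^sup>2 \<partial>M)"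
    by (rule Cauchy_Schwarz_nn_integral) auto
  also have "(\<integral>\<^sup>+x. ennreal (cmod (f x)) * ennreal (cmod (g x)) \<partial>M) = ennreal (\<integral>x. cmod (f x) * cmod (g x) \<partial>M)"
    by (subst nn_integral_eq_integral[OF i, symmetric]) (auto simp: ennreal_mult)
  finally have "ennreal ((\<integral>x. cmod (f x) * cmod (g x) \<partial>M)\<^sup>2)
      \<le> ennreal ((\<integral>x. (cmod (f x))\<^sup>2 \<partial>M) * (\<integral>x. (cmod (g x))\<^sup>2 \<partial>M))"
    by (simp add: ennreal_power nf[OF f] nf[OF g] ennreal_mult)
  then show ?thesis
    by (subst (asm) ennreal_le_iff) auto
qed

lemma integral_mult_Cauchy_Schwarz:
  assumes f: "sq_integrable M f" and g: "sq_integrable M g"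
  shows "(cmod (\<integral>x. f x * g x \<partial>M))\<^sup>2 \<le> (\<integral>x. (cmod (f x))\<^sup>2 \<partial>M) * (\<integral>x. (cmod (g x))\<^sup>2 \<partial>M)"
proof -
  have "cmod (\<integral>x. f x * g x \<partial>M) \<le> (\<integral>x. cmod (f x) * cmod (g x) \<partial>M)"
    using integral_norm_bound[of M "\<lambda>x. f x * g x"] by (simp add: norm_mult)
  then have "(cmod (\<integral>x. f x * g x \<partial>M))\<^sup>2 \<le> (\<integral>x. cmod (f x) * cmod (g x) \<partial>M)\<^sup>2"
    by (intro power_mono) auto
  with integral_Cauchy_Schwarz[OF f g] show ?thesis by linarith
qed

section \<open>Bessel, Riesz-Fischer and Parseval for an orthogonal sequence\<close>

text \<open>The vectors are left unnormalised: \<open>v\<close> is their common squared norm, later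
  the volume of the box. Indexing by \<open>nat\<close> makes sequential limit theorems available;
  the dual lattice is enumerated when the locale is instantiated.\<close>

locale orthogonal_sequence = finite_measure M for M :: "'a measure" +
  fixes e :: "nat \<Rightarrow> 'a \<Rightarrow> complex" and v :: real
  assumes sq: "\<And>i. sq_integrable M (e i)"
    and orth: "\<And>i j. (\<integral>x. cnj (e i x) * e j x \<partial>M) = (if i = j then complex_of_real v else 0)"
    and v_pos: "v > 0"
begin

lemma sq_integrable_comb: "sq_integrable M (\<lambda>x. \<Sum>i\<in>I. c i * e i x)"
  by (intro sq_integrable_sum sq_integrable_cmult sq)

lemma integral_cnj_mult_comb:
  assumes h: "sq_integrable M h"
  shows "(\<integral>x. cnj (h x) * (\<Sum>i\<in>I. c i * e i x) \<partial>M) = (\<Sum>i\<in>I. c i * (\<integral>x. cnj (h x) * e i x \<partial>M))"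
proof -
  have "(\<integral>x. cnj (h x) * (\<Sum>i\<in>I. c i * e i x) \<partial>M) = (\<integral>x. (\<Sum>i\<in>I. c i * (cnj (h x) * e i x)) \<partial>M)"
    by (simp add: sum_distrib_left mult_ac)
  also have "\<dots> = (\<Sum>i\<in>I. c i * (\<integral>x. cnj (h x) * e i x \<partial>M))"
    by (subst Bochner_Integration.integral_sum)
       (auto intro!: integrable_mult_right sq_integrable_mult sq_integrable_cnj h sq)
  finally show ?thesis .
qed

lemma integral_cnj_basis_comb:
  assumes "finite I"
  shows "(\<integral>x. cnj (e j x) * (\<Sum>i\<in>I. c i * e i x) \<partial>M) = (if j \<in> I then c j * v else 0)"
  by (subst integral_cnj_mult_comb[OF sq]) (simp add: orth if_distrib assms sum.delta' cong: if_cong)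

lemma norm_sq_comb:
  assumes "finite I"
  shows "(\<integral>x. (cmod (\<Sum>i\<in>I. c i * e i x))\<^sup>2 \<partial>M) = v * (\<Sum>i\<in>I. (cmod (c i))\<^sup>2)"
proof -
  let ?S = "\<lambda>x. \<Sum>i\<in>I. c i * e i x"
  have "complex_of_real (\<integral>x. (cmod (?S x))\<^sup>2 \<partial>M) = (\<integral>x. cnj (?S x) * ?S x \<partial>M)"
    by (subst integral_complex_of_real[symmetric]) (simp only: complex_norm_square mult.commute)
  also have "\<dots> = (\<Sum>i\<in>I. c i * (\<integral>x. cnj (?S x) * e i x \<partial>M))"
    by (rule integral_cnj_mult_comb[OF sq_integrable_comb])
  also have "\<dots> = (\<Sum>i\<in>I. c i * cnj (c i * v))"
  proof (intro sum.cong refl)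
    fix i assume "i \<in> I"
    have "(\<integral>x. cnj (?S x) * e i x \<partial>M) = (\<integral>x. cnj (cnj (e i x) * ?S x) \<partial>M)"
      by (simp add: mult.commute)
    also have "\<dots> = cnj (\<integral>x. cnj (e i x) * ?S x \<partial>M)"
      by (rule Bochner_Integration.integral_cnj)
    also have "\<dots> = cnj (c i * v)"
      using \<open>i \<in> I\<close> by (simp add: integral_cnj_basis_comb[OF assms])
    finally show "c i * (\<integral>x. cnj (?S x) * e i x \<partial>M) = c i * cnj (c i * v)" by simp
  qed
  also have "\<dots> = complex_of_real (v * (\<Sum>i\<in>I. (cmod (c i))\<^sup>2))"
    by (simp add: sum_distrib_left complex_norm_square mult_ac del: of_real_power)
  finally show ?thesis using of_real_eq_iff by blast
qed

text \<open>Pair \<open>f\<close> with the combination S of the basis vectors whose coefficients are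
  those of \<open>f\<close>. The pairing equals the sum s of squared coefficients and the squared
  norm of S is \<open>v * s\<close>, so Cauchy-Schwarz reads s^2 \<le> v s times the squared norm of
  \<open>f\<close>, and one factor s cancels.\<close>

lemma Bessel:
  assumes f: "sq_integrable M f" and I: "finite I"
  shows "(\<Sum>i\<in>I. (cmod (\<integral>x. cnj (e i x) * f x \<partial>M))\<^sup>2) \<le> v * (\<integral>x. (cmod (f x))\<^sup>2 \<partial>M)"
proof -
  define c where "c i = (\<integral>x. cnj (e i x) * f x \<partial>M)" for i
  let ?S = "\<lambda>x. \<Sum>i\<in>I. c i * e i x"
  define s where "s = (\<Sum>i\<in>I. (cmod (c i))\<^sup>2)"
  have cc: "c i * cnj (c i) = complex_of_real ((cmod (c i))\<^sup>2)" for i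
    by (simp add: complex_norm_square del: of_real_power)
  have "(\<integral>x. cnj (f x) * ?S x \<partial>M) = (\<Sum>i\<in>I. c i * (\<integral>x. cnj (f x) * e i x \<partial>M))"
    by (rule integral_cnj_mult_comb[OF f])
  also have "\<dots> = (\<Sum>i\<in>I. c i * cnj (c i))"
    by (intro sum.cong refl, unfold c_def)
       (subst Bochner_Integration.integral_cnj[symmetric], simp add: mult.commute)
  also have "\<dots> = complex_of_real s"
    by (simp only: cc s_def of_real_sum)
  finally have "(complex_of_real s) = (\<integral>x. cnj (f x) * ?S x \<partial>M)" ..
  then have "s\<^sup>2 = (cmod (\<integral>x. cnj (f x) * ?S x \<partial>M))\<^sup>2"
    by (metis norm_of_real power2_abs)
  also have "\<dots> \<le> (\<integral>x. (cmod (f x))\<^sup>2 \<partial>M) * (\<integral>x. (cmod (?S x))\<^sup>2 \<partial>M)"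
    using integral_mult_Cauchy_Schwarz[OF sq_integrable_cnj[OF f] sq_integrable_comb[of c I]] by simp
  also have "\<dots> = (\<integral>x. (cmod (f x))\<^sup>2 \<partial>M) * (v * s)"
    by (simp add: norm_sq_comb[OF I] s_def)
  finally have *: "s * s \<le> (v * (\<integral>x. (cmod (f x))\<^sup>2 \<partial>M)) * s"
    by (simp add: power2_eq_square mult_ac)
  have "s \<ge> 0" by (simp add: s_def sum_nonneg)
  show ?thesis
  proof (cases "s = 0")
    case True
    then show ?thesis using v_pos by (simp add: s_def c_def)
  next
    case False
    with * \<open>s \<ge> 0\<close> have "s \<le> v * (\<integral>x. (cmod (f x))\<^sup>2 \<partial>M)"
      by (metis less_le mult_le_cancel_right not_le)
    then show ?thesis by (simp add: s_def c_def)
  qed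
qed

text \<open>A subsequence of the partial sums converges almost everywhere because its increments are
  summable in L^1; Fatou's lemma then bounds the squared distance from the limit to every partial
  sum by the tail of the series. The conclusion is stated weakly, against each square-integrable
  \<open>h\<close>, which is the form in which coefficients and inner products are read off.\<close>

lemma Riesz_Fischer:
  assumes c: "summable (\<lambda>i. (cmod (c i))\<^sup>2)"
  obtains g where "sq_integrable M g"
    "\<And>h. sq_integrable M h \<Longrightarrow> (\<lambda>i. c i * (\<integral>x. cnj (h x) * e i x \<partial>M)) sums (\<integral>x. cnj (h x) * g x \<partial>M)"
proof -
  define S where "S n x = (\<Sum>i<n. c i * e i x)" for n x
  define tl where "tl n = v * (\<Sum>i. (cmod (c (i + n)))\<^sup>2)" for n
  have sqS: "sq_integrable M (S n)" for n
    unfolding S_def by (rule sq_integrable_comb)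
  then have mS[measurable]: "S n \<in> borel_measurable M" for n
    by (simp add: sq_integrable_def)
  have tl0: "tl \<longlonglongrightarrow> 0"
    using tendsto_mult_left[OF suminf_exist_split2[OF c], of v] unfolding tl_def
    by (simp add: fun_eq_iff)
  have diff: "(\<integral>x. (cmod (S m x - S n x))\<^sup>2 \<partial>M) \<le> tl n" if "n \<le> m" for m n
  proof -
    have "S m x - S n x = (\<Sum>i\<in>{n..<m}. c i * e i x)" for x
      unfolding S_def using that by (simp add: sum_diff_nat_ivl lessThan_atLeast0)
    then have "(\<integral>x. (cmod (S m x - S n x))\<^sup>2 \<partial>M) = v * (\<Sum>i\<in>{n..<m}. (cmod (c i))\<^sup>2)"
      by (simp add: norm_sq_comb)
    also have "(\<Sum>i\<in>{n..<m}. (cmod (c i))\<^sup>2) = (\<Sum>i<m-n. (cmod (c (i + n)))\<^sup>2)"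
      using that by (subst sum.atLeastLessThan_shift_0) (simp add: lessThan_atLeast0 add.commute)
    also have "\<dots> \<le> (\<Sum>i. (cmod (c (i + n)))\<^sup>2)"
      by (rule sum_le_suminf) (use summable_ignore_initial_segment[OF c] in auto)
    finally show ?thesis using v_pos by (simp add: tl_def)
  qed
  \<comment> \<open>Powers of 1/4 for the squared norms become powers of 1/2 after the square root
    in Cauchy-Schwarz.\<close>
  have "\<exists>n. \<forall>m\<ge>n. tl m < (1/4)^k" for k
    using order_tendstoD(2)[OF tl0, of "(1/4)^k"] by (simp add: eventually_sequentially)
  then obtain N where N: "\<And>k m. m \<ge> N k \<Longrightarrow> tl m < (1/4)^k"
    by metis
  \<comment> \<open>The subsequence has to lie beyond \<open>N k\<close>, to be monotone so that
    \<open>diff\<close> applies to consecutive indices, and to be at least \<open>k\<close> so that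
    it passes every fixed \<open>n\<close> in the Fatou step.\<close>
  define r where "r k = k + (\<Sum>i\<le>k. N i)" for k
  have rN: "N k \<le> r k" for k
    unfolding r_def by (intro trans_le_add2 member_le_sum) auto
  have r_Suc: "r k \<le> r (Suc k)" for k by (simp add: r_def)
  have r_ge: "k \<le> r k" for k by (simp add: r_def)
  define D where "D k x = cmod (S (r (Suc k)) x - S (r k) x)" for k x
  have intD: "(\<integral>\<^sup>+x. ennreal (D k x) \<partial>M) \<le> ennreal (sqrt (measure M (space M)) * (1/2)^k)" for k
  proof -
    have sqd: "sq_integrable M (\<lambda>x. S (r (Suc k)) x - S (r k) x)"
      by (intro sq_integrable_diff sqS)
    have one: "sq_integrable M (\<lambda>x. 1)" by (simp add: sq_integrable_def)
    have i: "integrable M (D k)"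
      unfolding D_def by (intro integrable_norm sq_integrable_imp_integrable sqd)
    have "(\<integral>x. D k x \<partial>M)\<^sup>2 \<le> (\<integral>x. (D k x)\<^sup>2 \<partial>M) * measure M (space M)"
      using integral_Cauchy_Schwarz[OF sqd one] by (simp add: D_def)
    also have "\<dots> \<le> (1/4)^k * measure M (space M)"
      using diff[OF r_Suc[of k]] N[OF rN[of k]] by (intro mult_right_mono) (auto simp: D_def)
    also have "\<dots> = (sqrt (measure M (space M)) * (1/2)^k)\<^sup>2"
    proof -
      have "((1/2)^k)\<^sup>2 = (1/4::real)^k"
        by (simp add: power2_eq_square flip: power_mult_distrib)
      then show ?thesis by (simp add: power_mult_distrib)
    qed
    finally have "(\<integral>x. D k x \<partial>M) \<le> sqrt (measure M (space M)) * (1/2)^k"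
      by (rule power2_le_imp_le) simp
    then show ?thesis
      by (subst nn_integral_eq_integral[OF i]) (auto intro!: ennreal_leI, simp add: D_def)
  qed
  have mD[measurable]: "D k \<in> borel_measurable M" for k unfolding D_def by measurable
  have "(\<integral>\<^sup>+x. (\<Sum>k. ennreal (D k x)) \<partial>M) = (\<Sum>k. \<integral>\<^sup>+x. ennreal (D k x) \<partial>M)"
    by (rule nn_integral_suminf) auto
  also have "\<dots> \<le> (\<Sum>k. ennreal (sqrt (measure M (space M)) * (1/2)^k))"
    by (intro suminf_le intD summableI)
  also have "\<dots> < \<infinity>"
  proof -
    have "summable (\<lambda>k. sqrt (measure M (space M)) * (1/2::real)^k)"
      by (intro summable_mult summable_geometric) auto
    then show ?thesis by (subst suminf_ennreal2) auto
  qed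
  finally have "AE x in M. (\<Sum>k. ennreal (D k x)) \<noteq> \<infinity>"
    by (intro nn_integral_PInf_AE) auto
  then have conv: "AE x in M. convergent (\<lambda>k. S (r k) x)"
  proof eventually_elim
    case (elim x)
    have "summable (\<lambda>k. D k x)"
      by (rule summable_suminf_not_top) (use elim in \<open>auto simp: D_def\<close>)
    then have "summable (\<lambda>k. S (r (Suc k)) x - S (r k) x)"
      unfolding D_def by (rule summable_norm_cancel)
    then have "convergent (\<lambda>n. S (r n) x - S (r 0) x)"
      unfolding summable_iff_convergent sum_lessThan_telescope[of "\<lambda>i. S (r i) x"] .
    then show ?case
      by (simp add: convergent_diff_const_right_iff)
  qed
  \<comment> \<open>On the null set where the subsequence diverges \<open>lim\<close> is an
    arbitrary value, which affects no integral.\<close>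
  define g where "g x = lim (\<lambda>k. S (r k) x)" for x
  have mg[measurable]: "g \<in> borel_measurable M"
    unfolding g_def by (rule borel_measurable_lim_metric) simp
  \<comment> \<open>Fatou's lemma: the integrand is almost everywhere the liminf of the squared
    distances along the subsequence, and these integrals are at most \<open>tl n\<close> as soon as
    \<open>r k\<close> exceeds \<open>n\<close>.\<close>
  have gint: "(\<integral>\<^sup>+x. ennreal ((cmod (g x - S n x))\<^sup>2) \<partial>M) \<le> ennreal (tl n)" for n
  proof -
    have "(\<integral>\<^sup>+x. ennreal ((cmod (g x - S n x))\<^sup>2) \<partial>M)
        = (\<integral>\<^sup>+x. liminf (\<lambda>k. ennreal ((cmod (S (r k) x - S n x))\<^sup>2)) \<partial>M)"
    proof (rule nn_integral_cong_AE)
      show "AE x in M. ennreal ((cmod (g x - S n x))\<^sup>2) = liminf (\<lambda>k. ennreal ((cmod (S (r k) x - S n x))\<^sup>2))"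
        using conv
      proof eventually_elim
        case (elim x)
        then have "(\<lambda>k. S (r k) x) \<longlonglongrightarrow> g x"
          by (simp add: g_def convergent_LIMSEQ_iff)
        then have "(\<lambda>k. ennreal ((cmod (S (r k) x - S n x))\<^sup>2)) \<longlonglongrightarrow> ennreal ((cmod (g x - S n x))\<^sup>2)"
          by (intro tendsto_intros)
        from lim_imp_Liminf[OF sequentially_bot this] show ?case by (rule sym)
      qed
    qed
    also have "\<dots> \<le> liminf (\<lambda>k. \<integral>\<^sup>+x. ennreal ((cmod (S (r k) x - S n x))\<^sup>2) \<partial>M)"
      by (rule nn_integral_liminf) simp
    also have "\<dots> \<le> limsup (\<lambda>k. \<integral>\<^sup>+x. ennreal ((cmod (S (r k) x - S n x))\<^sup>2) \<partial>M)"
      by (rule Liminf_le_Limsup) simp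
    also have "\<dots> \<le> ennreal (tl n)"
    proof (rule Limsup_bounded)
      show "\<forall>\<^sub>F k in sequentially. (\<integral>\<^sup>+x. ennreal ((cmod (S (r k) x - S n x))\<^sup>2) \<partial>M) \<le> ennreal (tl n)"
        using eventually_ge_at_top[of n]
      proof eventually_elim
        case (elim k)
        have "integrable M (\<lambda>x. (cmod (S (r k) x - S n x))\<^sup>2)"
          using sq_integrable_diff[OF sqS sqS] by (auto simp: sq_integrable_def)
        then show ?case
          using diff[of n "r k"] elim r_ge[of k] by (subst nn_integral_eq_integral) (auto intro!: ennreal_leI)
      qed
    qed
    finally show ?thesis .
  qed
  have sqgS: "sq_integrable M (\<lambda>x. g x - S n x)" for n
    unfolding sq_integrable_def
  proof
    show "integrable M (\<lambda>x. (cmod (g x - S n x))\<^sup>2)"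
      by (rule integrableI_nonneg) (use le_less_trans[OF gint[of n]] in auto)
  qed simp
  have tl_nn: "tl n \<ge> 0" for n
    unfolding tl_def using v_pos c by (intro mult_nonneg_nonneg suminf_nonneg) (auto intro: summable_ignore_initial_segment[of "\<lambda>i. (cmod (c i))\<^sup>2"])
  have gtl: "(\<integral>x. (cmod (g x - S n x))\<^sup>2 \<partial>M) \<le> tl n" for n
    using gint[of n] sqgS[of n] tl_nn[of n]
    by (subst (asm) nn_integral_eq_integral) (auto simp: sq_integrable_def)
  show ?thesis
  proof
    show sqg: "sq_integrable M g"
      using sqgS[of 0] by (simp add: S_def)
    fix h assume h: "sq_integrable M h"
    define H where "H = (\<integral>x. (cmod (h x))\<^sup>2 \<partial>M)"
    have bd: "cmod ((\<Sum>i<n. c i * (\<integral>x. cnj (h x) * e i x \<partial>M)) - (\<integral>x. cnj (h x) * g x \<partial>M)) \<le> sqrt (H * tl n)" for n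
    proof -
      have "(\<integral>x. cnj (h x) * g x \<partial>M) - (\<Sum>i<n. c i * (\<integral>x. cnj (h x) * e i x \<partial>M))
         = (\<integral>x. cnj (h x) * (g x - S n x) \<partial>M)"
      proof -
        have "(\<Sum>i<n. c i * (\<integral>x. cnj (h x) * e i x \<partial>M)) = (\<integral>x. cnj (h x) * S n x \<partial>M)"
          unfolding S_def by (rule integral_cnj_mult_comb[OF h, symmetric])
        then show ?thesis
          by (simp only: right_diff_distrib)
             (intro Bochner_Integration.integral_diff[symmetric] sq_integrable_mult sq_integrable_cnj h sqg sqS)
      qed
      then have "(cmod ((\<integral>x. cnj (h x) * g x \<partial>M) - (\<Sum>i<n. c i * (\<integral>x. cnj (h x) * e i x \<partial>M))))\<^sup>2
         \<le> H * (\<integral>x. (cmod (g x - S n x))\<^sup>2 \<partial>M)"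
        using integral_mult_Cauchy_Schwarz[OF sq_integrable_cnj[OF h] sqgS[of n]] by (simp add: H_def)
      also have "\<dots> \<le> H * tl n"
        by (intro mult_left_mono gtl) (simp add: H_def)
      finally show ?thesis
        by (metis norm_minus_commute real_le_rsqrt)
    qed
    have "(\<lambda>n. sqrt (H * tl n)) \<longlonglongrightarrow> sqrt (H * 0)"
      by (intro tendsto_intros tl0)
    then have "(\<lambda>n. (\<Sum>i<n. c i * (\<integral>x. cnj (h x) * e i x \<partial>M)) - (\<integral>x. cnj (h x) * g x \<partial>M)) \<longlonglongrightarrow> 0"
      by (intro Lim_null_comparison[OF always_eventually[OF allI[OF bd]]]) simp
    then show "(\<lambda>i. c i * (\<integral>x. cnj (h x) * e i x \<partial>M)) sums (\<integral>x. cnj (h x) * g x \<partial>M)"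
      unfolding sums_def by (rule LIM_zero_cancel)
  qed
qed

text \<open>Riesz-Fischer produces a \<open>g\<close> with the same coefficients as
  \<open>f\<close>. Completeness forces \<open>f\<close> and \<open>g\<close> to agree almost
  everywhere, so the series known for \<open>g\<close> is the series for \<open>f\<close>.\<close>

lemma Parseval:
  assumes complete: "\<And>f. sq_integrable M f \<Longrightarrow> (\<And>i. (\<integral>x. cnj (e i x) * f x \<partial>M) = 0) \<Longrightarrow> AE x in M. f x = 0"
    and f: "sq_integrable M f" and h: "sq_integrable M h"
  shows "(\<lambda>i. cnj (\<integral>x. cnj (e i x) * h x \<partial>M) * (\<integral>x. cnj (e i x) * f x \<partial>M) / v) sums (\<integral>x. cnj (h x) * f x \<partial>M)"
proof -
  define c where "c i = (\<integral>x. cnj (e i x) * f x \<partial>M) / v" for i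
  have "summable (\<lambda>i. (cmod (\<integral>x. cnj (e i x) * f x \<partial>M))\<^sup>2)"
    by (rule summableI_nonneg_bounded[where x="v * (\<integral>x. (cmod (f x))\<^sup>2 \<partial>M)"]) (auto intro: Bessel[OF f])
  then have "summable (\<lambda>i. (cmod (c i))\<^sup>2)"
    by (simp add: c_def norm_divide power_divide summable_divide)
  then obtain g where g: "sq_integrable M g"
    and gs: "\<And>h. sq_integrable M h \<Longrightarrow> (\<lambda>i. c i * (\<integral>x. cnj (h x) * e i x \<partial>M)) sums (\<integral>x. cnj (h x) * g x \<partial>M)"
    using Riesz_Fischer by blast
  have gc: "(\<integral>x. cnj (e j x) * g x \<partial>M) = (\<integral>x. cnj (e j x) * f x \<partial>M)" for j
  proof -
    have "(\<lambda>i. c i * (\<integral>x. cnj (e j x) * e i x \<partial>M)) sums (c j * v)"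
      using sums_single[of j "\<lambda>i. c i * v"] by (simp add: orth if_distrib eq_commute[of j] cong: if_cong)
    from sums_unique2[OF gs[OF sq] this] show ?thesis
      using v_pos by (simp add: c_def)
  qed
  have "AE x in M. f x - g x = 0"
  proof (rule complete)
    show "sq_integrable M (\<lambda>x. f x - g x)" by (intro sq_integrable_diff f g)
    show "(\<integral>x. cnj (e i x) * (f x - g x) \<partial>M) = 0" for i
      by (simp add: right_diff_distrib gc sq_integrable_mult sq_integrable_cnj sq f g)
  qed
  then have "(\<integral>x. cnj (h x) * f x \<partial>M) = (\<integral>x. cnj (h x) * g x \<partial>M)"
    using f g h by (intro integral_cong_AE) (auto simp: sq_integrable_def intro!: borel_measurable_times sq_integrable_measurable[OF sq_integrable_cnj])
  moreover have "c i * (\<integral>x. cnj (h x) * e i x \<partial>M) = cnj (\<integral>x. cnj (e i x) * h x \<partial>M) * (\<integral>x. cnj (e i x) * f x \<partial>M) / v" for i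
    by (subst Bochner_Integration.integral_cnj[symmetric]) (simp add: c_def mult_ac)
  ultimately show ?thesis using gs[OF h] by simp
qed

end

section \<open>The box, the dual lattice and its characters\<close>

text \<open>Isolating the point map from \<open>perext\<close> lets measurability and translation
  invariance be proved once, independently of the function that is periodised.\<close>

definition wrap :: "real \<Rightarrow> real^'d \<Rightarrow> real^'d" where
  "wrap L x = (\<chi> i. x $ i - L * of_int \<lfloor>x $ i / L + 1 / 2\<rfloor>)"

definition lattice_vec :: "real \<Rightarrow> int^'d \<Rightarrow> real^'d" where
  "lattice_vec L k = (\<chi> i. L * of_int (k $ i))"

definition chr :: "real^'d \<Rightarrow> real^'d \<Rightarrow> complex" where
  "chr p x = exp (2 * pi * \<i> * complex_of_real (p \<bullet> x))"

text \<open>The completed measure is used because \<open>L2_on\<close> provides only Lebesgue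
  measurability. Borel integrands are moved to \<open>lborel\<close> when translations are
  involved.\<close>

abbreviation leb_box :: "real \<Rightarrow> (real^'d) measure" where
  "leb_box L \<equiv> lebesgue_on (box_L L)"

lemma perext_wrap: "perext L h x = h (wrap L x)"
  by (simp add: perext_def wrap_def)

section \<open>Reduction modulo the period lattice\<close>

text \<open>Both inequalities rearrange to m \<le> t / L + 1/2 < m + 1. The half-open interval is
  what makes the integer unique; both the wrapping and the tiling facts rest on this.\<close>

lemma floor_shift_iff:
  fixes t L :: real
  assumes "L > 0"
  shows "- L / 2 \<le> t - L * of_int m \<and> t - L * of_int m < L / 2 \<longleftrightarrow> m = \<lfloor>t / L + 1 / 2\<rfloor>"
proof -
  have "- L / 2 \<le> t - L * of_int m \<longleftrightarrow> of_int m \<le> t / L + 1 / 2"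
    using assms by (simp add: field_simps)
  moreover have "t - L * of_int m < L / 2 \<longleftrightarrow> t / L + 1 / 2 < of_int m + 1"
    using assms by (simp add: field_simps)
  ultimately show ?thesis by (metis floor_eq_iff)
qed

lemma wrap_in_box: "L > 0 \<Longrightarrow> wrap L x \<in> box_L L"
  using floor_shift_iff[of L] by (simp add: box_L_def wrap_def)

lemma wrap_id:
  assumes "L > 0" "x \<in> box_L L" shows "wrap L x = x"
proof -
  have "\<lfloor>x $ i / L + 1 / 2\<rfloor> = 0" for i
    using floor_shift_iff[of L "x $ i" 0] assms by (auto simp: box_L_def)
  then show ?thesis by (simp add: wrap_def vec_eq_iff)
qed

lemma wrap_eq: "wrap L x = x - lattice_vec L (\<chi> i. \<lfloor>x $ i / L + 1 / 2\<rfloor>)"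
  by (simp add: wrap_def lattice_vec_def vec_eq_iff)

lemma wrap_shift:
  assumes "L > 0" shows "wrap L (x + lattice_vec L k) = wrap L x"
proof -
  have "(x $ i + L * of_int (k $ i)) / L + 1 / 2 = (x $ i / L + 1 / 2) + of_int (k $ i)" for i
    using assms by (simp add: field_simps)
  then show ?thesis
    by (simp add: wrap_def lattice_vec_def vec_eq_iff algebra_simps del: floor_add_int)
qed

lemma wrap_measurable[measurable]: "wrap L \<in> borel_measurable borel"
proof (rule borel_measurable_euclidean_space[THEN iffD2, rule_format])
  fix b :: "real^'d" assume "b \<in> Basis"
  then obtain i where b: "b = axis i 1" by (auto simp: Basis_vec_def)
  have "(\<lambda>x::real^'d. x $ i) \<in> borel_measurable borel"
    by (intro borel_measurable_continuous_onI continuous_intros)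
  then have "(\<lambda>x::real^'d. x $ i - L * of_int \<lfloor>x $ i / L + 1 / 2\<rfloor>) \<in> borel_measurable borel"
    by measurable
  then show "(\<lambda>x. wrap L x \<bullet> b) \<in> borel_measurable borel"
    by (simp add: b wrap_def inner_axis)
qed

section \<open>Measure of the box and invariance under wrapped translations\<close>

lemma nn_integral_vec_prod:
  fixes f :: "'d::finite \<Rightarrow> real \<Rightarrow> ennreal"
  assumes [measurable]: "\<And>i. f i \<in> borel_measurable borel"
  shows "(\<integral>\<^sup>+x. (\<Prod>i\<in>UNIV. f i ((x::real^'d) $ i)) \<partial>lborel) = (\<Prod>i\<in>UNIV. \<integral>\<^sup>+t. f i t \<partial>lborel)"
proof -
  define ix :: "real^'d \<Rightarrow> 'd" where "ix = inv (\<lambda>i. axis i 1)"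
  have inj: "inj (\<lambda>i::'d. axis i (1::real))"
    by (auto simp: inj_def axis_eq_axis)
  have ix: "ix (axis i 1) = i" for i
    unfolding ix_def by (rule inv_f_f[OF inj])
  have B: "(Basis :: (real^'d) set) = range (\<lambda>i. axis i 1)"
    by (auto simp: Basis_vec_def)
  have "(\<integral>\<^sup>+x. (\<Prod>b\<in>Basis. f (ix b) ((x::real^'d) \<bullet> b)) \<partial>lborel) = (\<Prod>b\<in>(Basis::(real^'d) set). \<integral>\<^sup>+t. f (ix b) t \<partial>lborel)"
    by (rule nn_integral_lborel_prod) auto
  then show ?thesis
    by (simp add: B prod.reindex[OF inj] ix inner_axis)
qed

lemma box_L_prod_indicator:
  "indicator (box_L L) x = (\<Prod>i\<in>UNIV. indicator {-L/2..<L/2} (x $ i) :: ennreal)"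
proof (cases "x \<in> box_L L")
  case True
  then show ?thesis by (auto simp: box_L_def indicator_def)
next
  case False
  then obtain i where "x $ i \<notin> {-L/2..<L/2}" by (auto simp: box_L_def)
  then have "(\<Prod>i\<in>UNIV. indicator {-L/2..<L/2} (x $ i) :: ennreal) = 0"
    by (intro prod_zero) (auto simp: indicator_def)
  with False show ?thesis by simp
qed

lemma box_L_borel[measurable]: "box_L L \<in> sets borel"
proof -
  have "(\<lambda>x::real^'d. x $ i) \<in> borel_measurable borel" for i
    by (intro borel_measurable_continuous_onI continuous_intros)
  then have [measurable]: "{x::real^'d. - L / 2 \<le> x $ i \<and> x $ i < L / 2} \<in> sets borel" for i
    by measurable
  have "box_L L = (\<Inter>i. {x::real^'d. - L / 2 \<le> x $ i \<and> x $ i < L / 2})"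
    by (auto simp: box_L_def)
  also have "\<dots> \<in> sets borel"
    by (intro sets.countable_INT'') auto
  finally show ?thesis .
qed

lemma box_L_lebesgue[measurable]: "box_L L \<in> sets lebesgue"
  using box_L_borel[of L] by simp

lemma emeasure_box_L:
  assumes "L > 0"
  shows "emeasure lborel (box_L L :: (real^'d) set) = ennreal (L ^ CARD('d))"
proof -
  have "emeasure lborel (box_L L :: (real^'d) set) = (\<integral>\<^sup>+x. (\<Prod>i\<in>UNIV. indicator {-L/2..<L/2} ((x::real^'d) $ i)) \<partial>lborel)"
    unfolding box_L_prod_indicator[symmetric] by simp
  also have "\<dots> = (\<Prod>i\<in>(UNIV::'d set). ennreal L)"
    using assms by (subst nn_integral_vec_prod) auto
  finally show ?thesis using assms by (simp add: ennreal_power)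
qed

lemma emeasure_leb_box:
  "L > 0 \<Longrightarrow> emeasure (leb_box L) (box_L L :: (real^'d) set) = ennreal (L ^ CARD('d))"
  by (simp add: emeasure_restrict_space emeasure_box_L)

lemma finite_measure_leb_box: "L > 0 \<Longrightarrow> finite_measure (leb_box L)"
  by (rule finite_measureI) (simp add: emeasure_leb_box)

lemma measure_leb_box: "L > 0 \<Longrightarrow> measure (leb_box L) (box_L L :: (real^'d) set) = L ^ CARD('d)"
  by (simp add: measure_def emeasure_leb_box)

lemma borel_measurable_leb_box:
  fixes f :: "_ \<Rightarrow> 'b::topological_space"
  assumes "f \<in> borel_measurable borel" shows "f \<in> borel_measurable (leb_box L)"
  by (rule measurable_restrict_space1, rule measurable_completion) (use assms in simp)

lemma nn_integral_lborel_shift: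
  assumes [measurable]: "f \<in> borel_measurable borel"
  shows "(\<integral>\<^sup>+x. f (x + a) \<partial>lborel) = (\<integral>\<^sup>+x. f (x::real^'d) \<partial>lborel)"
proof -
  have "(\<integral>\<^sup>+x. f x \<partial>lborel) = (\<integral>\<^sup>+x. f x \<partial>distr lborel borel ((+) a))"
    by (simp add: lborel_distr_plus)
  also have "\<dots> = (\<integral>\<^sup>+x. f (x + a) \<partial>lborel)"
    by (subst nn_integral_distr) (auto simp: add.commute)
  finally show ?thesis ..
qed

text \<open>Exactly one lattice translate of the box contains a given point. Writing this as an
  integral over counting measure yields a partition of unity that Tonelli's theorem can interchange
  with the integral over space.\<close>

lemma lattice_tile:
  assumes "L > 0"
  shows "(\<integral>\<^sup>+k. indicator (box_L L) (x - lattice_vec L k) \<partial>count_space UNIV) = (1::ennreal)"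
    and "(\<integral>\<^sup>+k. indicator (box_L L) (x + lattice_vec L k) \<partial>count_space UNIV) = (1::ennreal)"
proof -
  define m :: "int^'a" where "m = (\<chi> i. \<lfloor>x $ i / L + 1 / 2\<rfloor>)"
  have 1: "x - lattice_vec L k \<in> box_L L \<longleftrightarrow> k = m" for k
    using floor_shift_iff[OF assms, of "x $ _" "k $ _"] by (simp add: box_L_def lattice_vec_def m_def vec_eq_iff)
  have "x - lattice_vec L (- k) = x + lattice_vec L k" for k
    by (simp add: lattice_vec_def vec_eq_iff)
  then have 2: "x + lattice_vec L k \<in> box_L L \<longleftrightarrow> k = - m" for k
    using 1[of "- k"] by (metis minus_equation_iff)
  have *: "(\<integral>\<^sup>+k. indicator {a} k \<partial>count_space UNIV) = (1::ennreal)" for a :: "int^'a"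
    by (subst nn_integral_indicator) auto
  have "(\<lambda>k. indicator (box_L L) (x - lattice_vec L k) :: ennreal) = indicator {m}"
    using 1 by (auto simp: fun_eq_iff indicator_def)
  then show "(\<integral>\<^sup>+k. indicator (box_L L) (x - lattice_vec L k) \<partial>count_space UNIV) = (1::ennreal)"
    using * by simp
  have "(\<lambda>k. indicator (box_L L) (x + lattice_vec L k) :: ennreal) = indicator {- m}"
    using 2 by (auto simp: fun_eq_iff indicator_def)
  then show "(\<integral>\<^sup>+k. indicator (box_L L) (x + lattice_vec L k) \<partial>count_space UNIV) = (1::ennreal)"
    using * by simp
qed

text \<open>The shifted box and the original box are both fundamental domains of a periodic
  function. Inserting the partition of unity from \<open>lattice_tile\<close> and translating every
  piece by its lattice vector moves the integral from one domain to the other.\<close>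

lemma nn_integral_wrap_shift:
  fixes f :: "real^'d \<Rightarrow> ennreal"
  assumes "L > 0" and [measurable]: "f \<in> borel_measurable borel"
  shows "(\<integral>\<^sup>+x. indicator (box_L L) x * f (wrap L (x - y)) \<partial>lborel) = (\<integral>\<^sup>+x. indicator (box_L L) x * f x \<partial>lborel)"
proof -
  let ?I = "indicator (box_L L) :: real^'d \<Rightarrow> ennreal"
  define F where "F x = f (wrap L x)" for x
  have [measurable]: "F \<in> borel_measurable borel" unfolding F_def by measurable
  have per: "F (x + lattice_vec L k) = F x" for x k
    by (simp add: F_def wrap_shift[OF assms(1)])
  have "(\<integral>\<^sup>+x. ?I x * F (x - y) \<partial>lborel) = (\<integral>\<^sup>+x. ?I (x + y) * F (x + y - y) \<partial>lborel)"
    by (rule nn_integral_lborel_shift[symmetric]) measurable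
  also have "\<dots> = (\<integral>\<^sup>+x. (\<integral>\<^sup>+k. ?I (x - lattice_vec L k) * (?I (x + y) * F x) \<partial>count_space UNIV) \<partial>lborel)"
    by (simp add: nn_integral_multc lattice_tile[OF assms(1)])
  also have "\<dots> = (\<integral>\<^sup>+k. (\<integral>\<^sup>+x. ?I (x - lattice_vec L k) * (?I (x + y) * F x) \<partial>lborel) \<partial>count_space UNIV)"
    by (rule nn_integral_count_space_nn_integral) auto
  also have "\<dots> = (\<integral>\<^sup>+k. (\<integral>\<^sup>+x. ?I x * (?I (x + y + lattice_vec L k) * F x) \<partial>lborel) \<partial>count_space UNIV)"
  proof (rule nn_integral_cong)
    fix k :: "int^'d"
    have "(\<integral>\<^sup>+x. ?I (x - lattice_vec L k) * (?I (x + y) * F x) \<partial>lborel)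
        = (\<integral>\<^sup>+x. ?I (x + lattice_vec L k - lattice_vec L k) * (?I (x + lattice_vec L k + y) * F (x + lattice_vec L k)) \<partial>lborel)"
      by (rule nn_integral_lborel_shift[symmetric]) measurable
    then show "(\<integral>\<^sup>+x. ?I (x - lattice_vec L k) * (?I (x + y) * F x) \<partial>lborel)
        = (\<integral>\<^sup>+x. ?I x * (?I (x + y + lattice_vec L k) * F x) \<partial>lborel)"
      by (simp add: per add_ac)
  qed
  also have "\<dots> = (\<integral>\<^sup>+x. (\<integral>\<^sup>+k. ?I x * (?I (x + y + lattice_vec L k) * F x) \<partial>count_space UNIV) \<partial>lborel)"
    by (rule nn_integral_count_space_nn_integral[symmetric]) auto
  also have "\<dots> = (\<integral>\<^sup>+x. ?I x * F x \<partial>lborel)"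
    by (simp add: nn_integral_cmult nn_integral_multc lattice_tile[OF assms(1)])
  also have "\<dots> = (\<integral>\<^sup>+x. ?I x * f x \<partial>lborel)"
    by (intro nn_integral_cong) (auto simp: F_def indicator_def wrap_id[OF assms(1)])
  finally show ?thesis by (simp add: F_def)
qed

lemma integral_leb_box:
  fixes f :: "real^'d \<Rightarrow> 'b::{banach, second_countable_topology}"
  assumes [measurable]: "f \<in> borel_measurable borel"
  shows "integral\<^sup>L (leb_box L) f = integral\<^sup>L (density lborel (\<lambda>x. ennreal (indicator (box_L L) x))) f"
proof -
  have "integral\<^sup>L (leb_box L) f = integral\<^sup>L lebesgue (\<lambda>x. indicator (box_L L) x *\<^sub>R f x)"
    by (rule integral_restrict_space) simp
  also have "\<dots> = integral\<^sup>L lborel (\<lambda>x. indicator (box_L L) x *\<^sub>R f x)"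
    by (rule integral_completion) measurable
  finally show ?thesis by (subst integral_density) auto
qed

text \<open>The nonnegative case, applied to indicators, says that the wrapped translation preserves
  the measure of the box. Invariance of Bochner integrals is then the change of variables for the
  image measure.\<close>

lemma integral_wrap_shift:
  fixes f :: "real^'d \<Rightarrow> 'b::{banach, second_countable_topology}"
  assumes "L > 0" and [measurable]: "f \<in> borel_measurable borel"
  shows "integral\<^sup>L (leb_box L) (\<lambda>x. f (wrap L (x - y))) = integral\<^sup>L (leb_box L) f"
proof -
  let ?m = "density lborel (\<lambda>x::real^'d. ennreal (indicator (box_L L) x))"
  have "distr ?m borel (\<lambda>x. wrap L (x - y)) = ?m"
  proof (rule measure_eqI)
    fix A assume "A \<in> sets (distr ?m borel (\<lambda>x. wrap L (x - y)))"
    then have A[measurable]: "A \<in> sets borel" by simp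
    have "emeasure (distr ?m borel (\<lambda>x. wrap L (x - y))) A = (\<integral>\<^sup>+x. indicator A x \<partial>distr ?m borel (\<lambda>x. wrap L (x - y)))"
      by simp
    also have "\<dots> = (\<integral>\<^sup>+x. indicator A (wrap L (x - y)) \<partial>?m)"
      by (rule nn_integral_distr) measurable
    also have "\<dots> = (\<integral>\<^sup>+x. ennreal (indicator (box_L L) x) * indicator A (wrap L (x - y)) \<partial>lborel)"
      by (rule nn_integral_density) measurable
    also have "\<dots> = (\<integral>\<^sup>+x. indicator (box_L L) x * indicator A x \<partial>lborel)"
      unfolding ennreal_indicator by (rule nn_integral_wrap_shift[OF assms(1)]) measurable
    also have "\<dots> = emeasure ?m A"
      by (simp add: emeasure_density ennreal_indicator)
    finally show "emeasure (distr ?m borel (\<lambda>x. wrap L (x - y))) A = emeasure ?m A" .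
  qed simp
  then have "integral\<^sup>L ?m f = integral\<^sup>L (distr ?m borel (\<lambda>x. wrap L (x - y))) f" by simp
  also have "\<dots> = integral\<^sup>L ?m (\<lambda>x. f (wrap L (x - y)))"
    by (rule integral_distr) measurable
  finally show ?thesis
    by (simp add: integral_leb_box)
qed

section \<open>Characters of the dual lattice and their orthogonality\<close>

lemma norm_chr[simp]: "cmod (chr p x) = 1"
  by (simp add: chr_def norm_exp_eq_Re)

lemma cnj_chr: "cnj (chr p x) = exp (- (2 * pi * \<i> * complex_of_real (p \<bullet> x)))"
  by (simp add: chr_def exp_cnj)

lemma cnj_chr_minus: "cnj (chr p x) = chr (- p) x"
  unfolding cnj_chr by (simp add: chr_def inner_minus_left)

lemma chr_add_right: "chr p (x + y) = chr p x * chr p y"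
  by (simp add: chr_def inner_add_right distrib_left exp_add)

lemma chr_add_left: "chr (p + q) x = chr p x * chr q x"
  by (simp add: chr_def inner_add_left distrib_left exp_add)

lemma chr_diff_left: "chr (p - q) x = chr p x * cnj (chr q x)"
  using chr_add_left[of p "- q" x] by (simp add: cnj_chr_minus)

lemma chr_zero[simp]: "chr 0 x = 1" "chr p 0 = 1"
  by (simp_all add: chr_def)

lemma chr_sum_left: "chr (\<Sum>i\<in>I. p i) x = (\<Prod>i\<in>I. chr (p i) x)"
  by (induction I rule: infinite_finite_induct) (auto simp: chr_add_left)

lemma chr_measurable[measurable]: "chr p \<in> borel_measurable borel"
  unfolding chr_def by (intro borel_measurable_continuous_onI continuous_intros)

lemma chr_lattice:
  assumes "p \<in> dual_L L" "L > 0" shows "chr p (lattice_vec L k) = 1"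
proof -
  obtain m where m: "\<And>i. p $ i = of_int (m i) / L"
    using assms(1) unfolding dual_L_def by (auto simp: choice_iff)
  have "p \<bullet> lattice_vec L k = of_int (\<Sum>i\<in>UNIV. m i * k $ i)"
    using assms(2) by (simp add: inner_vec_def lattice_vec_def m)
  then show ?thesis
    unfolding chr_def using exp_integer_2pi[of "of_int (\<Sum>i\<in>UNIV. m i * k $ i)"]
    by (simp only: of_real_of_int_eq Ints_of_int) (simp add: mult_ac)
qed

lemma chr_wrap:
  assumes "p \<in> dual_L L" "L > 0" shows "chr p (wrap L x) = chr p x"
proof -
  have "chr p x = chr p (wrap L x + lattice_vec L (\<chi> i. \<lfloor>x $ i / L + 1 / 2\<rfloor>))"
    by (simp add: wrap_eq)
  then show ?thesis by (simp add: chr_add_right chr_lattice[OF assms])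
qed

lemma dual_L_diff: "p \<in> dual_L L \<Longrightarrow> q \<in> dual_L L \<Longrightarrow> p - q \<in> dual_L L"
  unfolding dual_L_def by (auto simp: diff_divide_distrib) (metis diff_divide_distrib of_int_diff)

lemma dual_L_0: "0 \<in> dual_L L"
  unfolding dual_L_def by (auto intro: exI[of _ 0])

lemma dual_L_uminus: "p \<in> dual_L L \<Longrightarrow> - p \<in> dual_L L"
  using dual_L_diff[OF dual_L_0, of p L] by simp

lemma dual_L_sum: "(\<And>i. i \<in> I \<Longrightarrow> p i \<in> dual_L L) \<Longrightarrow> (\<Sum>i\<in>I. p i) \<in> dual_L L"
proof (induction I rule: infinite_finite_induct)
  case (insert i I)
  then have "p i - - sum p I \<in> dual_L L" by (intro dual_L_diff dual_L_uminus) auto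
  with insert show ?case by simp
qed (auto simp: dual_L_0)

text \<open>Translating by a vector of phase -1 flips the sign of the integral, so it vanishes.\<close>
lemma integral_chr:
  assumes "L > 0" "p \<in> dual_L L"
  shows "(\<integral>x. chr p (x::real^'d) \<partial>leb_box L) = (if p = 0 then complex_of_real (L ^ CARD('d)) else 0)"
proof (cases "p = 0")
  case True
  then show ?thesis using measure_leb_box[OF assms(1), where ?'d='d] by (simp add: scaleR_conv_of_real)
next
  case False
  define y where "y = (1 / (2 * (p \<bullet> p))) *\<^sub>R p"
  have "p \<bullet> y = 1 / 2" using False by (simp add: y_def)
  then have y: "chr p y = -1" unfolding chr_def by (simp only:) (simp add: mult_ac)
  have "(\<integral>x. chr p x \<partial>leb_box L) = (\<integral>x. chr p (wrap L (x - (- y))) \<partial>leb_box L)"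
    by (rule integral_wrap_shift[OF assms(1), symmetric]) measurable
  also have "\<dots> = - (\<integral>x. chr p x \<partial>leb_box L)"
    by (simp add: chr_wrap[OF assms(2,1)] chr_add_right y)
  finally show ?thesis using False by simp
qed

lemma integral_chr_orth:
  assumes "L > 0" "p \<in> dual_L L" "q \<in> dual_L L"
  shows "(\<integral>x. cnj (chr p x) * chr q (x::real^'d) \<partial>leb_box L) = (if p = q then complex_of_real (L ^ CARD('d)) else 0)"
proof -
  have "(\<integral>x. cnj (chr p x) * chr q x \<partial>leb_box L) = (\<integral>x. chr (q - p) x \<partial>leb_box L)"
    by (simp add: chr_diff_left mult.commute)
  then show ?thesis
    using integral_chr[OF assms(1) dual_L_diff[OF assms(3,2)]] by auto
qed

lemma sq_integrable_chr: "L > 0 \<Longrightarrow> sq_integrable (leb_box L) (chr p)"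
  by (rule finite_measure.sq_integrable_bounded[OF finite_measure_leb_box, where C=1])
     (auto intro: borel_measurable_leb_box)

section \<open>From gauge integrals to Lebesgue integrals\<close>

text \<open>The two notions meet because a nonnegative function is gauge integrable exactly if it is
  absolutely integrable.\<close>

lemma L2_on_iff: "L2_on (box_L L) f \<longleftrightarrow> sq_integrable (leb_box L) f"
proof -
  have "(\<lambda>x. (cmod (f x))\<^sup>2) integrable_on box_L L \<longleftrightarrow> integrable (leb_box L) (\<lambda>x. (cmod (f x))\<^sup>2)"
    by (subst absolutely_integrable_on_iff_nonneg[symmetric])
       (auto simp: set_integrable_def integrable_restrict_space)
  then show ?thesis
    by (simp add: L2_on_def sq_integrable_def measurable_on_iff_borel_measurable)
qed

lemma L2_on_box_of_UNIV:
  assumes "L2_on UNIV f" shows "sq_integrable (leb_box L) f"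
proof -
  have m: "f \<in> borel_measurable lebesgue"
    using assms by (simp add: L2_on_def measurable_on_iff_borel_measurable lebesgue_on_UNIV_eq)
  have i: "(\<lambda>x. (cmod (f x))\<^sup>2) absolutely_integrable_on UNIV"
    using assms by (subst absolutely_integrable_on_iff_nonneg) (auto simp: L2_on_def)
  have "(\<lambda>x. (cmod (f x))\<^sup>2) absolutely_integrable_on box_L L"
    by (rule set_integrable_subset[OF i]) auto
  then show ?thesis
    using measurable_restrict_space1[OF m] by (simp add: sq_integrable_def set_integrable_def integrable_restrict_space)
qed

lemma fourier_L_eq:
  assumes "L > 0" "sq_integrable (leb_box L) h"
  shows "fourier_L L h p = (\<integral>x. cnj (chr p x) * h x \<partial>leb_box L)"
proof -
  have "fourier_L L h p = integral (box_L L) (\<lambda>x. cnj (chr p x) * h x)"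
    unfolding fourier_L_def by (rule integral_cong) (simp add: cnj_chr perext_wrap wrap_id[OF assms(1)])
  also have "\<dots> = (\<integral>x. cnj (chr p x) * h x \<partial>leb_box L)"
    by (rule lebesgue_integral_eq_integral[symmetric])
       (auto intro!: sq_integrable_mult sq_integrable_cnj sq_integrable_chr assms)
  finally show ?thesis .
qed

lemma fourier_L_perext: "L > 0 \<Longrightarrow> fourier_L L (perext L h) p = fourier_L L h p"
  unfolding fourier_L_def by (rule integral_cong) (simp add: perext_wrap wrap_id wrap_in_box)

lemma inner_L_eq:
  assumes "sq_integrable (leb_box L) f" "sq_integrable (leb_box L) g"
  shows "inner_L L f g = (\<integral>x. cnj (f x) * g x \<partial>leb_box L)"
  unfolding inner_L_def
  by (rule lebesgue_integral_eq_integral[symmetric]) (auto intro!: sq_integrable_mult sq_integrable_cnj assms)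

lemma sq_integrable_perext:
  assumes "L > 0" shows "sq_integrable (leb_box L) (perext L h) \<longleftrightarrow> sq_integrable (leb_box L) h"
proof -
  have "perext L h x = h x" if "x \<in> space (leb_box L)" for x
    using that by (simp add: perext_wrap wrap_id[OF assms])
  then show ?thesis
    unfolding sq_integrable_def
    by (intro conj_cong measurable_cong Bochner_Integration.integrable_cong) auto
qed

section \<open>Completeness of the characters\<close>

text \<open>Trigonometric polynomials. The inductive form lets orthogonality to all characters pass
  to them by rule induction; closure under products comes from the additive group structure of the
  dual lattice.\<close>

inductive trig :: "real \<Rightarrow> (real^'d \<Rightarrow> complex) \<Rightarrow> bool" for L where
  trig_chr: "p \<in> dual_L L \<Longrightarrow> trig L (\<lambda>x. c * chr p x)"
| trig_add: "trig L f \<Longrightarrow> trig L g \<Longrightarrow> trig L (\<lambda>x. f x + g x)"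

lemma trig_const: "trig L (\<lambda>x. c)"
  using trig_chr[OF dual_L_0, of L c] by simp

lemma trig_mult:
  assumes "trig L f" "trig L g" shows "trig L (\<lambda>x. f x * g x)"
  using assms(1)
proof induction
  case (trig_chr p c)
  show ?case
    using assms(2)
  proof induction
    case (trig_chr q c')
    have "p + q \<in> dual_L L"
      using dual_L_diff[OF \<open>p \<in> dual_L L\<close> dual_L_uminus[OF trig_chr]] by simp
    from trig.trig_chr[OF this, of "c * c'"] show ?case
      by (simp add: chr_add_left mult_ac)
  next
    case (trig_add f g)
    from trig.trig_add[OF trig_add.IH] show ?case by (simp add: distrib_left)
  qed
next
  case (trig_add f1 f2)
  from trig.trig_add[OF trig_add.IH] show ?case by (simp add: distrib_right)
qed

lemma trig_sum: "(\<And>i. i \<in> I \<Longrightarrow> trig L (f i)) \<Longrightarrow> trig L (\<lambda>x. \<Sum>i\<in>I. f i x)"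
  by (induction I rule: infinite_finite_induct) (auto intro: trig_const trig_add)

text \<open>Embeds the box into a product of unit circles inside a Euclidean space, where real
  polynomials approximate continuous functions on compact sets and restrict to trigonometric
  polynomials.\<close>

definition torus :: "real \<Rightarrow> real^'d \<Rightarrow> complex^'d" where
  "torus L x = (\<chi> j. exp (- (2 * pi * \<i> * complex_of_real (x $ j / L))))"

lemma torus_component: "torus L x $ j = chr (axis j (- 1 / L)) x"
  by (simp add: torus_def chr_def inner_axis inner_commute[of "axis _ _"])

lemma axis_dual_L: "axis j (of_int m / L) \<in> dual_L L"
  unfolding dual_L_def by (auto simp: axis_def intro: exI[of _ 0])

text \<open>Sums and products are preserved by \<open>trig\<close>, so only linear functionals need
  an argument: the real and imaginary parts of a coordinate are combinations of a character and its
  conjugate.\<close>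

lemma trig_real_polynomial_torus:
  assumes "real_polynomial_function g"
  shows "trig L (\<lambda>x. complex_of_real (g (torus L (x::real^'d))))"
  using assms
proof induction
  case (linear f)
  have f: "linear f" using linear by (rule bounded_linear.linear)
  have fw: "f w = (\<Sum>b\<in>Basis. (w \<bullet> b) * f b)" for w
  proof -
    have "f w = f (\<Sum>b\<in>Basis. (w \<bullet> b) *\<^sub>R b)" by (simp add: euclidean_representation)
    then show ?thesis by (simp add: linear_sum[OF f] linear_scale[OF f])
  qed
  have tb: "trig L (\<lambda>x. complex_of_real (torus L (x::real^'d) \<bullet> b))" if b: "b \<in> Basis" for b
  proof -
    obtain j u where b': "b = axis j u" "u \<in> {1, \<i>}"
      using b by (auto simp: Basis_vec_def Basis_complex_def)
    have t1: "trig L (\<lambda>x. c * chr (axis j (- 1 / L)) x)" for c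
      using trig_chr[OF axis_dual_L[of j "-1" L]] by simp
    have t2: "trig L (\<lambda>x. c * cnj (chr (axis j (- 1 / L)) x))" for c
      using trig_chr[OF dual_L_uminus[OF axis_dual_L[of j "-1" L]]] by (simp add: cnj_chr_minus)
    have "complex_of_real (torus L x \<bullet> b) =
      (if u = 1 then 1/2 else 1/(2*\<i>)) * chr (axis j (- 1 / L)) x + (if u = 1 then 1/2 else - 1/(2*\<i>)) * cnj (chr (axis j (- 1 / L)) x)" for x
      using b' by (auto simp: inner_axis torus_component inner_complex_def complex_eq_iff)
    then show ?thesis by (simp only:) (intro trig_add t1 t2)
  qed
  have "trig L (\<lambda>x. \<Sum>b\<in>Basis. complex_of_real (torus L (x::real^'d) \<bullet> b) * complex_of_real (f b))"
    by (rule trig_sum) (rule trig_mult[OF tb trig_const])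
  moreover have "(\<lambda>x. complex_of_real (f (torus L x)))
      = (\<lambda>x. \<Sum>b\<in>Basis. complex_of_real (torus L (x::real^'d) \<bullet> b) * complex_of_real (f b))"
    by (subst fw) simp
  ultimately show ?case by simp
next
  case (const c)
  then show ?case by (rule trig_const)
next
  case (add f g)
  then show ?case by (simp add: trig_add)
next
  case (mult f g)
  then show ?case by (simp add: trig_mult)
qed

lemma continuous_torus: "continuous_on UNIV (torus L)"
proof -
  have *: "torus L = (\<lambda>x. \<chi> j. chr (axis j (- 1 / L)) x)"
    by (auto simp: vec_eq_iff torus_component)
  show ?thesis unfolding * chr_def by (intro continuous_intros)
qed

lemma torus_measurable[measurable]: "torus L \<in> borel_measurable borel"
  by (rule borel_measurable_continuous_onI[OF continuous_torus])

lemma norm_torus: "norm (torus L (x::real^'d)) \<le> CARD('d)"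
proof -
  have "norm (torus L x) \<le> (\<Sum>j\<in>UNIV. norm (torus L x $ j))"
    unfolding norm_vec_def by (rule L2_set_le_sum) auto
  then show ?thesis by (simp add: torus_component)
qed

text \<open>A measurable inverse shows that the Borel subsets of the box are the preimages of Borel
  sets under \<open>torus L\<close>, so that testing on such preimages loses nothing.\<close>

lemma torus_left_inverse:
  assumes "L > 0"
  obtains G :: "complex^'d \<Rightarrow> real^'d" where "G \<in> borel_measurable borel" "\<And>x. x \<in> box_L L \<Longrightarrow> G (torus L x) = x"
proof -
  \<comment> \<open>The angle divided by \<open>2 * pi\<close>. Since \<open>torus\<close> uses
    exp(-i \<theta>), a nonnegative imaginary part means \<theta> \<le> 0; including Im = 0 in this
    case sends the point -1 to -1/2, the face that belongs to the half-open box. Clamping the real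
    part makes \<open>arccos\<close> continuous, hence Borel, on the whole plane.\<close>
  define \<tau> :: "complex \<Rightarrow> real" where
    "\<tau> w = (if 0 \<le> Im w then -1 else 1) * arccos (max (-1) (min 1 (Re w))) / (2 * pi)" for w
  define G :: "complex^'d \<Rightarrow> real^'d" where "G w = (\<chi> j. L * \<tau> (w $ j))" for w
  have "continuous_on UNIV (\<lambda>w. arccos (max (-1) (min 1 (Re w))))"
    by (rule continuous_on_compose2[OF continuous_on_arccos'])
       (auto intro!: continuous_intros)
  then have [measurable]: "(\<lambda>w. arccos (max (-1) (min 1 (Re w)))) \<in> borel_measurable borel"
    by (rule borel_measurable_continuous_onI)
  have [measurable]: "\<tau> \<in> borel_measurable borel"
    unfolding \<tau>_def by measurable
  have "G \<in> borel_measurable borel"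
  proof (rule borel_measurable_euclidean_space[THEN iffD2, rule_format])
    fix b :: "real^'d" assume "b \<in> Basis"
    then obtain i where b: "b = axis i 1" by (auto simp: Basis_vec_def)
    have [measurable]: "(\<lambda>x::complex^'d. x $ i) \<in> borel_measurable borel"
      by (intro borel_measurable_continuous_onI continuous_intros)
    have "(\<lambda>x::complex^'d. L * \<tau> (x $ i)) \<in> borel_measurable borel"
      by measurable
    then show "(\<lambda>x. G x \<bullet> b) \<in> borel_measurable borel"
      by (simp add: b G_def inner_axis)
  qed
  moreover have "G (torus L x) = x" if x: "x \<in> box_L L" for x
  proof -
    have "L * \<tau> (torus L x $ j) = x $ j" for j
    proof -
      define \<theta> where "\<theta> = 2 * pi * (x $ j / L)"
      have xL: "- 1 / 2 \<le> x $ j / L" "x $ j / L < 1 / 2"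
        using x assms by (auto simp: box_L_def field_simps)
      have "2 * pi * (- 1 / 2) \<le> \<theta>" unfolding \<theta>_def by (rule mult_left_mono[OF xL(1)]) simp
      moreover have "\<theta> < 2 * pi * (1 / 2)" unfolding \<theta>_def by (rule mult_strict_left_mono[OF xL(2)]) simp
      ultimately have th: "- pi \<le> \<theta>" "\<theta> < pi" by simp_all
      have w: "torus L x $ j = exp (\<i> * complex_of_real (- \<theta>))"
        by (simp add: torus_def \<theta>_def mult_ac)
      have re: "Re (torus L x $ j) = cos \<theta>" and im: "Im (torus L x $ j) = - sin \<theta>"
        unfolding w exp_Euler by (simp_all add: Re_sin Im_cos Re_cos Im_sin cos_of_real sin_of_real)
      have "\<tau> (torus L x $ j) = \<theta> / (2 * pi)"
      proof (cases "\<theta> \<le> 0")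
        case True
        then have "sin \<theta> \<le> 0" using th sin_ge_zero[of "- \<theta>"] by simp
        moreover have "arccos (cos \<theta>) = - \<theta>" using arccos_cos[of "- \<theta>"] True th by simp
        ultimately show ?thesis by (simp add: \<tau>_def re im)
      next
        case False
        then have "sin \<theta> > 0" using th sin_gt_zero[of \<theta>] by simp
        moreover have "arccos (cos \<theta>) = \<theta>" using arccos_cos[of \<theta>] False th by simp
        ultimately show ?thesis by (simp add: \<tau>_def re im)
      qed
      then show ?thesis using assms by (simp add: \<theta>_def)
    qed
    then show ?thesis by (simp add: G_def vec_eq_iff)
  qed
  ultimately show ?thesis using that by blast
qed

text \<open>View integration of \<open>f\<close> over preimages under \<open>torus L\<close> as a
  complex measure on Borel sets. It vanishes against polynomials by hypothesis, against continuous
  functions by uniform approximation, on closed sets by dominated convergence, and on Borel sets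
  because closed sets are an intersection-stable generator. A density whose integrals all vanish is
  zero almost everywhere.\<close>

lemma fourier_complete:
  fixes f :: "real^'d \<Rightarrow> complex"
  assumes L: "L > 0" and f: "sq_integrable (leb_box L) f"
    and zero: "\<And>p. p \<in> dual_L L \<Longrightarrow> (\<integral>x. cnj (chr p x) * f x \<partial>leb_box L) = 0"
  shows "AE x in leb_box L. f x = 0"
proof -
  let ?M = "leb_box L :: (real^'d) measure"
  interpret finite_measure ?M by (rule finite_measure_leb_box[OF L])
  have fi: "integrable ?M f" by (rule sq_integrable_imp_integrable[OF f])
  then have [measurable]: "f \<in> borel_measurable ?M" by simp
  have m: "g \<in> borel_measurable borel \<Longrightarrow> g \<in> borel_measurable ?M" for g :: "real^'d \<Rightarrow> 'z::topological_space"
    by (rule borel_measurable_leb_box)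
  have Em[measurable]: "torus L \<in> borel_measurable ?M" by (rule m) simp
  have bnd: "integrable ?M (\<lambda>x. h x * f x)" if "h \<in> borel_measurable ?M" "\<And>x. cmod (h x) \<le> C" for h C
    by (rule Bochner_Integration.integrable_bound[of _ "\<lambda>x. C * cmod (f x)"])
       (use fi that in \<open>auto simp: norm_mult intro!: mult_right_mono order_trans[OF _ abs_ge_self]\<close>)
  have trig0: "integrable ?M (\<lambda>x. h x * f x) \<and> (\<integral>x. h x * f x \<partial>?M) = 0" if "trig L h" for h
    using that
  proof induction
    case (trig_chr p c)
    have "integrable ?M (\<lambda>x. chr p x * f x)"
      by (rule bnd[of _ 1]) (auto intro: m)
    moreover have "(\<integral>x. chr p x * f x \<partial>?M) = 0"
      using zero[OF dual_L_uminus[OF trig_chr]] by (simp add: cnj_chr_minus)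
    ultimately show ?case by (simp add: mult.assoc)
  next
    case (trig_add f g)
    then show ?case by (simp add: distrib_right)
  qed
  have cont0: "(\<integral>x. complex_of_real (g (torus L x)) * f x \<partial>?M) = 0"
    if g: "continuous_on UNIV g" for g :: "complex^'d \<Rightarrow> real"
  proof -
    define K where "K = (\<integral>x. cmod (f x) \<partial>?M)"
    have K: "K \<ge> 0" by (simp add: K_def)
    let ?S = "cball 0 (real CARD('d)) :: (complex^'d) set"
    have gm[measurable]: "g \<in> borel_measurable borel" by (rule borel_measurable_continuous_onI[OF g])
    have S: "torus L x \<in> ?S" for x using norm_torus[of L x] by simp
    have "compact (g ` ?S)" by (intro compact_continuous_image continuous_on_subset[OF g]) auto
    then obtain C where C: "\<And>w. w \<in> ?S \<Longrightarrow> \<bar>g w\<bar> \<le> C"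
      using compact_imp_bounded bounded_iff by (metis imageI real_norm_def)
    have gi: "integrable ?M (\<lambda>x. complex_of_real (g (torus L x)) * f x)"
      by (rule bnd[of _ C]) (use C S in auto)
    have "cmod (\<integral>x. complex_of_real (g (torus L x)) * f x \<partial>?M) \<le> e * K" if "e > 0" for e
    proof -
      \<comment> \<open>The polynomial \<open>q\<close> composed with \<open>torus L\<close>
        integrates to zero against \<open>f\<close>, so subtracting it leaves the integral
        unchanged, and the uniform error costs at most \<open>e\<close> times the L^1 norm of
        \<open>f\<close>.\<close>
      obtain q where q: "real_polynomial_function q" "\<And>w. w \<in> ?S \<Longrightarrow> \<bar>g w - q w\<bar> < e"
        using Stone_Weierstrass_real_polynomial_function[OF compact_cball continuous_on_subset[OF g] \<open>e > 0\<close>] by blast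
      note q0 = trig0[OF trig_real_polynomial_torus[OF q(1), of L]]
      have "(\<integral>x. complex_of_real (g (torus L x)) * f x \<partial>?M)
          = (\<integral>x. complex_of_real (g (torus L x)) * f x - complex_of_real (q (torus L x)) * f x \<partial>?M)"
        using gi q0 by simp
      also have "cmod \<dots> \<le> (\<integral>x. cmod (complex_of_real (g (torus L x)) * f x - complex_of_real (q (torus L x)) * f x) \<partial>?M)"
        by (rule integral_norm_bound)
      also have "\<dots> \<le> (\<integral>x. e * cmod (f x) \<partial>?M)"
      proof (rule Bochner_Integration.integral_mono)
        fix x
        have "cmod (complex_of_real (g (torus L x)) * f x - complex_of_real (q (torus L x)) * f x)
            = \<bar>g (torus L x) - q (torus L x)\<bar> * cmod (f x)"
          by (metis left_diff_distrib norm_mult norm_of_real of_real_diff)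
        also have "\<dots> \<le> e * cmod (f x)"
          using q(2)[OF S[of x]] by (intro mult_right_mono) auto
        finally show "cmod (complex_of_real (g (torus L x)) * f x - complex_of_real (q (torus L x)) * f x) \<le> e * cmod (f x)" .
      qed (use gi q0 fi in auto)
      finally show ?thesis by (simp add: K_def)
    qed
    note eK = this
    have "cmod (\<integral>x. complex_of_real (g (torus L x)) * f x \<partial>?M) \<le> 0"
    proof (rule field_le_epsilon)
      fix e :: real assume "e > 0"
      \<comment> \<open>Dividing by \<open>K + 1\<close> covers the case in which the norm
        \<open>K\<close> is zero.\<close>
      have "cmod (\<integral>x. complex_of_real (g (torus L x)) * f x \<partial>?M) \<le> e / (K + 1) * K"
        using K \<open>e > 0\<close> by (intro eK) simp
      also have "\<dots> \<le> 0 + e" using K \<open>e > 0\<close> by (simp add: field_simps)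
      finally show "cmod (\<integral>x. complex_of_real (g (torus L x)) * f x \<partial>?M) \<le> 0 + e" .
    qed
    then show ?thesis by simp
  qed
  define I where "I A = (\<integral>x. indicator (torus L -` A \<inter> box_L L) x *\<^sub>R f x \<partial>?M)" for A
  have set_in[measurable]: "torus L -` A \<inter> box_L L \<in> sets ?M" if "A \<in> sets borel" for A
    using measurable_sets[OF Em that] by simp
  have closed0: "I C = 0" if C: "closed C" for C
  \<comment> \<open>The distance to the empty set is 0 by convention, so the cutoffs below would be
    constantly 1 there instead of tending to the indicator.\<close>
  proof (cases "C = {}")
    case True
    then show ?thesis by (simp add: I_def)
  next
    case False
    \<comment> \<open>Continuous cutoffs, equal to 1 on \<open>C\<close> and to 0 at distance at
      least 1/n from it, so they decrease to the indicator of a closed set.\<close>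
    define g where "g n w = max 0 (1 - real n * infdist w C)" for n w
    have gc: "continuous_on UNIV (g n)" for n
      unfolding g_def by (intro continuous_intros)
    have gm[measurable]: "g n \<in> borel_measurable borel" for n by (rule borel_measurable_continuous_onI[OF gc])
    have "(\<lambda>n. \<integral>x. complex_of_real (g n (torus L x)) * f x \<partial>?M) \<longlonglongrightarrow> I C"
      unfolding I_def
    proof (rule integral_dominated_convergence)
      show "integrable ?M (\<lambda>x. cmod (f x))" using fi by simp
      show "(\<lambda>x. indicat_real (torus L -` C \<inter> box_L L) x *\<^sub>R f x) \<in> borel_measurable ?M"
        using set_in[OF borel_closed[OF C]] by measurable
      show "AE x in ?M. cmod (complex_of_real (g n (torus L x)) * f x) \<le> cmod (f x)" for n
        using infdist_nonneg[of _ C] by (auto simp: norm_mult g_def intro!: mult_left_le_one_le)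
      show "AE x in ?M. (\<lambda>n. complex_of_real (g n (torus L x)) * f x) \<longlonglongrightarrow> indicat_real (torus L -` C \<inter> box_L L) x *\<^sub>R f x"
      proof (rule AE_I2)
        fix x assume "x \<in> space ?M"
        then have x: "x \<in> box_L L" by simp
        have "(\<lambda>n. g n w) \<longlonglongrightarrow> indicator C w" for w
        proof (cases "w \<in> C")
          case True
          then show ?thesis by (simp add: g_def)
        next
          case False
          then have "infdist w C > 0"
            using C \<open>C \<noteq> {}\<close> by (metis in_closed_iff_infdist_zero infdist_nonneg less_eq_real_def)
          then obtain N where N: "1 < real N * infdist w C" using reals_Archimedean3 by blast
          have "eventually (\<lambda>n. g n w = 0) sequentially"
            using eventually_ge_at_top[of N]
          proof eventually_elim
            case (elim n)
            then have "real N * infdist w C \<le> real n * infdist w C"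
              by (intro mult_right_mono infdist_nonneg) auto
            with N show ?case by (simp add: g_def)
          qed
          then show ?thesis using False by (simp add: tendsto_eventually)
        qed
        then have "(\<lambda>n. complex_of_real (g n (torus L x)) * f x) \<longlonglongrightarrow> complex_of_real (indicator C (torus L x)) * f x"
          by (intro tendsto_intros)
        then show "(\<lambda>n. complex_of_real (g n (torus L x)) * f x) \<longlonglongrightarrow> indicat_real (torus L -` C \<inter> box_L L) x *\<^sub>R f x"
          using x by (simp add: indicator_def scaleR_conv_of_real)
      qed
    qed measurable
    then have "(\<lambda>n. 0) \<longlonglongrightarrow> I C" by (simp add: cont0[OF gc])
    then show ?thesis using LIMSEQ_unique tendsto_const by blast
  qed
  have borel0: "I A = 0" if "A \<in> sets borel" for A
  proof -
    have "Int_stable (Collect closed :: (complex^'d) set set)"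
      by (auto simp: Int_stable_def)
    moreover have "Collect closed \<subseteq> Pow (UNIV :: (complex^'d) set)" by simp
    moreover have "A \<in> sigma_sets UNIV (Collect closed)"
      using that by (simp add: borel_eq_closed)
    ultimately show ?thesis
    proof (induction rule: sigma_sets_induct_disjoint)
      case (basic A)
      then show ?case by (simp add: closed0)
    next
      case empty
      then show ?case by (simp add: I_def)
    next
      case (compl A)
      then have A: "A \<in> sets borel" by (simp add: borel_eq_closed)
      have "I (UNIV - A) = (\<integral>x. indicator (torus L -` UNIV \<inter> box_L L) x *\<^sub>R f x - indicator (torus L -` A \<inter> box_L L) x *\<^sub>R f x \<partial>?M)"
        unfolding I_def by (rule Bochner_Integration.integral_cong) (auto simp: indicator_def)
      also have "\<dots> = I UNIV - I A"
        unfolding I_def by (rule Bochner_Integration.integral_diff)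
          (use A in \<open>auto intro!: integrable_mult_indicator fi set_in\<close>)
      finally show ?case using compl by (simp add: closed0)
    next
      case (union A)
      then have A: "A i \<in> sets borel" for i by (auto simp: borel_eq_closed)
      define Z where "Z i = torus L -` A i \<inter> box_L L" for i
      have Z: "Z i \<in> sets ?M" for i unfolding Z_def by (rule set_in[OF A])
      have UZ: "torus L -` (\<Union>i. A i) \<inter> box_L L = (\<Union>i. Z i)" by (auto simp: Z_def)
      have "(LINT x:(\<Union>i. Z i)|?M. f x) = (\<Sum>i. (LINT x:(Z i)|?M. f x))"
      proof (rule lebesgue_integral_countable_add)
        show "Z i \<inter> Z j = {}" if "i \<noteq> j" for i j
          using union(1) that by (auto simp: Z_def disjoint_family_on_def)
        show "set_integrable ?M (\<Union>i. Z i) f"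
          unfolding set_integrable_def by (intro integrable_mult_indicator fi sets.countable_UN) (use Z in auto)
      qed (rule Z)
      also have "\<dots> = (\<Sum>i. I (A i))" by (simp add: set_lebesgue_integral_def I_def Z_def)
      finally show ?case
        using union by (simp add: I_def UZ set_lebesgue_integral_def)
    qed
  qed
  obtain G :: "complex^'d \<Rightarrow> real^'d" where G[measurable]: "G \<in> borel_measurable borel" and GE: "\<And>x. x \<in> box_L L \<Longrightarrow> G (torus L x) = x"
    using torus_left_inverse[OF L] by blast
  show ?thesis
  proof (rule density_zero[OF fi])
    fix D assume "D \<in> sets ?M"
    then have D: "D \<in> sets lebesgue" "D \<subseteq> box_L L"
      by (auto simp: sets_restrict_space_iff)
    \<comment> \<open>A Lebesgue set is a Borel set up to a null set, and the part of the Borel set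
      in the box is recovered from the torus through the inverse \<open>G\<close>.\<close>
    obtain S N N' where SN: "D = S \<union> N" "N \<subseteq> N'" "N' \<in> null_sets lborel" "S \<in> sets lborel"
      using sets_completionE[OF D(1)] by metis
    have "AE x in lebesgue. x \<notin> N'"
      using SN(3) by (simp add: AE_not_in null_sets_completionI)
    then have "AE x in ?M. x \<notin> N'"
      by (subst AE_restrict_space_iff) auto
    then have *: "AE x in ?M. indicator D x *\<^sub>R f x = indicator (torus L -` (G -` S) \<inter> box_L L) x *\<^sub>R f x"
      by (rule AE_mp, intro AE_I2) (use SN D GE in \<open>auto simp: indicator_def\<close>)
    have GS: "G -` S \<in> sets borel"
      using measurable_sets[OF G, of S] SN by simp
    have "(LINT x:D|?M. f x) = I (G -` S)"
      unfolding set_lebesgue_integral_def I_def using * \<open>D \<in> sets ?M\<close> set_in[OF GS]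
      by (intro integral_cong_AE) auto
    with borel0[OF GS] show "(LINT x:D|?M. f x) = 0" by simp
  qed
qed

section \<open>Parseval and Riesz-Fischer on the box\<close>

lemma dual_L_eq_range: "dual_L L = range (\<lambda>k::int^'d. (\<chi> i. of_int (k $ i) / L) :: real^'d)"
proof (intro equalityI subsetI)
  fix p :: "real^'d" assume "p \<in> dual_L L"
  then obtain m where "\<And>i. p $ i = of_int (m i) / L"
    unfolding dual_L_def by (auto simp: choice_iff)
  then have "p = (\<chi> i. of_int ((\<chi> i. m i) $ i) / L)" by (simp add: vec_eq_iff)
  then show "p \<in> range (\<lambda>k::int^'d. (\<chi> i. of_int (k $ i) / L))" by blast
qed (auto simp: dual_L_def)

lemma countable_dual_L: "countable (dual_L L)"
  unfolding dual_L_eq_range by simp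

lemma infinite_dual_L:
  assumes "L > 0" shows "infinite (dual_L L :: (real^'d) set)"
proof -
  have "inj (\<lambda>m::int. axis (undefined::'d) (of_int m / L))"
    using assms by (auto simp: inj_def axis_eq_axis)
  then have "infinite (range (\<lambda>m::int. axis (undefined::'d) (of_int m / L)))"
    using finite_imageD infinite_UNIV_int by blast
  moreover have "range (\<lambda>m::int. axis (undefined::'d) (of_int m / L)) \<subseteq> dual_L L"
    by (auto intro: axis_dual_L)
  ultimately show ?thesis using finite_subset by blast
qed

lemma bij_enum_dual_L:
  "L > 0 \<Longrightarrow> bij_betw (from_nat_into (dual_L L)) UNIV (dual_L L :: (real^'d) set)"
  by (rule bij_betw_from_nat_into[OF countable_dual_L infinite_dual_L])

lemma orthogonal_sequence_chr:
  assumes L: "L > 0"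
  shows "orthogonal_sequence (leb_box L) (\<lambda>n. chr (from_nat_into (dual_L L :: (real^'d) set) n)) (L ^ CARD('d))"
proof -
  interpret finite_measure "leb_box L :: (real^'d) measure" by (rule finite_measure_leb_box[OF L])
  let ?e = "from_nat_into (dual_L L :: (real^'d) set)"
  have e: "?e n \<in> dual_L L" for n
    using bij_enum_dual_L[OF L, where ?'d='d] by (auto simp: bij_betw_def)
  have inj: "?e i = ?e j \<longleftrightarrow> i = j" for i j
    using bij_enum_dual_L[OF L, where ?'d='d] by (auto simp: bij_betw_def inj_def)
  show ?thesis
    by unfold_locales (use L in \<open>auto simp: integral_chr_orth[OF L e e] inj sq_integrable_chr\<close>)
qed

lemma fourier_sq_summable:
  assumes L: "L > 0" and f: "sq_integrable (leb_box L) (f :: real^'d \<Rightarrow> complex)"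
  shows "(\<lambda>p. (cmod (fourier_L L f p))\<^sup>2) summable_on dual_L L"
proof -
  interpret orthogonal_sequence "leb_box L" "\<lambda>n. chr (from_nat_into (dual_L L :: (real^'d) set) n)" "L ^ CARD('d)"
    by (rule orthogonal_sequence_chr[OF L])
  have "summable (\<lambda>n. (cmod (fourier_L L f (from_nat_into (dual_L L) n)))\<^sup>2)"
    unfolding fourier_L_eq[OF L f]
    by (rule summableI_nonneg_bounded[OF _ Bessel[OF f]]) auto
  then have "(\<lambda>n. (cmod (fourier_L L f (from_nat_into (dual_L L) n)))\<^sup>2) summable_on UNIV"
    by (intro summable_nonneg_imp_summable_on) auto
  then show ?thesis
    using summable_on_reindex_bij_betw[OF bij_enum_dual_L[OF L], of "\<lambda>p. (cmod (fourier_L L f p))\<^sup>2"] by simp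
qed

text \<open>The enumeration of the dual lattice gives convergence in one order only. Square
  summability of both families of coefficients makes the series absolutely convergent, and the
  statement becomes independent of the enumeration.\<close>

lemma Parseval_box:
  fixes f h :: "real^'d \<Rightarrow> complex"
  assumes L: "L > 0" and f: "sq_integrable (leb_box L) f" and h: "sq_integrable (leb_box L) h"
  shows "((\<lambda>p. cnj (fourier_L L h p) * fourier_L L f p / L ^ CARD('d)) has_sum (\<integral>x. cnj (h x) * f x \<partial>leb_box L)) (dual_L L)"
proof -
  let ?e = "from_nat_into (dual_L L :: (real^'d) set)"
  let ?v = "L ^ CARD('d)"
  interpret orthogonal_sequence "leb_box L" "\<lambda>n. chr (?e n)" ?v
    by (rule orthogonal_sequence_chr[OF L])
  have complete: "AE x in leb_box L. g x = 0"
    if "sq_integrable (leb_box L) g" "\<And>i. (\<integral>x. cnj (chr (?e i) x) * g x \<partial>leb_box L) = 0" for g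
  proof (rule fourier_complete[OF L that(1)])
    fix p :: "real^'d" assume "p \<in> dual_L L"
    then obtain i where "p = ?e i"
      using bij_enum_dual_L[OF L, where ?'d='d] by (auto simp: bij_betw_def)
    with that(2) show "(\<integral>x. cnj (chr p x) * g x \<partial>leb_box L) = 0" by simp
  qed
  let ?F = "\<lambda>p. cnj (fourier_L L h p) * fourier_L L f p / ?v"
  have s: "(\<lambda>n. ?F (?e n)) sums (\<integral>x. cnj (h x) * f x \<partial>leb_box L)"
    using Parseval[OF complete f h] by (simp add: fourier_L_eq[OF L f] fourier_L_eq[OF L h])
  have sq1: "(\<lambda>n. (cmod (fourier_L L g (?e n)))\<^sup>2) summable_on UNIV" if "sq_integrable (leb_box L) g" for g
    using summable_on_reindex_bij_betw[OF bij_enum_dual_L[OF L], of "\<lambda>p. (cmod (fourier_L L g p))\<^sup>2"]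
      fourier_sq_summable[OF L that] by simp
  have sq: "summable (\<lambda>n. (cmod (fourier_L L g (?e n)))\<^sup>2)" if "sq_integrable (leb_box L) g" for g
    by (rule summable_on_imp_summable[OF sq1[OF that]])
  have "summable (\<lambda>n. norm (?F (?e n)))"
  proof (rule summable_comparison_test'[where N=0])
    show "summable (\<lambda>n. ((cmod (fourier_L L h (?e n)))\<^sup>2 + (cmod (fourier_L L f (?e n)))\<^sup>2) / ?v)"
      by (intro summable_divide summable_add sq f h)
    fix n
    show "norm (norm (?F (?e n))) \<le> ((cmod (fourier_L L h (?e n)))\<^sup>2 + (cmod (fourier_L L f (?e n)))\<^sup>2) / ?v"
      using L by (simp add: norm_mult norm_divide norm_power divide_right_mono mult_le_sum_squares)
  qed
  from norm_summable_imp_has_sum[OF this s] show ?thesis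
    using has_sum_reindex_bij_betw[OF bij_enum_dual_L[OF L], of ?F] by simp
qed

text \<open>This supplies the existence behind the choice in \<open>resolv_L\<close>. The sequence
  fed to \<open>Riesz_Fischer\<close> is divided by the volume because the characters are not
  normalised.\<close>

lemma Riesz_Fischer_box:
  fixes c :: "real^'d \<Rightarrow> complex"
  assumes L: "L > 0" and c: "(\<lambda>p. (cmod (c p))\<^sup>2) summable_on dual_L L"
  obtains g where "sq_integrable (leb_box L) g" "\<And>p. p \<in> dual_L L \<Longrightarrow> fourier_L L g p = c p"
proof -
  let ?e = "from_nat_into (dual_L L :: (real^'d) set)"
  let ?v = "L ^ CARD('d)"
  interpret orthogonal_sequence "leb_box L" "\<lambda>n. chr (?e n)" ?v
    by (rule orthogonal_sequence_chr[OF L])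
  have "(\<lambda>n. (cmod (c (?e n)))\<^sup>2) summable_on UNIV"
    using summable_on_reindex_bij_betw[OF bij_enum_dual_L[OF L], of "\<lambda>p. (cmod (c p))\<^sup>2"] c by simp
  then have "summable (\<lambda>n. (cmod (c (?e n)))\<^sup>2)" by (rule summable_on_imp_summable)
  then have "summable (\<lambda>n. (cmod (c (?e n) / ?v))\<^sup>2)"
    by (simp add: norm_divide power_divide summable_divide)
  then obtain g where g: "sq_integrable (leb_box L) g"
    and gs: "\<And>h. sq_integrable (leb_box L) h \<Longrightarrow>
      (\<lambda>i. c (?e i) / ?v * (\<integral>x. cnj (h x) * chr (?e i) x \<partial>leb_box L)) sums (\<integral>x. cnj (h x) * g x \<partial>leb_box L)"
    using Riesz_Fischer[of "\<lambda>i. c (?e i) / ?v"] by blast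
  have "fourier_L L g p = c p" if "p \<in> dual_L L" for p
  proof -
    obtain j where j: "p = ?e j"
      using bij_betw_imp_surj_on[OF bij_enum_dual_L[OF L]] \<open>p \<in> dual_L L\<close> by (metis imageE)
    have "(\<lambda>i. c (?e i) / ?v * (\<integral>x. cnj (chr (?e j) x) * chr (?e i) x \<partial>leb_box L)) = (\<lambda>i. if i = j then c (?e i) else 0)"
      using L by (auto simp: orth fun_eq_iff)
    then have "(\<lambda>i. c (?e i) / ?v * (\<integral>x. cnj (chr (?e j) x) * chr (?e i) x \<partial>leb_box L)) sums c (?e j)"
      using sums_single[of j "\<lambda>i. c (?e i)"] by simp
    from sums_unique2[OF gs[OF sq] this] show ?thesis
      by (simp add: j fourier_L_eq[OF L g])
  qed
  with g show ?thesis using that by blast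
qed

section \<open>Decay of the Fourier coefficients of the profile\<close>

lemma iter_partial_partial: "iter_partial js (partial_j j f) = iter_partial (js @ [j]) f"
  by (induction js) auto

lemma schwartz_partial: "schwartz f \<Longrightarrow> schwartz (partial_j j f)"
  unfolding schwartz_def iter_partial_partial by blast

lemma schwartz_differentiable: "schwartz f \<Longrightarrow> f differentiable (at x)"
  unfolding schwartz_def by (metis iter_partial.simps(1))

lemma schwartz_bounded:
  assumes "schwartz f" obtains C where "C \<ge> 0" "\<And>x. \<bar>f x\<bar> \<le> C"
proof -
  have "bounded (range (\<lambda>x. (1 + norm x) ^ 0 * iter_partial [] f x))"
    using assms unfolding schwartz_def by blast
  then obtain C where "\<And>x. \<bar>f x\<bar> \<le> C" by (auto simp: bounded_iff)
  then show ?thesis using that[of C] by (meson abs_ge_zero order_trans)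
qed

lemma schwartz_measurable: "schwartz f \<Longrightarrow> f \<in> borel_measurable borel"
  by (intro borel_measurable_continuous_onI continuous_at_imp_continuous_on ballI
      differentiable_imp_continuous_within schwartz_differentiable)

lemma schwartz_has_partial_derivative:
  assumes "schwartz f"
  shows "((\<lambda>t. f (x + t *\<^sub>R axis j 1)) has_real_derivative partial_j j f (x + t *\<^sub>R axis j 1)) (at t)"
proof -
  define F where "F t = f (x + t *\<^sub>R axis j 1)" for t
  have "(f \<circ> (\<lambda>t. x + t *\<^sub>R axis j 1)) differentiable (at t)"
    by (rule differentiable_chain_at[OF _ schwartz_differentiable[OF assms]]) simp
  then have "F differentiable (at t)"
    by (simp add: F_def[abs_def] o_def)
  then obtain D where D: "(F has_real_derivative D) (at t)"
    using real_differentiable_def by blast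
  then have "((\<lambda>s. F (s + t)) has_real_derivative D) (at 0)"
    using DERIV_shift[of F D 0 t] by simp
  moreover have "(\<lambda>s. F (s + t)) = (\<lambda>s. f ((x + t *\<^sub>R axis j 1) + s *\<^sub>R axis j 1))"
    by (simp add: F_def scaleR_add_left add_ac)
  ultimately have "partial_j j f (x + t *\<^sub>R axis j 1) = D"
    unfolding partial_j_def by (simp add: DERIV_imp_deriv)
  with D show ?thesis by (simp add: F_def[abs_def])
qed

text \<open>Adding a coordinate \<open>j\<close> turns the alternating sum into the difference of
  one function of a single real variable at 0 and at \<open>- s j\<close>. Its derivative is the
  alternating sum over the smaller set for \<open>partial_j j f\<close>, so the mean value
  inequality contributes the factor |s j| and the induction continues with another Schwartz
  function.\<close>

lemma mixed_difference_bound: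
  fixes f :: "real^'d::finite \<Rightarrow> real"
  assumes "finite J" "schwartz f"
  shows "\<exists>C\<ge>0. \<forall>x s. \<bar>\<Sum>T\<in>Pow J. (-1) ^ card T * f (x - (\<Sum>j\<in>T. s j *\<^sub>R axis j 1))\<bar> \<le> C * (\<Prod>j\<in>J. \<bar>s j\<bar>)"
  using assms
proof (induction J arbitrary: f rule: finite_induct)
  case empty
  then obtain C where "C \<ge> 0" "\<And>x. \<bar>f x\<bar> \<le> C" using schwartz_bounded by blast
  then show ?case by (intro exI[of _ C]) simp
next
  case (insert j J)
  obtain C where C: "C \<ge> 0"
    "\<And>x s. \<bar>\<Sum>T\<in>Pow J. (-1) ^ card T * partial_j j f (x - (\<Sum>j\<in>T. s j *\<^sub>R axis j 1))\<bar> \<le> C * (\<Prod>j\<in>J. \<bar>s j\<bar>)"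
    using insert.IH[OF schwartz_partial[OF insert.prems]] by blast
  have "\<bar>\<Sum>T\<in>Pow (insert j J). (-1) ^ card T * f (x - (\<Sum>j\<in>T. s j *\<^sub>R axis j 1))\<bar> \<le> C * (\<Prod>j\<in>insert j J. \<bar>s j\<bar>)" for x s
  proof -
    define y where "y T = x - (\<Sum>j\<in>T. s j *\<^sub>R axis j 1)" for T
    define \<phi> where "\<phi> t = (\<Sum>T\<in>Pow J. (-1) ^ card T * f (y T + t *\<^sub>R axis j 1))" for t
    define \<phi>' where "\<phi>' t = (\<Sum>T\<in>Pow J. (-1) ^ card T * partial_j j f (y T + t *\<^sub>R axis j 1))" for t
    have der: "(\<phi> has_real_derivative \<phi>' t) (at t within UNIV)" for t
      unfolding \<phi>_def \<phi>'_def
      by (auto intro!: DERIV_sum DERIV_cmult schwartz_has_partial_derivative insert.prems)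
    \<comment> \<open>The constant \<open>C\<close> is uniform in the base point, so
      \<open>x\<close> may be moved along the new axis by \<open>t\<close>.\<close>
    have bd: "norm (\<phi>' t) \<le> C * (\<Prod>j\<in>J. \<bar>s j\<bar>)" for t
      using C(2)[of "x + t *\<^sub>R axis j 1" s] unfolding \<phi>'_def y_def by (simp add: algebra_simps)
    have yi: "y (insert j T) = y T + (- s j) *\<^sub>R axis j 1" if "T \<in> Pow J" for T
    proof -
      have "finite T" "j \<notin> T" using that insert finite_subset by auto
      then show ?thesis by (simp add: y_def)
    qed
    have ci: "card (insert j T) = Suc (card T)" if "T \<in> Pow J" for T
    proof -
      have "finite T" "j \<notin> T" using that insert finite_subset by auto
      then show ?thesis by simp
    qed
    have inj: "inj_on (insert j) (Pow J)"
      using insert.hyps(2) by (auto simp: inj_on_def)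
    have "(\<Sum>T\<in>Pow (insert j J). (-1) ^ card T * f (y T))
        = (\<Sum>T\<in>Pow J. (-1) ^ card T * f (y T)) + (\<Sum>T\<in>insert j ` Pow J. (-1) ^ card T * f (y T))"
      unfolding Pow_insert using insert.hyps by (intro sum.union_disjoint) auto
    also have "(\<Sum>T\<in>insert j ` Pow J. (-1) ^ card T * f (y T)) = (\<Sum>T\<in>Pow J. (-1) ^ card (insert j T) * f (y (insert j T)))"
      by (simp add: sum.reindex[OF inj])
    also have "\<dots> = - \<phi> (- s j)"
      unfolding \<phi>_def sum_negf[symmetric] by (intro sum.cong refl) (simp add: ci yi)
    also have "(\<Sum>T\<in>Pow J. (-1) ^ card T * f (y T)) = \<phi> 0" by (simp add: \<phi>_def)
    finally have "\<bar>\<Sum>T\<in>Pow (insert j J). (-1) ^ card T * f (y T)\<bar> = norm (\<phi> 0 - \<phi> (- s j))"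
      by simp
    also have "\<dots> \<le> C * (\<Prod>j\<in>J. \<bar>s j\<bar>) * norm (0 - (- s j))"
      by (rule field_differentiable_bound[OF convex_UNIV der bd]) auto
    also have "\<dots> = C * (\<Prod>j\<in>insert j J. \<bar>s j\<bar>)"
      using insert.hyps by simp
    finally show ?thesis unfolding y_def .
  qed
  with C(1) show ?case by blast
qed

lemma integral_chr_translate:
  fixes h :: "real^'d \<Rightarrow> complex"
  assumes "L > 0" "p \<in> dual_L L" and [measurable]: "h \<in> borel_measurable borel"
  shows "(\<integral>x. cnj (chr p x) * h (wrap L (x - y)) \<partial>leb_box L) = cnj (chr p y) * (\<integral>x. cnj (chr p x) * h x \<partial>leb_box L)"
proof -
  have [measurable]: "(\<lambda>x. cnj (chr p x)) \<in> borel_measurable borel"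
    unfolding cnj_chr_minus by measurable
  have eq: "cnj (chr p x) = cnj (chr p y) * cnj (chr p (wrap L (x - y)))" for x
    using chr_add_right[of p y "x - y"] by (simp add: chr_wrap[OF assms(2,1)])
  have "(\<integral>x. cnj (chr p x) * h (wrap L (x - y)) \<partial>leb_box L)
      = (\<integral>x. cnj (chr p y) * (cnj (chr p (wrap L (x - y))) * h (wrap L (x - y))) \<partial>leb_box L)"
    by (rule Bochner_Integration.integral_cong[OF refl], subst eq) (rule mult.assoc)
  also have "\<dots> = cnj (chr p y) * (\<integral>x. cnj (chr p (wrap L (x - y))) * h (wrap L (x - y)) \<partial>leb_box L)"
    by simp
  also have "(\<integral>x. cnj (chr p (wrap L (x - y))) * h (wrap L (x - y)) \<partial>leb_box L) = (\<integral>x. cnj (chr p x) * h x \<partial>leb_box L)"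
    by (rule integral_wrap_shift[OF assms(1)]) measurable
  finally show ?thesis .
qed

lemma sum_axis_component:
  fixes s :: "'d::finite \<Rightarrow> real"
  shows "(\<Sum>j\<in>T. s j *\<^sub>R axis j 1) $ i = (if i \<in> T then s i else 0)"
  by (simp add: axis_def if_distrib cong: if_cong)

text \<open>A backward step shorter than the period crosses the left face at most once. When it
  does, wrapping adds \<open>L\<close>, which amounts to a step of \<open>h j - L\<close>.\<close>

lemma wrap_shift_components:
  fixes x :: "real^'d::finite"
  assumes L: "L > 0" and x: "x \<in> box_L L" and h: "\<And>j. j \<in> T \<Longrightarrow> 0 < h j \<and> h j < L"
  shows "wrap L (x - (\<Sum>j\<in>T. h j *\<^sub>R axis j 1))
    = x - (\<Sum>j\<in>T. (if - L / 2 \<le> x $ j - h j then h j else h j - L) *\<^sub>R axis j 1)"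
proof -
  have "wrap L (x - (\<Sum>j\<in>T. h j *\<^sub>R axis j 1)) $ i
    = (x - (\<Sum>j\<in>T. (if - L / 2 \<le> x $ j - h j then h j else h j - L) *\<^sub>R axis j 1)) $ i" for i
  proof -
    have xi: "- L / 2 \<le> x $ i" "x $ i < L / 2" using x by (auto simp: box_L_def)
    have f0: "\<lfloor>t / L + 1 / 2\<rfloor> = m" if "- L / 2 \<le> t - L * of_int m \<and> t - L * of_int m < L / 2" for t m
      using floor_shift_iff[OF L] that by metis
    show ?thesis
    proof (cases "i \<in> T")
      case False
      then show ?thesis using f0[of "x $ i" 0] xi by (simp add: wrap_def sum_axis_component del: sum_component)
    next
      case True
      with h have hi: "0 < h i" "h i < L" by auto
      show ?thesis
      proof (cases "- L / 2 \<le> x $ i - h i")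
        case c: True
        then show ?thesis using True f0[of "x $ i - h i" 0] xi hi by (simp add: wrap_def sum_axis_component del: sum_component)
      next
        case c: False
        then show ?thesis using True f0[of "x $ i - h i" "-1"] xi hi by (simp add: wrap_def sum_axis_component del: sum_component)
      qed
    qed
  qed
  then show ?thesis by (simp add: vec_eq_iff)
qed

text \<open>Translating the periodic extension by half a period in each coordinate with nonzero frequency
  writes the coefficient as the integral of a mixed difference. Wrapping around the box only replaces
  a step h by h - L, on a slab of width h, so each coordinate gains a factor of order h.\<close>
lemma fourier_L_schwartz_decay:
  fixes B :: "real^'d::finite \<Rightarrow> real"
  assumes B: "schwartz B" and L: "L > 0"
  obtains C where "C \<ge> 0" "\<And>p. p \<in> dual_L L \<Longrightarrow> cmod (fourier_L L (\<lambda>x. complex_of_real (B x)) p) \<le> C * (\<Prod>i\<in>UNIV. 1 / (1 + \<bar>L * p $ i\<bar>))"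
proof -
  let ?B = "\<lambda>x. complex_of_real (B x)"
  interpret finite_measure "leb_box L :: (real^'d) measure" by (rule finite_measure_leb_box[OF L])
  have [measurable]: "B \<in> borel_measurable borel" by (rule schwartz_measurable[OF B])
  obtain C0 where C0: "\<And>x. \<bar>B x\<bar> \<le> C0" using schwartz_bounded[OF B] by blast
  have sqB: "sq_integrable (leb_box L) ?B"
    by (rule sq_integrable_bounded[where C=C0]) (auto intro!: borel_measurable_leb_box simp: C0)
  have "\<forall>J. \<exists>C\<ge>0. \<forall>x s. \<bar>\<Sum>T\<in>Pow J. (-1) ^ card T * B (x - (\<Sum>j\<in>T. s j *\<^sub>R axis j 1))\<bar> \<le> C * (\<Prod>j\<in>J. \<bar>s j\<bar>)"
    using mixed_difference_bound[OF _ B] by simp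
  from choice[OF this] obtain CJ where CJ: "\<And>J. CJ J \<ge> 0"
    "\<And>J x s. \<bar>\<Sum>T\<in>Pow J. (-1) ^ card T * B (x - (\<Sum>j\<in>T. s j *\<^sub>R axis j 1))\<bar> \<le> CJ J * (\<Prod>j\<in>J. \<bar>s j\<bar>)"
    by blast
  \<comment> \<open>The set of coordinates with nonzero frequency depends on \<open>p\<close>;
    summing over all subsets makes the constant independent of it.\<close>
  define C1 where "C1 = (\<Sum>J\<in>UNIV. CJ J)"
  have C1: "CJ J \<le> C1" for J
    unfolding C1_def by (rule member_le_sum) (auto simp: CJ)
  have C1nn: "C1 \<ge> 0" unfolding C1_def by (intro sum_nonneg) (simp add: CJ)
  show ?thesis
  proof
    \<comment> \<open>One factor \<open>L + L^2\<close> per coordinate serves both cases at the end: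
      it dominates \<open>L\<close> for zero frequency and, with a = |L p_i| \<ge> 1, also L^2 / (2
      a) \<le> L^2 / (1 + a) for nonzero frequency.\<close>
    show "C1 * (L + L\<^sup>2) ^ CARD('d) \<ge> 0" using C1nn L by simp
    fix p :: "real^'d" assume p: "p \<in> dual_L L"
    define J where "J = {i. p $ i \<noteq> 0}"
    define h where "h i = 1 / (2 * \<bar>p $ i\<bar>)" for i
    \<comment> \<open>On the dual lattice |L p_i| is an integer, so a nonzero one is at least 1;
      this keeps the half-period \<open>h i\<close> below \<open>L\<close>.\<close>
    have Lp: "1 \<le> \<bar>L * p $ i\<bar>" if i: "i \<in> J" for i
    proof -
      obtain m :: int where "p $ i = of_int m / L" using p unfolding dual_L_def by auto
      with i L show ?thesis by (auto simp: J_def)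
    qed
    have hJ: "0 < h i \<and> h i < L" if "i \<in> J" for i
    proof -
      have "0 < \<bar>p $ i\<bar>" using that by (simp add: J_def)
      moreover have "1 \<le> L * \<bar>p $ i\<bar>" using Lp[OF that] L by (simp add: abs_mult)
      ultimately show ?thesis by (simp add: h_def field_simps)
    qed
    define s where "s t i = (if - L / 2 \<le> t - h i then h i else h i - L)" for t :: real and i
    define y where "y T = (\<Sum>j\<in>T. h j *\<^sub>R axis j (1::real))" for T
    have chrT: "cnj (chr p (y T)) = (-1) ^ card T" if "T \<subseteq> J" for T
    proof -
      have "finite T" by simp
      then show ?thesis using that
      proof (induction T rule: finite_induct)
        case empty
        then show ?case by (simp add: y_def)
      next
        case (insert i T)
        then have "p $ i \<noteq> 0" by (simp add: J_def)
        then have "p \<bullet> (h i *\<^sub>R axis i 1) = sgn (p $ i) / 2"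
          by (simp add: inner_axis h_def sgn_if)
        then have "chr p (h i *\<^sub>R axis i 1) = exp (\<i> * pi * sgn (p $ i))"
          unfolding chr_def by (simp only:) (simp add: mult_ac)
        also have "\<dots> = -1"
          using \<open>p $ i \<noteq> 0\<close> by (auto simp: sgn_if exp_minus exp_pi_i')
        finally have "cnj (chr p (h i *\<^sub>R axis i 1)) = -1" by simp
        with insert show ?case by (simp add: y_def chr_add_right)
      qed
    qed
    define b where "b = (\<integral>x. cnj (chr p x) * ?B x \<partial>leb_box L)"
    have intT: "integrable (leb_box L) (\<lambda>x. cnj (chr p x) * ?B (wrap L (x - y T)))" for T
    proof -
      have "sq_integrable (leb_box L) (\<lambda>x. ?B (wrap L (x - y T)))"
        by (rule sq_integrable_bounded[where C=C0]) (auto intro!: borel_measurable_leb_box simp: C0)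
      then show ?thesis by (intro sq_integrable_mult sq_integrable_cnj sq_integrable_chr L)
    qed
    \<comment> \<open>The phase of the translation by \<open>y T\<close> is
      \<open>(-1) ^ card T\<close>, which cancels the sign of the term. All
      \<open>2 ^ card J\<close> terms equal \<open>b\<close>, and their sum is a mixed difference
      under the integral.\<close>
    have "(2 ^ card J) * b = (\<Sum>T\<in>Pow J. (-1) ^ card T * ((-1) ^ card T * b))"
      by (simp add: card_Pow flip: mult.assoc power_mult_distrib)
    also have "\<dots> = (\<Sum>T\<in>Pow J. (-1) ^ card T * (\<integral>x. cnj (chr p x) * ?B (wrap L (x - y T)) \<partial>leb_box L))"
      by (intro sum.cong refl arg_cong2[where f="(*)"])
         (subst integral_chr_translate[OF L p], simp_all add: b_def chrT)
    also have "\<dots> = (\<integral>x. (\<Sum>T\<in>Pow J. (-1) ^ card T * (cnj (chr p x) * ?B (wrap L (x - y T)))) \<partial>leb_box L)"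
      by (subst Bochner_Integration.integral_sum) (auto intro!: integrable_mult_right intT)
    finally have b2: "(2 ^ card J) * b = (\<integral>x. (\<Sum>T\<in>Pow J. (-1) ^ card T * (cnj (chr p x) * ?B (wrap L (x - y T)))) \<partial>leb_box L)" .
    have pt: "cmod (\<Sum>T\<in>Pow J. (-1) ^ card T * (cnj (chr p x) * ?B (wrap L (x - y T)))) \<le> C1 * (\<Prod>j\<in>J. \<bar>s (x $ j) j\<bar>)"
      if x: "x \<in> box_L L" for x
    proof -
      have "wrap L (x - y T) = x - (\<Sum>j\<in>T. s (x $ j) j *\<^sub>R axis j 1)" if "T \<in> Pow J" for T
        unfolding y_def s_def by (rule wrap_shift_components[OF L x hJ]) (use that in auto)
      then have "(\<Sum>T\<in>Pow J. (-1) ^ card T * (cnj (chr p x) * ?B (wrap L (x - y T))))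
          = cnj (chr p x) * complex_of_real (\<Sum>T\<in>Pow J. (-1) ^ card T * B (x - (\<Sum>j\<in>T. s (x $ j) j *\<^sub>R axis j 1)))"
        by (simp add: sum_distrib_left mult_ac)
      then have "cmod (\<Sum>T\<in>Pow J. (-1) ^ card T * (cnj (chr p x) * ?B (wrap L (x - y T))))
          = \<bar>\<Sum>T\<in>Pow J. (-1) ^ card T * B (x - (\<Sum>j\<in>T. s (x $ j) j *\<^sub>R axis j 1))\<bar>"
        by (simp only: norm_mult norm_of_real complex_mod_cnj norm_chr mult_1)
      also have "\<dots> \<le> CJ J * (\<Prod>j\<in>J. \<bar>s (x $ j) j\<bar>)" by (rule CJ(2))
      also have "\<dots> \<le> C1 * (\<Prod>j\<in>J. \<bar>s (x $ j) j\<bar>)"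
        by (intro mult_right_mono C1 prod_nonneg) auto
      finally show ?thesis .
    qed
    have [measurable]: "(\<lambda>t. s t i) \<in> borel_measurable borel" for i unfolding s_def by measurable
    \<comment> \<open>One function per coordinate, carrying both the indicator of the side of the
      box and the step length, so that the integral over the box factors.\<close>
    define g where "g i t = indicator {-L/2..<L/2} t * (if i \<in> J then ennreal \<bar>s t i\<bar> else 1)" for i t
    have [measurable]: "g i \<in> borel_measurable borel" for i unfolding g_def by measurable
    have gint: "(\<integral>\<^sup>+t. g i t \<partial>lborel) \<le> ennreal (if i \<in> J then 2 * L * h i else L)" for i
    proof (cases "i \<in> J")
      case True
      with hJ have h: "0 < h i" "h i < L" by auto
      \<comment> \<open>Off a slab of width \<open>h i\<close> at the left face the step has length
        \<open>h i\<close>; on the slab it is at most \<open>L\<close>. The two contributions to the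
        integral are equal and give \<open>2 * L * h i\<close>.\<close>
      have "g i t \<le> ennreal (h i) * indicator {-L/2..<L/2} t + ennreal L * indicator {-L/2..<-L/2 + h i} t" for t
        using True h by (auto simp: g_def s_def indicator_def ennreal_plus[symmetric] intro!: ennreal_leI simp del: ennreal_plus)
      then have "(\<integral>\<^sup>+t. g i t \<partial>lborel) \<le> (\<integral>\<^sup>+t. ennreal (h i) * indicator {-L/2..<L/2} t + ennreal L * indicator {-L/2..<-L/2 + h i} t \<partial>lborel)"
        by (intro nn_integral_mono)
      also have "\<dots> = ennreal (h i) * ennreal L + ennreal L * ennreal (h i)"
        using h L by (subst nn_integral_add) (auto simp: nn_integral_cmult)
      also have "\<dots> = ennreal (2 * L * h i)"
        using h L by (simp add: ennreal_mult[symmetric] ennreal_plus[symmetric] mult.commute del: ennreal_plus)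
      finally show ?thesis using True by simp
    next
      case False
      then show ?thesis using L by (simp add: g_def)
    qed
    have "ennreal (cmod ((2 ^ card J) * b)) \<le> (\<integral>\<^sup>+x. ennreal (cmod (\<Sum>T\<in>Pow J. (-1) ^ card T * (cnj (chr p x) * ?B (wrap L (x - y T))))) \<partial>leb_box L)"
      unfolding b2 by (intro integral_norm_bound_ennreal Bochner_Integration.integrable_sum integrable_mult_right intT)
    also have "\<dots> \<le> (\<integral>\<^sup>+x. ennreal (C1 * (\<Prod>j\<in>J. \<bar>s (x $ j) j\<bar>)) \<partial>leb_box L)"
      by (intro nn_integral_mono ennreal_leI pt) simp
    also have "\<dots> = (\<integral>\<^sup>+x. ennreal (C1 * (\<Prod>j\<in>J. \<bar>s (x $ j) j\<bar>)) * indicator (box_L L) x \<partial>lborel)"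
      by (simp add: nn_integral_restrict_space nn_integral_completion)
    also have "\<dots> = (\<integral>\<^sup>+x. ennreal C1 * (\<Prod>i\<in>UNIV. g i (x $ i)) \<partial>lborel)"
    proof (rule nn_integral_cong)
      fix x :: "real^'d"
      have "(\<Prod>i\<in>UNIV. g i (x $ i)) = (\<Prod>i\<in>UNIV. indicator {-L/2..<L/2} (x $ i)) * (\<Prod>i\<in>UNIV. if i \<in> J then ennreal \<bar>s (x $ i) i\<bar> else 1)"
        by (simp add: g_def prod.distrib)
      also have "(\<Prod>i\<in>UNIV. if i \<in> J then ennreal \<bar>s (x $ i) i\<bar> else 1) = (\<Prod>i\<in>J. ennreal \<bar>s (x $ i) i\<bar>)"
        by (simp add: prod.If_cases)
      also have "\<dots> = ennreal (\<Prod>i\<in>J. \<bar>s (x $ i) i\<bar>)" by (rule prod_ennreal) simp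
      finally show "ennreal (C1 * (\<Prod>j\<in>J. \<bar>s (x $ j) j\<bar>)) * indicator (box_L L) x = ennreal C1 * (\<Prod>i\<in>UNIV. g i (x $ i))"
        using C1nn by (simp add: box_L_prod_indicator ennreal_mult prod_nonneg mult_ac)
    qed
    also have "\<dots> = ennreal C1 * (\<Prod>i\<in>UNIV. \<integral>\<^sup>+t. g i t \<partial>lborel)"
    proof (subst nn_integral_cmult)
      have [measurable]: "(\<lambda>x::real^'d. x $ i) \<in> borel_measurable borel" for i
        by (intro borel_measurable_continuous_onI continuous_intros)
      show "(\<lambda>x::real^'d. \<Prod>i\<in>UNIV. g i (x $ i)) \<in> borel_measurable lborel" by measurable
    qed (simp add: nn_integral_vec_prod)
    also have "\<dots> \<le> ennreal C1 * (\<Prod>i\<in>UNIV. ennreal (if i \<in> J then 2 * L * h i else L))"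
      by (intro mult_left_mono prod_mono_ennreal gint) simp
    also have "(\<Prod>i\<in>UNIV. ennreal (if i \<in> J then 2 * L * h i else L)) = ennreal (\<Prod>i\<in>UNIV. if i \<in> J then 2 * L * h i else L)"
      by (rule prod_ennreal) (use L in \<open>auto simp: h_def\<close>)
    also have "ennreal C1 * \<dots> = ennreal (C1 * (\<Prod>i\<in>UNIV. if i \<in> J then 2 * L * h i else L))"
      using C1nn L by (simp add: ennreal_mult prod_nonneg h_def)
    finally have "2 ^ card J * cmod b \<le> C1 * (\<Prod>i\<in>UNIV. if i \<in> J then 2 * L * h i else L)"
      using C1nn L by (subst (asm) ennreal_le_iff) (auto simp: norm_mult norm_power h_def intro!: mult_nonneg_nonneg prod_nonneg)
    \<comment> \<open>The factors 2 from the slabs are exactly matched by the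
      \<open>2 ^ card J\<close> on the left.\<close>
    also have "(\<Prod>i\<in>UNIV. if i \<in> J then 2 * L * h i else L) = 2 ^ card J * (\<Prod>i\<in>UNIV. if i \<in> J then L * h i else L)"
    proof -
      have "(\<Prod>i\<in>UNIV. if i \<in> J then 2 * L * h i else L) = (\<Prod>i\<in>UNIV. (if i \<in> J then 2 else 1) * (if i \<in> J then L * h i else L))"
        by (intro prod.cong) auto
      then show ?thesis by (simp add: prod.distrib prod.If_cases)
    qed
    finally have "cmod b \<le> C1 * (\<Prod>i\<in>UNIV. if i \<in> J then L * h i else L)"
      by simp
    also have "\<dots> \<le> C1 * (\<Prod>i\<in>UNIV. (L + L\<^sup>2) * (1 / (1 + \<bar>L * p $ i\<bar>)))"
    proof (intro mult_left_mono prod_mono C1nn conjI)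
      fix i
      show "0 \<le> (if i \<in> J then L * h i else L)" using L by (simp add: h_def)
      show "(if i \<in> J then L * h i else L) \<le> (L + L\<^sup>2) * (1 / (1 + \<bar>L * p $ i\<bar>))"
      proof (cases "i \<in> J")
        case True
        define a where "a = \<bar>L * p $ i\<bar>"
        have a: "a \<ge> 1" using Lp[OF True] by (simp add: a_def)
        have "L * h i = L\<^sup>2 / (2 * a)"
          using L by (simp add: h_def a_def abs_mult power2_eq_square)
        also have "\<dots> \<le> L\<^sup>2 / (1 + a)" using a by (intro divide_left_mono) auto
        also have "\<dots> \<le> (L + L\<^sup>2) * (1 / (1 + a))"
          using a L by (simp add: divide_right_mono)
        finally show ?thesis using True by (simp add: a_def)
      next
        case False
        then show ?thesis using L by (simp add: J_def)
      qed
    qed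
    also have "\<dots> = C1 * (L + L\<^sup>2) ^ CARD('d) * (\<Prod>i\<in>UNIV. 1 / (1 + \<bar>L * p $ i\<bar>))"
      by (simp only: prod.distrib prod_constant mult.assoc)
    finally show "cmod (fourier_L L ?B p) \<le> C1 * (L + L\<^sup>2) ^ CARD('d) * (\<Prod>i\<in>UNIV. 1 / (1 + \<bar>L * p $ i\<bar>))"
      by (simp add: b_def fourier_L_eq[OF L sqB])
  qed
qed

section \<open>Absolute summability of resolvent chains\<close>

lemma bij_betw_PiE_snoc:
  "bij_betw (\<lambda>(k, q). k(Suc N := q)) (PiE {1..N} (\<lambda>_. D) \<times> D) (PiE {1..Suc N} (\<lambda>_. D))"
proof (rule bij_betw_byWitness[where f'="\<lambda>k. (restrict k {1..N}, k (Suc N))"])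
  show "\<forall>a\<in>PiE {1..N} (\<lambda>_. D) \<times> D.
      (\<lambda>k. (restrict k {1..N}, k (Suc N))) ((\<lambda>(k, q). k(Suc N := q)) a) = a"
    by (auto simp: PiE_def extensional_def restrict_def fun_eq_iff)
  show "\<forall>a'\<in>PiE {1..Suc N} (\<lambda>_. D).
      (\<lambda>(k, q). k(Suc N := q)) ((\<lambda>k. (restrict k {1..N}, k (Suc N))) a') = a'"
    by (auto simp: PiE_def extensional_def restrict_def fun_eq_iff le_Suc_eq)
  show "(\<lambda>(k, q). k(Suc N := q)) ` (PiE {1..N} (\<lambda>_. D) \<times> D) \<subseteq> PiE {1..Suc N} (\<lambda>_. D)"
    by (auto simp: PiE_def extensional_def Pi_iff)
  show "(\<lambda>k. (restrict k {1..N}, k (Suc N))) ` PiE {1..Suc N} (\<lambda>_. D) \<subseteq> PiE {1..N} (\<lambda>_. D) \<times> D"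
    by (auto simp: PiE_iff)
qed

lemma bij_betw_PiE_rev:
  "bij_betw (\<lambda>k. \<lambda>j\<in>{1..Suc n}. k (Suc (Suc n) - j)) (PiE {1..Suc n} (\<lambda>_. D)) (PiE {1..Suc n} (\<lambda>_. D))"
proof -
  have "k (Suc (Suc n) - j) \<in> D" if "k \<in> PiE {1..Suc n} (\<lambda>_. D)" "j \<in> {1..Suc n}" for k j
    by (rule PiE_mem[OF that(1)]) (use that(2) in auto)
  then show ?thesis
    by (intro bij_betw_byWitness[where f'="\<lambda>k. \<lambda>j\<in>{1..Suc n}. k (Suc (Suc n) - j)"])
       (auto simp: restrict_def fun_eq_iff PiE_iff extensional_def)
qed

text \<open>Symmetry makes the single row bound serve as the column bound as well. The bound is on
  finite partial sums, from which summability of the rows is derived.\<close>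

locale schur_kernel =
  fixes D :: "'k set" and t :: "'k \<Rightarrow> 'k \<Rightarrow> real" and C :: real
  assumes t_nonneg: "t k q \<ge> 0" and t_sym: "t k q = t q k"
    and row: "\<And>k F. k \<in> D \<Longrightarrow> finite F \<Longrightarrow> F \<subseteq> D \<Longrightarrow> (\<Sum>q\<in>F. t k q) \<le> C"
begin

lemma row_summable: "k \<in> D \<Longrightarrow> t k summable_on D"
  by (rule nonneg_bdd_above_summable_on) (auto simp: t_nonneg intro!: bdd_aboveI2[where M=C] row)

lemma row_infsum: "k \<in> D \<Longrightarrow> infsum (t k) D \<le> C"
  by (rule infsum_le_finite_sums[OF row_summable row])

lemma row_infsum_nonneg: "infsum (t k) D \<ge> 0"
  by (rule infsum_nonneg) (rule t_nonneg)

text \<open>Summing the last variable with all the others fixed costs a factor at most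
  \<open>C\<close>, so the chain is shortened from the right until only the summable weight at its
  left end remains.\<close>

lemma chain_summable_left:
  assumes a: "a summable_on D" and a0: "\<And>k. a k \<ge> 0"
  shows "(\<lambda>k. a (k 1) * (\<Prod>l\<in>{1..n}. t (k l) (k (l + 1)))) summable_on PiE {1..Suc n} (\<lambda>_. D)"
proof (induction n)
  case 0
  have s: "((\<lambda>(k, q). a q)) summable_on (PiE {1..0::nat} (\<lambda>_. D) \<times> D)"
  proof (rule summable_on_SigmaI[where g="\<lambda>_. infsum a D"])
    show "(\<lambda>_. infsum a D) summable_on PiE {1..0::nat} (\<lambda>_. D)"
      by (rule summable_on_finite) (simp add: PiE_empty_domain)
  qed (use a a0 in auto)
  show ?case
    using summable_on_reindex_bij_betw[OF bij_betw_PiE_snoc[of 0 D],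
        of "\<lambda>k. a (k 1) * (\<Prod>l\<in>{1..0}. t (k l) (k (l + 1)))"] s
    by (simp add: case_prod_unfold)
next
  case (Suc n)
  let ?P = "\<lambda>k. a (k 1) * (\<Prod>l\<in>{1..n}. t (k l) (k (l + 1)))"
  have P0: "?P k \<ge> 0" for k by (intro mult_nonneg_nonneg prod_nonneg a0) (auto simp: t_nonneg)
  have "(\<lambda>(k, q). ?P k * t (k (Suc n)) q) summable_on (PiE {1..Suc n} (\<lambda>_. D) \<times> D)"
  proof (rule summable_on_SigmaI[where g="\<lambda>k. ?P k * infsum (t (k (Suc n))) D"])
    fix k assume "k \<in> PiE {1..Suc n} (\<lambda>_. D)"
    then have "k (Suc n) \<in> D" by auto
    from has_sum_cmult_right[OF has_sum_infsum[OF row_summable[OF this]], of "?P k"]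
    show "((\<lambda>q. (case (k, q) of (k, q) \<Rightarrow> ?P k * t (k (Suc n)) q)) has_sum (?P k * infsum (t (k (Suc n))) D)) D"
      by simp
  next
    show "(\<lambda>k. ?P k * infsum (t (k (Suc n))) D) summable_on PiE {1..Suc n} (\<lambda>_. D)"
    proof (rule summable_on_comparison_test)
      show "(\<lambda>k. ?P k * C) summable_on PiE {1..Suc n} (\<lambda>_. D)"
        by (rule summable_on_cmult_left[OF Suc])
      fix k assume "k \<in> PiE {1..Suc n} (\<lambda>_. D)"
      then have "k (Suc n) \<in> D" by auto
      then show "?P k * infsum (t (k (Suc n))) D \<le> ?P k * C"
        by (intro mult_left_mono row_infsum P0)
      show "0 \<le> ?P k * infsum (t (k (Suc n))) D" by (intro mult_nonneg_nonneg P0 row_infsum_nonneg)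
    qed
  next
    show "0 \<le> (case (k, q) of (k, q) \<Rightarrow> ?P k * t (k (Suc n)) q)" for k q
      using P0[of k] t_nonneg by simp
  qed
  moreover have "a ((k(Suc (Suc n) := q)) 1) * (\<Prod>l\<in>{1..Suc n}. t ((k(Suc (Suc n) := q)) l) ((k(Suc (Suc n) := q)) (l + 1)))
      = ?P k * t (k (Suc n)) q" for k q
  proof -
    have "(\<Prod>l\<in>{1..n}. t ((k(Suc (Suc n) := q)) l) ((k(Suc (Suc n) := q)) (l + 1))) = (\<Prod>l\<in>{1..n}. t (k l) (k (l + 1)))"
      by (intro prod.cong) auto
    then show ?thesis by simp
  qed
  ultimately show ?case
    using summable_on_reindex_bij_betw[OF bij_betw_PiE_snoc[of "Suc n" D],
        of "\<lambda>k. a (k 1) * (\<Prod>l\<in>{1..Suc n}. t (k l) (k (l + 1)))"]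
    by (simp only: case_prod_unfold)
qed

text \<open>Reading the tuple backwards, with the kernel symmetric, exchanges the two ends of the
  chain.\<close>

lemma chain_summable_right:
  assumes c: "c summable_on D" and c0: "\<And>k. c k \<ge> 0"
  shows "(\<lambda>k. c (k (Suc n)) * (\<Prod>l\<in>{1..n}. t (k l) (k (l + 1)))) summable_on PiE {1..Suc n} (\<lambda>_. D)"
proof -
  let ?r = "\<lambda>k. \<lambda>j\<in>{1..Suc n}. k (Suc (Suc n) - j)"
  let ?G = "\<lambda>k. c (k 1) * (\<Prod>l\<in>{1..n}. t (k l) (k (l + 1)))"
  have eq: "?G (?r k) = c (k (Suc n)) * (\<Prod>l\<in>{1..n}. t (k l) (k (l + 1)))" for k
  proof -
    have "(\<Prod>l\<in>{1..n}. t (?r k l) (?r k (l + 1))) = (\<Prod>l\<in>{1..n}. t (k (Suc n - l)) (k (Suc n - l + 1)))"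
      by (intro prod.cong refl) (subst t_sym, simp add: Suc_diff_le)
    also have "\<dots> = (\<Prod>l\<in>{1..n}. t (k l) (k (l + 1)))"
      by (rule prod.reindex_bij_witness[where i="\<lambda>l. Suc n - l" and j="\<lambda>l. Suc n - l"]) auto
    finally show ?thesis by simp
  qed
  have "(\<lambda>k. ?G (?r k)) summable_on PiE {1..Suc n} (\<lambda>_. D)"
    using summable_on_reindex_bij_betw[OF bij_betw_PiE_rev[of n D], of ?G] chain_summable_left[OF c c0, of n]
    by blast
  then show ?thesis unfolding eq .
qed

text \<open>Schur's test: the product of the end weights is at most the sum of their squares, and
  each square is a summable weight at one end of the chain.\<close>

lemma chain_summable:
  assumes a: "(\<lambda>k. (a k)\<^sup>2) summable_on D" and c: "(\<lambda>k. (c k)\<^sup>2) summable_on D"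
    and a0: "\<And>k. a k \<ge> 0" and c0: "\<And>k. c k \<ge> 0"
  shows "(\<lambda>k. a (k 1) * c (k (Suc n)) * (\<Prod>l\<in>{1..n}. t (k l) (k (l + 1)))) summable_on PiE {1..Suc n} (\<lambda>_. D)"
proof (rule summable_on_comparison_test)
  show "(\<lambda>k. (a (k 1))\<^sup>2 * (\<Prod>l\<in>{1..n}. t (k l) (k (l + 1))) + (c (k (Suc n)))\<^sup>2 * (\<Prod>l\<in>{1..n}. t (k l) (k (l + 1))))
      summable_on PiE {1..Suc n} (\<lambda>_. D)"
    by (intro summable_on_add chain_summable_left[OF a] chain_summable_right[OF c]) auto
  fix k :: "nat \<Rightarrow> 'k"
  have p: "(\<Prod>l\<in>{1..n}. t (k l) (k (l + 1))) \<ge> 0" by (intro prod_nonneg) (auto simp: t_nonneg)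
  have "a (k 1) * c (k (Suc n)) \<le> (a (k 1))\<^sup>2 + (c (k (Suc n)))\<^sup>2"
    by (intro mult_le_sum_squares a0 c0)
  from mult_right_mono[OF this p]
  show "a (k 1) * c (k (Suc n)) * (\<Prod>l\<in>{1..n}. t (k l) (k (l + 1)))
      \<le> (a (k 1))\<^sup>2 * (\<Prod>l\<in>{1..n}. t (k l) (k (l + 1))) + (c (k (Suc n)))\<^sup>2 * (\<Prod>l\<in>{1..n}. t (k l) (k (l + 1)))"
    by (simp add: distrib_right)
  show "0 \<le> a (k 1) * c (k (Suc n)) * (\<Prod>l\<in>{1..n}. t (k l) (k (l + 1)))"
    using p a0 c0 by simp
qed

end

section \<open>Product decay against resolvent weights\<close>

definition decay :: "real \<Rightarrow> real^'d::finite \<Rightarrow> real" where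
  "decay L p = (\<Prod>i\<in>UNIV. 1 / (1 + \<bar>L * p $ i\<bar>))"

lemma decay_nonneg: "decay L p \<ge> 0"
  by (auto simp: decay_def intro!: prod_nonneg)

lemma decay_minus_commute: "decay L (p - q) = decay L (q - p)"
  unfolding decay_def by (intro prod.cong refl) (simp add: right_diff_distrib abs_minus_commute)

lemma resolvent_lower_bound:
  assumes "z \<notin> complex_of_real ` {0..}"
  obtains c where "c > 0" "\<And>x. x \<ge> 0 \<Longrightarrow> c * (1 + x) \<le> cmod (complex_of_real x - z)"
proof -
  have "complex_of_real ` {0..} = \<real>\<^sub>\<ge>\<^sub>0" by (auto simp: nonneg_Reals_def)
  then obtain \<delta> where d: "\<delta> > 0" "\<And>x. x \<ge> 0 \<Longrightarrow> \<delta> \<le> dist z (complex_of_real x)"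
    using separate_point_closed[OF closed_nonneg_Reals_complex, of z] assms
    by (metis atLeast_iff imageI)
  \<comment> \<open>From 1 + x \<le> (1 + |z|) + |x - z|, where the first summand is at most (1 +
    |z|) / \<delta> times |x - z| because \<delta> is a lower bound for the distance to the
    half-line.\<close>
  define K where "K = (1 + cmod z) / \<delta> + 1"
  have K: "K > 0" using d by (auto simp: K_def intro!: add_nonneg_pos)
  show ?thesis
  proof
    show "1 / K > 0" using K by simp
    fix x :: real assume x: "x \<ge> 0"
    have dx: "\<delta> \<le> cmod (complex_of_real x - z)" using d(2)[OF x] by (simp add: dist_norm norm_minus_commute)
    have "x \<le> cmod z + cmod (complex_of_real x - z)"
      using norm_triangle_ineq[of z "complex_of_real x - z"] x by simp
    moreover have "1 + cmod z \<le> (1 + cmod z) / \<delta> * cmod (complex_of_real x - z)"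
      using mult_left_mono[OF dx, of "(1 + cmod z) / \<delta>"] d by simp
    ultimately have "1 + x \<le> K * cmod (complex_of_real x - z)"
      by (simp add: K_def distrib_right)
    then show "1 / K * (1 + x) \<le> cmod (complex_of_real x - z)"
      using K by (simp add: field_simps)
  qed
qed

text \<open>The denominator grows at least like 1 + |k|^2, so its square root dominates 1 + |L k_i|
  for each single coordinate. Writing the weight as a product of d copies of its d-th root allows a
  different coordinate to be used in each copy.\<close>

lemma resolvent_sqrt_decay:
  assumes z: "z \<notin> complex_of_real ` {0..}" and L: "L > 0"
  obtains C where "C > 0"
    "\<And>k::real^'d::finite. 1 / sqrt (cmod (complex_of_real (nu k) - z)) \<le> C"
    "\<And>k::real^'d. 1 / sqrt (cmod (complex_of_real (nu k) - z)) \<le> C * (\<Prod>i\<in>UNIV. (1 + \<bar>L * k $ i\<bar>) powr (- 1 / CARD('d)))"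
proof -
  obtain c where c: "c > 0" "\<And>x. x \<ge> 0 \<Longrightarrow> c * (1 + x) \<le> cmod (complex_of_real x - z)"
    using resolvent_lower_bound[OF z] by blast
  \<comment> \<open>Collects (1 + a)^2 \<le> 2 (1 + a^2) for a = |L k_i|, the identity |k|^2 = 2
    nu(k), and the constant \<open>c\<close> of the lower bound.\<close>
  define C where "C = sqrt (2 * (1 + 2 * L\<^sup>2) / c)"
  have C: "C > 0" using c by (simp add: C_def add_pos_nonneg)
  have comp: "1 / sqrt (cmod (complex_of_real (nu k) - z)) \<le> C / (1 + \<bar>L * k $ i\<bar>)" for k :: "real^'d" and i
  proof -
    let ?a = "\<bar>L * k $ i\<bar>"
    have nn: "nu k \<ge> 0" by (simp add: nu_def)
    have "\<bar>k $ i\<bar> \<le> norm k" by (rule component_le_norm_cart)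
    then have ki: "(k $ i)\<^sup>2 \<le> (norm k)\<^sup>2" by (metis abs_le_square_iff abs_norm_cancel)
    have "(1 + ?a)\<^sup>2 \<le> 2 * (1 + ?a\<^sup>2)"
      using sum_squares_bound[of 1 ?a] by (simp add: power2_sum)
    also have "?a\<^sup>2 \<le> L\<^sup>2 * (norm k)\<^sup>2"
      using ki by (simp add: power_mult_distrib mult_left_mono)
    also have "2 * (1 + L\<^sup>2 * (norm k)\<^sup>2) \<le> 2 * ((1 + 2 * L\<^sup>2) * (1 + nu k))"
      by (simp add: nu_def algebra_simps)
    also have "\<dots> = (2 * (1 + 2 * L\<^sup>2) / c) * (c * (1 + nu k))" using c by simp
    also have "\<dots> \<le> (2 * (1 + 2 * L\<^sup>2) / c) * cmod (complex_of_real (nu k) - z)"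
      using c nn by (intro mult_left_mono c(2)) auto
    finally have "sqrt ((1 + ?a)\<^sup>2) \<le> sqrt ((2 * (1 + 2 * L\<^sup>2) / c) * cmod (complex_of_real (nu k) - z))"
      by (rule real_sqrt_le_mono[rotated]) simp
    then have "1 + ?a \<le> C * sqrt (cmod (complex_of_real (nu k) - z))"
      unfolding C_def real_sqrt_mult by simp
    moreover have "cmod (complex_of_real (nu k) - z) > 0"
      using c(1) c(2)[OF nn] nn by (smt (verit) mult_pos_pos)
    ultimately show ?thesis by (simp add: field_simps)
  qed
  show ?thesis
  proof
    show "C > 0" by (rule C)
    fix k :: "real^'d"
    let ?u = "1 / sqrt (cmod (complex_of_real (nu k) - z))"
    have u0: "?u \<ge> 0" by simp
    have "C / (1 + \<bar>L * k $ i\<bar>) \<le> C" for i using C by (simp add: field_simps)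
    with comp[of k undefined] show "?u \<le> C" by (meson order_trans)
    show "?u \<le> C * (\<Prod>i\<in>UNIV. (1 + \<bar>L * k $ i\<bar>) powr (- 1 / CARD('d)))"
    proof (cases "?u = 0")
      case True
      then show ?thesis using C by (simp add: prod_nonneg)
    next
      case False
      then have up: "?u > 0" using u0 by linarith
      have "(\<Prod>i\<in>(UNIV::'d set). ?u powr (1 / CARD('d))) = ?u"
        using up by (simp add: powr_powr flip: powr_realpow)
      then have "?u = (\<Prod>i\<in>(UNIV::'d set). ?u powr (1 / CARD('d)))" by simp
      also have "\<dots> \<le> (\<Prod>i\<in>(UNIV::'d set). (C / (1 + \<bar>L * k $ i\<bar>)) powr (1 / CARD('d)))"
        using u0 by (intro prod_mono conjI powr_mono2 comp) auto
      also have "\<dots> = (\<Prod>i\<in>(UNIV::'d set). C powr (1 / CARD('d)) * (1 + \<bar>L * k $ i\<bar>) powr (- 1 / CARD('d)))"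
        using C by (intro prod.cong refl) (simp add: powr_divide powr_minus_divide)
      also have "\<dots> = C * (\<Prod>i\<in>UNIV. (1 + \<bar>L * k $ i\<bar>) powr (- 1 / CARD('d)))"
        using C by (simp add: prod.distrib powr_powr flip: powr_realpow)
      finally show ?thesis .
    qed
  qed
qed

lemma int_powr_summable:
  fixes s :: real
  assumes "s > 1"
  shows "(\<lambda>m::int. (1 + \<bar>of_int m\<bar>) powr (- s)) summable_on UNIV"
proof -
  let ?f = "\<lambda>m::int. (1 + \<bar>of_int m\<bar> :: real) powr (- s)"
  have "summable (\<lambda>n. real (Suc n) powr (- s))"
    using summable_real_powr_iff[of "- s"] assms by (subst summable_Suc_iff) simp
  then have *: "(\<lambda>n. real (Suc n) powr (- s)) summable_on UNIV"
    by (rule summable_nonneg_imp_summable_on) simp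
  have "?f summable_on range int"
    by (subst summable_on_reindex) (use * in \<open>auto simp: o_def add.commute\<close>)
  moreover have "?f summable_on range (\<lambda>n. - int n)"
    by (subst summable_on_reindex) (use * in \<open>auto simp: o_def add.commute inj_def\<close>)
  ultimately have "?f summable_on (range int \<union> range (\<lambda>n. - int n))"
    by (rule summable_on_union)
  moreover have "range int \<union> range (\<lambda>n. - int n) = UNIV"
    by (auto simp: image_iff) (metis int_cases2)
  ultimately show ?thesis by simp
qed

text \<open>In 1/x times y^(-e) replace the larger of x and y by the smaller: the term is at most
  x^(-1-e) + y^(-1-e). Both sums over the integers converge, and the translation by \<open>m\<close>
  does not change the bound.\<close>

lemma convolution_powr_bound:
  fixes e :: real
  assumes "e > 0"
  obtains S :: real where "\<And>m G. finite G \<Longrightarrow> (\<Sum>n\<in>G. 1 / (1 + \<bar>of_int (m - n)\<bar>) * (1 + \<bar>of_int n\<bar>) powr (- e)) \<le> S"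
proof -
  let ?f = "\<lambda>m::int. (1 + \<bar>of_int m\<bar> :: real) powr (- (1 + e))"
  have sf: "?f summable_on UNIV" by (rule int_powr_summable) (use assms in simp)
  have fin: "(\<Sum>n\<in>G. ?f n) \<le> infsum ?f UNIV" if "finite G" for G
    by (rule finite_sum_le_infsum[OF sf that]) auto
  have split: "1 / x * y powr (- e) \<le> x powr (- (1 + e)) + y powr (- (1 + e))" if "x \<ge> 1" "y \<ge> 1" for x y :: real
  proof (cases "x \<le> y")
    case True
    have "1 / x * y powr (- e) \<le> 1 / x * x powr (- e)"
      using True that assms by (intro mult_left_mono powr_mono2') auto
    also have "\<dots> = x powr (- (1 + e))" using that by (simp add: powr_minus_divide powr_add del: minus_add_distrib)
    finally show ?thesis using powr_ge_zero[of y "- (1 + e)"] by linarith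
  next
    case False
    have "1 / x * y powr (- e) \<le> 1 / y * y powr (- e)"
      using False that by (intro mult_right_mono divide_left_mono) auto
    also have "\<dots> = y powr (- (1 + e))" using that by (simp add: powr_minus_divide powr_add del: minus_add_distrib)
    finally show ?thesis using powr_ge_zero[of x "- (1 + e)"] by linarith
  qed
  show ?thesis
  proof (rule that[of "2 * infsum ?f UNIV"])
    fix m :: int and G :: "int set" assume G: "finite G"
    have "(\<Sum>n\<in>G. 1 / (1 + \<bar>of_int (m - n)\<bar>) * (1 + \<bar>of_int n\<bar>) powr (- e)) \<le> (\<Sum>n\<in>G. ?f (m - n) + ?f n)"
      by (intro sum_mono split) auto
    also have "\<dots> = (\<Sum>n\<in>(\<lambda>n. m - n) ` G. ?f n) + (\<Sum>n\<in>G. ?f n)"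
      by (subst sum.reindex) (auto simp: inj_on_def sum.distrib)
    also have "\<dots> \<le> 2 * infsum ?f UNIV"
      using fin[OF G] fin[of "(\<lambda>n. m - n) ` G"] G by simp
    finally show "(\<Sum>n\<in>G. 1 / (1 + \<bar>of_int (m - n)\<bar>) * (1 + \<bar>of_int n\<bar>) powr (- e)) \<le> 2 * infsum ?f UNIV" .
  qed
qed

text \<open>For the row sum the weight at the fixed momentum is bounded by a constant, while the
  weight at the summed momentum is used in product form. The sum then factors into one convolution
  sum for each coordinate.\<close>

lemma schur_kernel_resolvent:
  fixes z :: complex
  assumes z: "z \<notin> complex_of_real ` {0..}" and L: "L > 0"
  obtains C where "schur_kernel (dual_L L :: (real^'d::finite) set)
    (\<lambda>k q. 1 / sqrt (cmod (complex_of_real (nu k) - z)) * decay L (k - q) * (1 / sqrt (cmod (complex_of_real (nu q) - z)))) C"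
proof -
  obtain C where C: "C > 0"
    "\<And>k::real^'d::finite. 1 / sqrt (cmod (complex_of_real (nu k) - z)) \<le> C"
    "\<And>k::real^'d. 1 / sqrt (cmod (complex_of_real (nu k) - z)) \<le> C * (\<Prod>i\<in>UNIV. (1 + \<bar>L * k $ i\<bar>) powr (- 1 / CARD('d)))"
    using resolvent_sqrt_decay[OF z L] by metis
  define e where "e = 1 / real CARD('d)"
  have e: "e > 0" by (simp add: e_def)
  obtain S :: real where S: "\<And>m G. finite G \<Longrightarrow> (\<Sum>n\<in>G. 1 / (1 + \<bar>of_int (m - n)\<bar>) * (1 + \<bar>of_int n\<bar>) powr (- e)) \<le> S"
    using convolution_powr_bound[OF e] by blast
  have S0: "S \<ge> 0" using S[of "{}"] by simp
  let ?u = "\<lambda>k::real^'d. 1 / sqrt (cmod (complex_of_real (nu k) - z))"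
  have row: "(\<Sum>q\<in>F. decay L (k - q) * ?u q) \<le> C * S ^ CARD('d)"
    if k: "k \<in> dual_L L" and F: "finite F" "F \<subseteq> dual_L L" for k F
  proof -
    define \<iota> :: "('d \<Rightarrow> int) \<Rightarrow> real^'d" where "\<iota> m = (\<chi> i. of_int (m i) / L)" for m
    have inj: "inj \<iota>" using L by (auto simp: inj_def \<iota>_def vec_eq_iff fun_eq_iff)
    have surj: "\<exists>m. p = \<iota> m" if "p \<in> dual_L L" for p
    proof -
      obtain m where "\<And>i. p $ i = of_int (m i) / L"
        using \<open>p \<in> dual_L L\<close> unfolding dual_L_def by (auto simp: choice_iff)
      then show ?thesis by (intro exI[of _ m]) (simp add: \<iota>_def vec_eq_iff)
    qed
    obtain m where m: "k = \<iota> m" using surj[OF k] by blast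
    define F' where "F' = \<iota> -` F"
    have F'fin: "finite F'" unfolding F'_def by (rule finite_vimageI[OF F(1) inj])
    have FF': "F = \<iota> ` F'" using F(2) surj by (force simp: F'_def)
    \<comment> \<open>The coordinate projections of the finite set. Enlarging it to their product
      adds only nonnegative terms and lets the sum of products become a product of sums.\<close>
    define G where "G i = (\<lambda>n. n i) ` F'" for i
    have Gfin: "finite (G i)" for i unfolding G_def using F'fin by simp
    have sub: "F' \<subseteq> PiE UNIV G" by (auto simp: G_def)
    let ?h = "\<lambda>i n. 1 / (1 + \<bar>of_int (m i - n)\<bar>) * (1 + \<bar>of_int n\<bar> :: real) powr (- e)"
    have "(\<Sum>q\<in>F. decay L (k - q) * ?u q) = (\<Sum>n\<in>F'. decay L (\<iota> m - \<iota> n) * ?u (\<iota> n))"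
      unfolding FF' m by (subst sum.reindex) (use inj in \<open>auto simp: inj_on_def inj_def\<close>)
    also have "\<dots> \<le> (\<Sum>n\<in>F'. C * (\<Prod>i\<in>UNIV. ?h i (n i)))"
    proof (rule sum_mono)
      fix n :: "'d \<Rightarrow> int"
      have "decay L (\<iota> m - \<iota> n) * ?u (\<iota> n) \<le> decay L (\<iota> m - \<iota> n) * (C * (\<Prod>i\<in>UNIV. (1 + \<bar>L * \<iota> n $ i\<bar>) powr (- 1 / CARD('d))))"
        by (intro mult_left_mono C(3) decay_nonneg)
      also have "\<dots> = C * (\<Prod>i\<in>UNIV. ?h i (n i))"
      proof -
        have "L * (\<iota> m - \<iota> n) $ i = of_int (m i - n i)" "L * \<iota> n $ i = of_int (n i)" for i
          using L by (simp_all add: \<iota>_def field_simps)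
        then show ?thesis
          unfolding decay_def by (simp only: prod.distrib) (simp add: e_def)
      qed
      finally show "decay L (\<iota> m - \<iota> n) * ?u (\<iota> n) \<le> C * (\<Prod>i\<in>UNIV. ?h i (n i))" .
    qed
    also have "\<dots> = C * (\<Sum>n\<in>F'. \<Prod>i\<in>UNIV. ?h i (n i))" by (simp add: sum_distrib_left)
    also have "\<dots> \<le> C * (\<Sum>n\<in>PiE UNIV G. \<Prod>i\<in>UNIV. ?h i (n i))"
    proof (intro mult_left_mono sum_mono2 sub)
      show "finite (PiE UNIV G)" by (intro finite_PiE) (auto simp: Gfin)
      show "0 \<le> (\<Prod>i\<in>UNIV. ?h i (n i))" for n by (intro prod_nonneg) auto
    qed (use C in simp)
    also have "(\<Sum>n\<in>PiE UNIV G. \<Prod>i\<in>UNIV. ?h i (n i)) = (\<Prod>i\<in>UNIV. \<Sum>n\<in>G i. ?h i n)"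
      by (rule prod_sum_PiE[symmetric]) (auto simp: Gfin)
    also have "\<dots> \<le> (\<Prod>i\<in>(UNIV::'d set). S)"
      by (intro prod_mono conjI S sum_nonneg Gfin) auto
    finally show ?thesis using C by simp
  qed
  show ?thesis
  proof (rule that[of "C * (C * S ^ CARD('d))"], unfold_locales)
    fix k q :: "real^'d"
    show "0 \<le> ?u k * decay L (k - q) * ?u q" by (simp add: decay_nonneg)
    show "?u k * decay L (k - q) * ?u q = ?u q * decay L (q - k) * ?u k"
      using decay_minus_commute[of L k q] by (simp add: mult_ac)
  next
    fix k :: "real^'d" and F :: "(real^'d) set" assume *: "k \<in> dual_L L" "finite F" "F \<subseteq> dual_L L"
    have "(\<Sum>q\<in>F. ?u k * decay L (k - q) * ?u q) = ?u k * (\<Sum>q\<in>F. decay L (k - q) * ?u q)"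
      by (simp add: sum_distrib_left mult.assoc)
    also have "\<dots> \<le> C * (C * S ^ CARD('d))"
      by (intro mult_mono C(2) row[OF *] sum_nonneg) (use C in \<open>auto simp: decay_nonneg\<close>)
    finally show "(\<Sum>q\<in>F. ?u k * decay L (k - q) * ?u q) \<le> C * (C * S ^ CARD('d))" .
  qed
qed

text \<open>Each squared weight gives one factor to the kernel on either side; at the two ends of
  the chain one factor is left over.\<close>

lemma prod_sq_telescope:
  fixes u :: "nat \<Rightarrow> real"
  shows "(\<Prod>j\<in>{1..Suc n}. (u j)\<^sup>2) = u 1 * u (Suc n) * (\<Prod>l\<in>{1..n}. u l * u (l + 1))"
  by (induction n) (simp_all add: power2_eq_square mult_ac, metis mult.left_commute mult.commute)

lemma resolvent_chain_summable:
  fixes z :: complex and a c :: "real^'d::finite \<Rightarrow> real" and n :: nat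
  assumes z: "z \<notin> complex_of_real ` {0..}" and L: "L > 0"
    and a: "(\<lambda>k. (a k)\<^sup>2) summable_on dual_L L" and c: "(\<lambda>k. (c k)\<^sup>2) summable_on dual_L L"
    and a0: "\<And>k. a k \<ge> 0" and c0: "\<And>k. c k \<ge> 0"
  shows "(\<lambda>k. a (k 1) * c (k (n + 1)) * (\<Prod>l\<in>{1..n}. decay L (k l - k (l + 1)))
      * (\<Prod>j\<in>{1..n+1}. 1 / cmod (complex_of_real (nu (k j)) - z))) summable_on PiE {1..n+1} (\<lambda>_. dual_L L)"
proof -
  let ?u = "\<lambda>k::real^'d. 1 / sqrt (cmod (complex_of_real (nu k) - z))"
  obtain C where C: "C > 0" "\<And>k::real^'d::finite. ?u k \<le> C"
    using resolvent_sqrt_decay[OF z L] by metis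
  obtain S where "schur_kernel (dual_L L :: (real^'d) set) (\<lambda>k q. ?u k * decay L (k - q) * ?u q) S"
    using schur_kernel_resolvent[OF z L] by blast
  then interpret schur_kernel "dual_L L :: (real^'d) set" "\<lambda>k q. ?u k * decay L (k - q) * ?u q" S .
  \<comment> \<open>The leftover square roots at the ends are bounded, so they can be absorbed into
    the square-summable end weights.\<close>
  have sq: "(\<lambda>k. (f k * ?u k)\<^sup>2) summable_on dual_L L" if "(\<lambda>k. (f k)\<^sup>2) summable_on dual_L L" for f
  proof (rule summable_on_comparison_test)
    show "(\<lambda>k. (f k)\<^sup>2 * C\<^sup>2) summable_on dual_L L" by (rule summable_on_cmult_left[OF that])
    show "(f k * ?u k)\<^sup>2 \<le> (f k)\<^sup>2 * C\<^sup>2" for k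
      unfolding power_mult_distrib by (intro mult_left_mono power_mono C(2)) auto
  qed simp
  have eq: "a (k 1) * ?u (k 1) * (c (k (Suc n)) * ?u (k (Suc n))) * (\<Prod>l\<in>{1..n}. ?u (k l) * decay L (k l - k (l + 1)) * ?u (k (l + 1)))
    = a (k 1) * c (k (n + 1)) * (\<Prod>l\<in>{1..n}. decay L (k l - k (l + 1))) * (\<Prod>j\<in>{1..n+1}. 1 / cmod (complex_of_real (nu (k j)) - z))" for k
  proof -
    have "(\<Prod>j\<in>{1..n+1}. 1 / cmod (complex_of_real (nu (k j)) - z)) = (\<Prod>j\<in>{1..Suc n}. (?u (k j))\<^sup>2)"
      by (intro prod.cong) (auto simp: power_divide)
    also have "\<dots> = ?u (k 1) * ?u (k (Suc n)) * (\<Prod>l\<in>{1..n}. ?u (k l) * ?u (k (l + 1)))"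
      by (rule prod_sq_telescope)
    finally have e1: "(\<Prod>j\<in>{1..n+1}. 1 / cmod (complex_of_real (nu (k j)) - z)) = \<dots>" .
    have e2: "(\<Prod>l\<in>{1..n}. ?u (k l) * decay L (k l - k (l + 1)) * ?u (k (l + 1)))
       = (\<Prod>l\<in>{1..n}. decay L (k l - k (l + 1))) * (\<Prod>l\<in>{1..n}. ?u (k l) * ?u (k (l + 1)))"
      unfolding prod.distrib[symmetric] by (intro prod.cong) (auto simp: mult_ac)
    show ?thesis unfolding e1 e2 by (simp only: mult_ac Suc_eq_plus1)
  qed
  have "(\<lambda>k. a (k 1) * ?u (k 1) * (c (k (Suc n)) * ?u (k (Suc n))) * (\<Prod>l\<in>{1..n}. ?u (k l) * decay L (k l - k (l + 1)) * ?u (k (l + 1)))) summable_on PiE {1..Suc n} (\<lambda>_. dual_L L)"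
    by (rule chain_summable[OF sq[OF a] sq[OF c]]) (auto simp: a0 c0)
  then show ?thesis unfolding eq by simp
qed

section \<open>Moments of the Poisson sample\<close>

definition fibres :: "('a \<Rightarrow> 'b) \<Rightarrow> 'a set \<Rightarrow> 'a set set" where
  "fibres g I = (\<lambda>i. {l \<in> I. g l = i}) ` (g ` I)"

lemma partition_on_fibres: "partition_on I (fibres g I)"
  by (rule partition_onI) (auto simp: fibres_def disjnt_iff)

text \<open>A map with fibre partition \<open>A\<close> is the block map followed by an injection of
  \<open>A\<close> into \<open>S\<close>. The product on the right is the falling factorial counting
  these injections; with truncated subtraction it is 0 when there are more blocks than
  labels.\<close>

lemma card_functions_with_fibres:
  assumes I: "finite I" and S: "finite S" and A: "partition_on I A"
  shows "card {g \<in> PiE I (\<lambda>_. S). fibres g I = A} = prod ((-) (card S)) {0..<card A}"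
proof -
  have finA: "finite A" using finite_elements[OF I A] .
  have UA: "\<Union>A = I" using partition_onD1[OF A] by simp
  have dis: "a = b" if "a \<in> A" "b \<in> A" "l \<in> a" "l \<in> b" for a b l
    using disjointD[OF partition_onD2[OF A] that(1,2)] that(3,4) by blast
  have ne: "a \<noteq> {}" if "a \<in> A" for a using partition_onD3[OF A] that by blast
  define blk where "blk l = (THE a. a \<in> A \<and> l \<in> a)" for l
  have blk_eq: "blk l = a" if "a \<in> A" "l \<in> a" for l a
    unfolding blk_def by (rule the_equality) (use that dis in blast)+
  have blk: "blk l \<in> A" "l \<in> blk l" if "l \<in> I" for l
    using that UA blk_eq by auto
  define \<Phi> where "\<Phi> f = (\<lambda>l\<in>I. f (blk l))" for f :: "'a set \<Rightarrow> 'b"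
  have "bij_betw \<Phi> {f \<in> A \<rightarrow>\<^sub>E S. inj_on f A} {g \<in> PiE I (\<lambda>_. S). fibres g I = A}"
    unfolding bij_betw_def
  proof (intro conjI equalityI subsetI)
    show "inj_on \<Phi> {f \<in> A \<rightarrow>\<^sub>E S. inj_on f A}"
    proof (rule inj_onI)
      fix f f' assume f: "f \<in> {f \<in> A \<rightarrow>\<^sub>E S. inj_on f A}" "f' \<in> {f \<in> A \<rightarrow>\<^sub>E S. inj_on f A}" and eq: "\<Phi> f = \<Phi> f'"
      show "f = f'"
      proof (rule PiE_ext)
        show "f \<in> A \<rightarrow>\<^sub>E S" "f' \<in> A \<rightarrow>\<^sub>E S" using f by auto
        fix a assume a: "a \<in> A"
        then obtain l where l: "l \<in> a" using ne by blast
        then have "l \<in> I" using a UA by blast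
        then show "f a = f' a" using fun_cong[OF eq, of l] blk_eq[OF a l] by (simp add: \<Phi>_def)
      qed
    qed
  next
    fix g assume "g \<in> \<Phi> ` {f \<in> A \<rightarrow>\<^sub>E S. inj_on f A}"
    then obtain f where f: "f \<in> A \<rightarrow>\<^sub>E S" "inj_on f A" "g = \<Phi> f" by blast
    have g: "g l = f (blk l)" if "l \<in> I" for l using that f by (simp add: \<Phi>_def)
    have fib: "{l' \<in> I. g l' = g l} = blk l" if l: "l \<in> I" for l
    proof (intro equalityI subsetI)
      fix l' assume "l' \<in> {l' \<in> I. g l' = g l}"
      then have l': "l' \<in> I" "f (blk l') = f (blk l)" using g l by auto
      then have "blk l' = blk l" using f(2) blk l by (meson inj_onD)
      then show "l' \<in> blk l" using blk(2)[OF l'(1)] by simp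
    next
      fix l' assume l': "l' \<in> blk l"
      then have "l' \<in> I" using blk(1)[OF l] UA by blast
      moreover have "blk l' = blk l" using blk_eq[OF blk(1)[OF l] l'] .
      ultimately show "l' \<in> {l' \<in> I. g l' = g l}" using g l by simp
    qed
    have "fibres g I = blk ` I" by (simp add: fibres_def image_image fib)
    also have "\<dots> = A"
    proof (intro equalityI subsetI)
      fix a assume a: "a \<in> A"
      then obtain l where "l \<in> a" using ne by blast
      then show "a \<in> blk ` I" using a UA blk_eq[OF a] by (metis UnionI imageI)
    qed (use blk in auto)
    finally show "g \<in> {g \<in> PiE I (\<lambda>_. S). fibres g I = A}"
      using f blk by (auto simp: \<Phi>_def)
  next
    fix g assume "g \<in> {g \<in> PiE I (\<lambda>_. S). fibres g I = A}"
    then have g: "g \<in> PiE I (\<lambda>_. S)" "fibres g I = A" by auto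
    define f where "f = (\<lambda>a\<in>A. g (SOME l. l \<in> a))"
    have fa: "f a = g l" if al: "a \<in> A" "l \<in> a" for a l
    proof -
      obtain i where i: "a = {l \<in> I. g l = i}" using g(2) al(1) by (auto simp: fibres_def)
      have "(SOME l. l \<in> a) \<in> a" using al(2) by (rule someI)
      then show ?thesis using al i by (simp add: f_def)
    qed
    have "f \<in> A \<rightarrow>\<^sub>E S"
    proof
      fix a assume a: "a \<in> A"
      then obtain l where l: "l \<in> a" using ne by blast
      then have "l \<in> I" using a UA by blast
      then show "f a \<in> S" using fa[OF a l] g(1) by auto
    qed (simp add: f_def)
    moreover have "inj_on f A"
    proof (rule inj_onI)
      fix a b assume ab: "a \<in> A" "b \<in> A" "f a = f b"
      obtain la lb where l: "la \<in> a" "lb \<in> b" using ne ab by blast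
      obtain i j where ij: "a = {l \<in> I. g l = i}" "b = {l \<in> I. g l = j}" using g(2) ab by (auto simp: fibres_def)
      have "i = j" using l ij fa[OF ab(1) l(1)] fa[OF ab(2) l(2)] ab(3) by simp
      then show "a = b" using ij by simp
    qed
    moreover have "g = \<Phi> f"
    proof (rule PiE_ext[OF g(1)])
      show "\<Phi> f \<in> PiE I (\<lambda>_. S)"
        using \<open>f \<in> A \<rightarrow>\<^sub>E S\<close> blk by (auto simp: \<Phi>_def)
      show "g l = \<Phi> f l" if "l \<in> I" for l
        using fa[OF blk[OF that]] that by (simp add: \<Phi>_def)
    qed
    ultimately show "g \<in> \<Phi> ` {f \<in> A \<rightarrow>\<^sub>E S. inj_on f A}" by blast
  qed
  from bij_betw_same_card[OF this]
  have "card {g \<in> PiE I (\<lambda>_. S). fibres g I = A} = card {f \<in> A \<rightarrow>\<^sub>E S. inj_on f A}"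
    by (rule sym)
  then show ?thesis
    using card_inj_on_subset_funcset[OF finA S subset_refl] by simp
qed

lemma sum_functions_by_fibres:
  fixes W :: "'a set set \<Rightarrow> 'c::comm_ring_1"
  assumes I: "finite I" and S: "finite S"
  shows "(\<Sum>g\<in>PiE I (\<lambda>_. S). W (fibres g I)) = (\<Sum>A | partition_on I A. of_nat (prod ((-) (card S)) {0..<card A}) * W A)"
proof -
  have "(\<Sum>g\<in>PiE I (\<lambda>_. S). W (fibres g I))
      = (\<Sum>A | partition_on I A. \<Sum>g\<in>{g \<in> PiE I (\<lambda>_. S). fibres g I = A}. W (fibres g I))"
    by (rule sum.group[symmetric])
       (auto simp: I S finite_PiE finitely_many_partition_on partition_on_fibres)
  also have "\<dots> = (\<Sum>A | partition_on I A. of_nat (prod ((-) (card S)) {0..<card A}) * W A)"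
    by (intro sum.cong refl) (simp add: card_functions_with_fibres[OF I S, symmetric])
  finally show ?thesis .
qed

lemma falling_prod_shift: "prod ((-) (i + j)) {0..<j} * fact i = (fact (i + j) :: nat)"
proof (induction j)
  case (Suc j)
  have "prod ((-) (i + Suc j)) {0..<Suc j} = (i + Suc j) * prod ((-) (i + j)) {0..<j}"
    by (subst prod.atLeast0_lessThan_Suc_shift) (simp add: o_def)
  then have "prod ((-) (i + Suc j)) {0..<Suc j} * fact i = (i + Suc j) * (prod ((-) (i + j)) {0..<j} * fact i)"
    by (simp only: mult.assoc)
  then show ?case unfolding Suc by simp
qed simp

lemma falling_prod_zero: "n < j \<Longrightarrow> prod ((-) n) {0..<j} = (0::nat)"
  by (rule prod_zero) auto

text \<open>The falling factorial cancels against n!, so after a shift by \<open>j\<close> the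
  series is \<open>r ^ j\<close> times the exponential series. The terms below \<open>j\<close>
  contain a zero factor.\<close>

lemma poisson_factorial_moment:
  assumes r: "r > 0"
  shows "integrable (measure_pmf (poisson_pmf r)) (\<lambda>n. real (prod ((-) n) {0..<j}))"
    and "(\<integral>n. real (prod ((-) n) {0..<j}) \<partial>measure_pmf (poisson_pmf r)) = r ^ j"
proof -
  let ?f = "\<lambda>n. real (prod ((-) n) {0..<j})"
  have "(\<lambda>i. r ^ j * exp (- r) * (r ^ i / fact i)) sums (r ^ j * exp (- r) * exp r)"
    using exp_converges[of r] by (intro sums_mult) (simp add: scaleR_conv_of_real divide_inverse mult.commute)
  moreover have "pmf (poisson_pmf r) (i + j) * ?f (i + j) = r ^ j * exp (- r) * (r ^ i / fact i)" for i
  proof -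
    have "?f (i + j) * fact i = fact (i + j)"
      using arg_cong[OF falling_prod_shift[of i j], of real] by simp
    then have "?f (i + j) = fact (i + j) / fact i" by (simp add: field_simps)
    then show ?thesis using r by (simp add: power_add field_simps)
  qed
  ultimately have "(\<lambda>i. pmf (poisson_pmf r) (i + j) * ?f (i + j)) sums r ^ j"
    by (simp add: mult.assoc flip: exp_add)
  then have s: "(\<lambda>n. pmf (poisson_pmf r) n * ?f n) sums r ^ j"
    by (subst (asm) sums_iff_shift) (simp add: falling_prod_zero)
  have "(\<integral>\<^sup>+n. ennreal (?f n) \<partial>measure_pmf (poisson_pmf r)) = (\<integral>\<^sup>+n. ennreal (pmf (poisson_pmf r) n) * ennreal (?f n) \<partial>count_space UNIV)"
    by (rule nn_integral_measure_pmf)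
  also have "\<dots> = (\<Sum>n. ennreal (pmf (poisson_pmf r) n * ?f n))"
    unfolding nn_integral_count_space_nat by (intro suminf_cong ennreal_mult[symmetric]) (simp_all add: prod_nonneg)
  also have "\<dots> = ennreal (r ^ j)"
    using s by (subst suminf_ennreal2) (auto simp: sums_iff prod_nonneg)
  finally have nn: "(\<integral>\<^sup>+n. ennreal (?f n) \<partial>measure_pmf (poisson_pmf r)) = ennreal (r ^ j)" .
  show i: "integrable (measure_pmf (poisson_pmf r)) ?f"
    by (rule integrableI_nonneg) (simp_all add: nn del: of_nat_prod)
  show "(\<integral>n. ?f n \<partial>measure_pmf (poisson_pmf r)) = r ^ j"
    using nn r by (subst integral_eq_nn_integral) (simp_all del: of_nat_prod)
qed

section \<open>Independence and product measures\<close>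

text \<open>The integrand depends on finitely many coordinates only, and the image of the infinite
  product measure under restriction to them is the finite product measure.\<close>

lemma PiM_integral_prod:
  fixes \<phi> :: "'i \<Rightarrow> 'a \<Rightarrow> 'b::{real_normed_field,banach,second_countable_topology}"
  assumes "prob_space M" and K: "finite K" and \<phi>: "\<And>i. i \<in> K \<Longrightarrow> integrable M (\<phi> i)"
  shows "integrable (PiM UNIV (\<lambda>_. M)) (\<lambda>x. \<Prod>i\<in>K. \<phi> i (x i))"
    and "(\<integral>x. (\<Prod>i\<in>K. \<phi> i (x i)) \<partial>PiM UNIV (\<lambda>_. M)) = (\<Prod>i\<in>K. integral\<^sup>L M (\<phi> i))"
proof -
  interpret prob_space M by fact
  interpret product_prob_space "\<lambda>_::'i. M" UNIV by unfold_locales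
  have d: "distr (PiM UNIV (\<lambda>_. M)) (PiM K (\<lambda>_. M)) (\<lambda>x. restrict x K) = PiM K (\<lambda>_. M)"
    by (rule distr_PiM_restrict_finite[OF K]) simp
  have r: "(\<lambda>x. restrict x K) \<in> measurable (PiM UNIV (\<lambda>_. M)) (PiM K (\<lambda>_. M))"
    by (rule measurable_restrict_subset) simp
  have i: "integrable (PiM K (\<lambda>_. M)) (\<lambda>x. \<Prod>i\<in>K. \<phi> i (x i))"
    by (rule product_integrable_prod[OF K \<phi>])
  have m: "(\<lambda>x. \<Prod>i\<in>K. \<phi> i (x i)) \<in> borel_measurable (PiM K (\<lambda>_. M))"
    using i by simp
  have e: "(\<Prod>i\<in>K. \<phi> i (restrict x K i)) = (\<Prod>i\<in>K. \<phi> i (x i))" for x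
    by (intro prod.cong) auto
  show "integrable (PiM UNIV (\<lambda>_. M)) (\<lambda>x. \<Prod>i\<in>K. \<phi> i (x i))"
    using integrable_distr[OF r, of "\<lambda>x. \<Prod>i\<in>K. \<phi> i (x i)"] i by (simp add: d e)
  have "(\<integral>x. (\<Prod>i\<in>K. \<phi> i (x i)) \<partial>PiM K (\<lambda>_. M)) = (\<integral>x. (\<Prod>i\<in>K. \<phi> i (x i)) \<partial>PiM UNIV (\<lambda>_. M))"
    by (subst d[symmetric], subst integral_distr[OF r m]) (simp add: e)
  then show "(\<integral>x. (\<Prod>i\<in>K. \<phi> i (x i)) \<partial>PiM UNIV (\<lambda>_. M)) = (\<Prod>i\<in>K. integral\<^sup>L M (\<phi> i))"
    using product_integral_prod[OF K \<phi>] by simp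
qed

lemma (in pair_sigma_finite) integral_mult_pair:
  fixes f :: "'a \<Rightarrow> 'c::{real_normed_field,banach,second_countable_topology}" and h :: "'b \<Rightarrow> 'c"
  assumes f: "integrable M1 f" and h: "integrable M2 h"
  shows "integrable (M1 \<Otimes>\<^sub>M M2) (\<lambda>x. f (fst x) * h (snd x))"
    and "(\<integral>x. f (fst x) * h (snd x) \<partial>(M1 \<Otimes>\<^sub>M M2)) = integral\<^sup>L M1 f * integral\<^sup>L M2 h"
proof -
  have [measurable]: "f \<in> borel_measurable M1" "h \<in> borel_measurable M2" using f h by auto
  show i: "integrable (M1 \<Otimes>\<^sub>M M2) (\<lambda>x. f (fst x) * h (snd x))"
    by (rule Fubini_integrable) (use f h in \<open>auto simp: norm_mult\<close>)
  show "(\<integral>x. f (fst x) * h (snd x) \<partial>(M1 \<Otimes>\<^sub>M M2)) = integral\<^sup>L M1 f * integral\<^sup>L M2 h"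
    using integral_fst'[OF i] by simp
qed

lemma uniform_box_prob: "L > 0 \<Longrightarrow> prob_space (uniform_measure lborel (box_L L))"
  by (rule prob_space_uniform_measure) (auto simp: emeasure_box_L)

lemma integral_uniform_box:
  fixes f :: "real^'d::finite \<Rightarrow> complex"
  assumes L: "L > 0" and [measurable]: "f \<in> borel_measurable borel"
  shows "integral\<^sup>L (uniform_measure lborel (box_L L)) f = integral\<^sup>L (leb_box L) f / L ^ CARD('d)"
proof -
  let ?v = "L ^ CARD('d)"
  have v: "?v > 0" using L by simp
  have "uniform_measure lborel (box_L L :: (real^'d) set) = density lborel (\<lambda>x. ennreal (indicator (box_L L) x / ?v))"
    unfolding uniform_measure_def emeasure_box_L[OF L]
    by (intro density_cong) (auto simp: indicator_def divide_ennreal[symmetric] v)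
  then have "integral\<^sup>L (uniform_measure lborel (box_L L)) f = (\<integral>x. (indicator (box_L L) x / ?v) *\<^sub>R f x \<partial>lborel)"
    using L by (simp add: integral_density)
  also have "\<dots> = (\<integral>x. indicator (box_L L) x *\<^sub>R f x \<partial>lborel) / ?v"
    by (simp add: scaleR_conv_of_real)
  also have "(\<integral>x. indicator (box_L L) x *\<^sub>R f x \<partial>lborel) = integral\<^sup>L (leb_box L) f"
    by (simp add: integral_leb_box integral_density)
  finally show ?thesis .
qed

lemma prod_over_fibres:
  assumes "finite I"
  shows "(\<Prod>l\<in>I. x l (g l)) = (\<Prod>i\<in>g ` I. \<Prod>l\<in>{l \<in> I. g l = i}. x l i :: 'c::comm_monoid_mult)"
  by (subst prod.image_gen[OF assms, of _ g]) (auto intro!: prod.cong)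

lemma prod_fibres: "(\<Prod>a\<in>fibres g I. w a) = (\<Prod>i\<in>g ` I. w {l \<in> I. g l = i})"
  unfolding fibres_def by (subst prod.reindex) (auto simp: inj_on_def)

section \<open>Expectations over the Poisson sample\<close>

type_synonym 'd sample = "nat \<times> (nat \<Rightarrow> real^'d) \<times> (nat \<Rightarrow> real)"

abbreviation unif_seq :: "real \<Rightarrow> (nat \<Rightarrow> real^'d::finite) measure" where
  "unif_seq L \<equiv> (\<Pi>\<^sub>M \<gamma>\<in>UNIV. uniform_measure lborel (box_L L))"

abbreviation iid_seq :: "real measure \<Rightarrow> (nat \<Rightarrow> real) measure" where
  "iid_seq mu \<equiv> (\<Pi>\<^sub>M \<gamma>\<in>UNIV. mu)"

abbreviation poisson_count :: "real \<Rightarrow> 'd::finite itself \<Rightarrow> nat measure" where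
  "poisson_count L t \<equiv> measure_pmf (poisson_pmf (vol_L L t))"

abbreviation mark_space :: "'d::finite itself \<Rightarrow> real \<Rightarrow> real measure \<Rightarrow> ((nat \<Rightarrow> real^'d) \<times> (nat \<Rightarrow> real)) measure" where
  "mark_space t L mu \<equiv> unif_seq L \<Otimes>\<^sub>M iid_seq mu"

locale poisson_sample =
  fixes L :: real and mu :: "real measure"
  assumes L: "L > 0" and mu_prob: "prob_space mu" and mu_sets: "sets mu = sets borel"
    and mu_moments: "\<And>k::nat. integrable mu (\<lambda>v. v ^ k)"
begin

lemma Y_prob: "prob_space (unif_seq L :: (nat \<Rightarrow> real^'d) measure)"
  by (rule prob_space_PiM) (rule uniform_box_prob[OF L])

lemma W_prob: "prob_space (iid_seq mu)"
  by (rule prob_space_PiM) (rule mu_prob)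

lemma pair_YW: "pair_prob_space (unif_seq L :: (nat \<Rightarrow> real^'d) measure) (iid_seq mu)"
proof -
  interpret A: prob_space "unif_seq L :: (nat \<Rightarrow> real^'d) measure" by (rule Y_prob)
  interpret B: prob_space "iid_seq mu" by (rule W_prob)
  show ?thesis by unfold_locales
qed

lemma YW_prob: "prob_space (mark_space TYPE('d::finite) L mu)"
proof -
  interpret pair_prob_space "unif_seq L :: (nat \<Rightarrow> real^'d) measure" "iid_seq mu" by (rule pair_YW)
  show ?thesis by (rule P.prob_space_axioms)
qed

lemma pair_Q: "pair_sigma_finite (poisson_count L TYPE('d::finite)) (mark_space TYPE('d::finite) L mu)"
proof -
  interpret A: prob_space "mark_space TYPE('d::finite) L mu" by (rule YW_prob)
  show ?thesis by unfold_locales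
qed

lemma vol_pos: "vol_L L TYPE('d::finite) > 0"
  using L by (simp add: vol_L_def)

lemma sample_space_eq: "sample_space L mu = (poisson_count L TYPE('d::finite)) \<Otimes>\<^sub>M (mark_space TYPE('d::finite) L mu)"
  by (simp add: sample_space_def)

lemma measurable_v[measurable]: "(\<lambda>x. snd x \<gamma>) \<in> borel_measurable (mark_space TYPE('d::finite) L mu)"
proof -
  have "(\<lambda>v. v \<gamma>) \<in> measurable (iid_seq mu) mu" by (rule measurable_component_singleton) simp
  then have "(\<lambda>v. v \<gamma>) \<in> borel_measurable (iid_seq mu)" using measurable_cong_sets[OF refl mu_sets] by blast
  then show ?thesis by (rule measurable_compose[OF measurable_snd])
qed

lemma measurable_y[measurable]: "(\<lambda>x. fst x \<gamma>) \<in> borel_measurable (mark_space TYPE('d::finite) L mu)"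
proof -
  have "(\<lambda>v. v \<gamma>) \<in> measurable (unif_seq L :: (nat \<Rightarrow> real^'d) measure) (uniform_measure lborel (box_L L))" by (rule measurable_component_singleton) simp
  then have "(\<lambda>v. v \<gamma>) \<in> borel_measurable (unif_seq L :: (nat \<Rightarrow> real^'d) measure)"
    using measurable_cong_sets[OF refl, of "uniform_measure lborel (box_L L)" borel] by simp
  then show ?thesis by (rule measurable_compose[OF measurable_fst])
qed

text \<open>The number of points is discrete, so measurability may be checked at each fixed count,
  where the random sums have a fixed range.\<close>

lemma measurable_sample:
  assumes "\<And>m. (\<lambda>x. f (m, x)) \<in> borel_measurable (mark_space TYPE('d::finite) L mu)"
  shows "f \<in> borel_measurable ((poisson_count L TYPE('d::finite)) \<Otimes>\<^sub>M (mark_space TYPE('d::finite) L mu))"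
proof -
  have "f \<in> borel_measurable (count_space UNIV \<Otimes>\<^sub>M (mark_space TYPE('d::finite) L mu))"
    by (rule measurable_pair_measure_countable1) (use assms in auto)
  moreover have "sets (count_space UNIV \<Otimes>\<^sub>M (mark_space TYPE('d::finite) L mu)) = sets ((poisson_count L TYPE('d::finite)) \<Otimes>\<^sub>M (mark_space TYPE('d::finite) L mu))"
    by (rule sets_pair_measure_cong) auto
  ultimately show ?thesis using measurable_cong_sets by blast
qed

lemma uniform_chr:
  assumes "q \<in> dual_L L"
  shows "(\<integral>x. cnj (chr q (x::real^'d)) \<partial>uniform_measure lborel (box_L L)) = (if q = 0 then 1 else 0)"
proof -
  have "(\<integral>x. cnj (chr q x) \<partial>uniform_measure lborel (box_L L)) = (\<integral>x. chr (- q) x \<partial>leb_box L) / L ^ CARD('d)"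
    unfolding cnj_chr_minus by (rule integral_uniform_box[OF L]) measurable
  then show ?thesis using integral_chr[OF L dual_L_uminus[OF assms]] L by simp
qed

text \<open>Factors with the same label share their position and their mark: the marks combine to a
  power and the phases to the character of the summed momentum. Different labels are independent,
  and the uniform average of a character tests whether its momentum is zero.\<close>

lemma chain_term:
  fixes p :: "'i \<Rightarrow> real^'d" and g :: "'i \<Rightarrow> nat"
  assumes I: "finite I" and p: "\<And>l. l \<in> I \<Longrightarrow> p l \<in> dual_L L"
  defines "F \<equiv> \<lambda>x. \<Prod>l\<in>I. complex_of_real (snd x (g l)) * cnj (chr (p l) (fst x (g l)))"
  shows "integrable (mark_space TYPE('d::finite) L mu) F"
    and "integral\<^sup>L (mark_space TYPE('d::finite) L mu) F = (\<Prod>a\<in>fibres g I. complex_of_real (moment mu (card a)) * (if (\<Sum>l\<in>a. p l) = 0 then 1 else 0))"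
proof -
  interpret pair_prob_space "unif_seq L :: (nat \<Rightarrow> real^'d) measure" "iid_seq mu" by (rule pair_YW)
  let ?K = "g ` I"
  let ?fib = "\<lambda>i. {l \<in> I. g l = i}"
  define f where "f i x = cnj (chr (\<Sum>l\<in>?fib i. p l) (x::real^'d))" for i x
  define h where "h i v = complex_of_real (v ^ card (?fib i))" for i v
  have K: "finite ?K" using I by simp
  have eq: "F x = (\<Prod>i\<in>?K. f i (fst x i)) * (\<Prod>i\<in>?K. h i (snd x i))" for x
  proof -
    have "F x = (\<Prod>i\<in>?K. \<Prod>l\<in>?fib i. complex_of_real (snd x i) * cnj (chr (p l) (fst x i)))"
      unfolding F_def by (rule prod_over_fibres[OF I])
    also have "\<dots> = (\<Prod>i\<in>?K. f i (fst x i) * h i (snd x i))"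
      by (intro prod.cong refl) (simp add: f_def h_def prod.distrib chr_sum_left mult.commute)
    finally show ?thesis by (simp add: prod.distrib)
  qed
  have fi: "integrable (uniform_measure lborel (box_L L)) (f i)" for i
  proof -
    interpret U: prob_space "uniform_measure lborel (box_L L :: (real^'d) set)" by (rule uniform_box_prob[OF L])
    have "f i \<in> borel_measurable borel" unfolding f_def cnj_chr_minus by measurable
    then show ?thesis by (intro U.integrable_const_bound[where B=1]) (auto simp: f_def)
  qed
  have hi: "integrable mu (h i)" for i
    unfolding h_def by (intro integrable_of_real mu_moments)
  have iY: "integrable (unif_seq L :: (nat \<Rightarrow> real^'d) measure) (\<lambda>y. \<Prod>i\<in>?K. f i (y i))" and iW: "integrable (iid_seq mu) (\<lambda>v. \<Prod>i\<in>?K. h i (v i))"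
    using PiM_integral_prod(1)[OF uniform_box_prob[OF L] K fi] PiM_integral_prod(1)[OF mu_prob K hi] by auto
  show "integrable (mark_space TYPE('d::finite) L mu) F"
    using integral_mult_pair(1)[OF iY iW] by (simp add: eq[abs_def])
  have "integral\<^sup>L (mark_space TYPE('d::finite) L mu) F = (\<Prod>i\<in>?K. integral\<^sup>L (uniform_measure lborel (box_L L)) (f i)) * (\<Prod>i\<in>?K. integral\<^sup>L mu (h i))"
    using integral_mult_pair(2)[OF iY iW] PiM_integral_prod(2)[OF uniform_box_prob[OF L] K fi] PiM_integral_prod(2)[OF mu_prob K hi]
    by (simp add: eq[abs_def])
  also have "\<dots> = (\<Prod>i\<in>?K. complex_of_real (moment mu (card (?fib i))) * (if (\<Sum>l\<in>?fib i. p l) = 0 then 1 else 0))"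
  proof -
    have "integral\<^sup>L (uniform_measure lborel (box_L L)) (f i) = (if (\<Sum>l\<in>?fib i. p l) = 0 then 1 else 0)" for i
      unfolding f_def by (intro uniform_chr dual_L_sum p) simp
    moreover have "integral\<^sup>L mu (h i) = complex_of_real (moment mu (card (?fib i)))" for i
      unfolding h_def moment_def by (rule integral_complex_of_real)
    ultimately show ?thesis by (simp add: prod.distrib mult.commute del: if_image_distrib)
  qed
  finally show "integral\<^sup>L (mark_space TYPE('d::finite) L mu) F = (\<Prod>a\<in>fibres g I. complex_of_real (moment mu (card a)) * (if (\<Sum>l\<in>a. p l) = 0 then 1 else 0))"
    by (simp add: prod_fibres)
qed

text \<open>The analogue of \<open>chain_term\<close> with absolute values, where the positions
  disappear. It provides the dominating function for the interchange of sum and expectation.\<close>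

lemma abs_chain_term:
  fixes g :: "'i \<Rightarrow> nat"
  assumes I: "finite I"
  shows "integrable (mark_space TYPE('d::finite) L mu) (\<lambda>x. \<Prod>l\<in>I. \<bar>snd x (g l)\<bar>)"
    and "(\<integral>x. (\<Prod>l\<in>I. \<bar>snd x (g l)\<bar>) \<partial>(mark_space TYPE('d::finite) L mu)) = (\<Prod>a\<in>fibres g I. \<integral>v. \<bar>v\<bar> ^ card a \<partial>mu)"
proof -
  interpret pair_prob_space "unif_seq L :: (nat \<Rightarrow> real^'d) measure" "iid_seq mu" by (rule pair_YW)
  let ?K = "g ` I"
  let ?fib = "\<lambda>i. {l \<in> I. g l = i}"
  have K: "finite ?K" using I by simp
  have eq: "(\<Prod>l\<in>I. \<bar>v (g l)\<bar>) = (\<Prod>i\<in>?K. \<bar>v i\<bar> ^ card (?fib i))" for v :: "nat \<Rightarrow> real"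
    by (subst prod_over_fibres[OF I]) simp
  have hi: "integrable mu (\<lambda>v. \<bar>v\<bar> ^ k)" for k
    using integrable_norm[OF mu_moments[of k]] by (simp add: power_abs)
  have one: "integrable (unif_seq L :: (nat \<Rightarrow> real^'d) measure) (\<lambda>y. 1::real)" by simp
  have iW: "integrable (iid_seq mu) (\<lambda>v. \<Prod>i\<in>?K. \<bar>v i\<bar> ^ card (?fib i))"
    using PiM_integral_prod(1)[OF mu_prob K hi] .
  show "integrable (mark_space TYPE('d::finite) L mu) (\<lambda>x. \<Prod>l\<in>I. \<bar>snd x (g l)\<bar>)"
    using integral_mult_pair(1)[OF one iW] by (simp add: eq)
  show "(\<integral>x. (\<Prod>l\<in>I. \<bar>snd x (g l)\<bar>) \<partial>(mark_space TYPE('d::finite) L mu)) = (\<Prod>a\<in>fibres g I. \<integral>v. \<bar>v\<bar> ^ card a \<partial>mu)"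
    using integral_mult_pair(2)[OF one iW] PiM_integral_prod(2)[OF mu_prob K hi, of "\<lambda>i. card (?fib i)"] M1.prob_space
    by (simp add: eq prod_fibres)
qed

text \<open>Expanding the product over the configurations and grouping them by which labels coincide
  produces the partitions; the number of configurations with given coincidences is a falling factorial of m.\<close>
lemma integral_prod_sum_by_partitions:
  fixes \<xi> :: "'i \<Rightarrow> nat \<Rightarrow> 'x \<Rightarrow> 'b::{real_normed_field,banach,second_countable_topology}"
  assumes I: "finite I"
    and int: "\<And>g. integrable N (\<lambda>x. \<Prod>l\<in>I. \<xi> l (g l) x)"
    and val: "\<And>g. (\<integral>x. (\<Prod>l\<in>I. \<xi> l (g l) x) \<partial>N) = (\<Prod>a\<in>fibres g I. w a)"
  shows "integrable N (\<lambda>x. \<Prod>l\<in>I. \<Sum>\<gamma>\<in>{1..m}. \<xi> l \<gamma> x)"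
    and "(\<integral>x. (\<Prod>l\<in>I. \<Sum>\<gamma>\<in>{1..m}. \<xi> l \<gamma> x) \<partial>N)
      = (\<Sum>A | partition_on I A. of_nat (prod ((-) m) {0..<card A}) * (\<Prod>a\<in>A. w a))"
proof -
  have eq: "(\<Prod>l\<in>I. \<Sum>\<gamma>\<in>{1..m}. \<xi> l \<gamma> x) = (\<Sum>g\<in>PiE I (\<lambda>_. {1..m}). \<Prod>l\<in>I. \<xi> l (g l) x)" for x
    by (rule prod_sum_PiE[OF I]) simp
  show "integrable N (\<lambda>x. \<Prod>l\<in>I. \<Sum>\<gamma>\<in>{1..m}. \<xi> l \<gamma> x)"
    unfolding eq by (intro Bochner_Integration.integrable_sum int)
  have "(\<integral>x. (\<Prod>l\<in>I. \<Sum>\<gamma>\<in>{1..m}. \<xi> l \<gamma> x) \<partial>N) = (\<Sum>g\<in>PiE I (\<lambda>_. {1..m}). \<Prod>a\<in>fibres g I. w a)"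
    unfolding eq by (subst Bochner_Integration.integral_sum) (auto simp: int val)
  also have "\<dots> = (\<Sum>A | partition_on I A. of_nat (prod ((-) m) {0..<card A}) * (\<Prod>a\<in>A. w a))"
    using sum_functions_by_fibres[OF I, of "{1..m}" "\<lambda>A. \<Prod>a\<in>A. w a"] by simp
  finally show "(\<integral>x. (\<Prod>l\<in>I. \<Sum>\<gamma>\<in>{1..m}. \<xi> l \<gamma> x) \<partial>N)
      = (\<Sum>A | partition_on I A. of_nat (prod ((-) m) {0..<card A}) * (\<Prod>a\<in>A. w a))" .
qed

text \<open>At a fixed count the expectation is a linear combination of falling factorials of the
  count, and these are integrable for the Poisson law.\<close>

lemma abs_moment_integrable:
  assumes I: "finite (I :: 'i set)"
  shows "integrable (sample_space L mu :: ('d::finite) sample measure)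
    (\<lambda>\<omega>. \<Prod>l\<in>I. \<Sum>\<gamma>\<in>{1..fst \<omega>}. \<bar>snd (snd \<omega>) \<gamma>\<bar>)"
proof -
  interpret pair_sigma_finite "poisson_count L TYPE('d::finite)" "mark_space TYPE('d::finite) L mu" by (rule pair_Q)
  note T = integral_prod_sum_by_partitions[OF I abs_chain_term(1)[OF I] abs_chain_term(2)[OF I]]
  show ?thesis
    unfolding sample_space_eq
  proof (rule Fubini_integrable)
    show "(\<lambda>\<omega>. \<Prod>l\<in>I. \<Sum>\<gamma>\<in>{1..fst \<omega>}. \<bar>snd (snd \<omega>) \<gamma>\<bar>) \<in> borel_measurable ((poisson_count L TYPE('d::finite)) \<Otimes>\<^sub>M (mark_space TYPE('d::finite) L mu))"
      by (rule measurable_sample) simp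
    have "norm (\<Prod>l\<in>I. \<Sum>\<gamma>\<in>{1..m}. \<bar>snd x \<gamma>\<bar>) = (\<Prod>l\<in>I. \<Sum>\<gamma>\<in>{1..m}. \<bar>snd x \<gamma>\<bar>)" for m and x :: "(nat \<Rightarrow> real^'d) \<times> (nat \<Rightarrow> real)"
      by (auto intro!: prod_nonneg sum_nonneg)
    then show "integrable (poisson_count L TYPE('d::finite)) (\<lambda>m. \<integral>x. norm (\<Prod>l\<in>I. \<Sum>\<gamma>\<in>{1..fst (m, x)}. \<bar>snd (snd (m, x)) \<gamma>\<bar>) \<partial>(mark_space TYPE('d::finite) L mu))"
      by (simp only: fst_conv snd_conv T(2))
         (intro Bochner_Integration.integrable_sum integrable_mult_left poisson_factorial_moment vol_pos)
    show "AE m in (poisson_count L TYPE('d::finite)). integrable (mark_space TYPE('d::finite) L mu) (\<lambda>x. \<Prod>l\<in>I. \<Sum>\<gamma>\<in>{1..fst (m, x)}. \<bar>snd (snd (m, x)) \<gamma>\<bar>)"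
      by (intro AE_I2) (simp only: fst_conv snd_conv T(1))
  qed
qed

lemma expectation_prod:
  fixes p :: "'i \<Rightarrow> real^'d"
  assumes I: "finite I" and p: "\<And>l. l \<in> I \<Longrightarrow> p l \<in> dual_L L"
  defines "F \<equiv> \<lambda>\<omega>::'d sample.
    \<Prod>l\<in>I. \<Sum>\<gamma>\<in>{1..fst \<omega>}. complex_of_real (snd (snd \<omega>) \<gamma>) * cnj (chr (p l) (fst (snd \<omega>) \<gamma>))"
  shows "F \<in> borel_measurable (sample_space L mu)" and "integrable (sample_space L mu) F"
    and "integral\<^sup>L (sample_space L mu) F
      = (\<Sum>A | partition_on I A. \<Prod>a\<in>A. complex_of_real (moment mu (card a)) * delta_L L (\<Sum>l\<in>a. p l))"
proof -
  interpret pair_sigma_finite "poisson_count L TYPE('d::finite)" "mark_space TYPE('d::finite) L mu" by (rule pair_Q)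
  note T = integral_prod_sum_by_partitions[where
      \<xi>="\<lambda>l \<gamma> x. complex_of_real (snd x \<gamma>) * cnj (chr (p l) (fst x \<gamma>))" and
      w="\<lambda>a. complex_of_real (moment mu (card a)) * (if (\<Sum>l\<in>a. p l) = 0 then 1 else 0)",
      OF I chain_term(1)[OF I p] chain_term(2)[OF I p]]
  let ?w = "\<lambda>a. complex_of_real (moment mu (card a)) * (if (\<Sum>l\<in>a. p l) = 0 then 1 else 0)"
  let ?v = "vol_L L TYPE('d)"
  show m: "F \<in> borel_measurable (sample_space L mu)"
    unfolding sample_space_eq F_def
    by (rule measurable_sample) (use borel_measurable_integrable[OF T(1)] in simp)
  show i: "integrable (sample_space L mu) F"
  proof (rule Bochner_Integration.integrable_bound[OF abs_moment_integrable[OF I] m], rule AE_I2)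
    fix \<omega> :: "'d sample"
    have "norm (F \<omega>) \<le> (\<Prod>l\<in>I. \<Sum>\<gamma>\<in>{1..fst \<omega>}. \<bar>snd (snd \<omega>) \<gamma>\<bar>)"
      unfolding F_def prod_norm[symmetric]
      by (intro prod_mono conjI order_trans[OF norm_sum] sum_mono) (auto simp: norm_mult)
    then show "norm (F \<omega>) \<le> norm (\<Prod>l\<in>I. \<Sum>\<gamma>\<in>{1..fst \<omega>}. \<bar>snd (snd \<omega>) \<gamma>\<bar>)"
      by simp
  qed
  have "integral\<^sup>L (sample_space L mu) F = (\<integral>m. (\<integral>x. F (m, x) \<partial>(mark_space TYPE('d::finite) L mu)) \<partial>(poisson_count L TYPE('d::finite)))"
    using integral_fst'[of F] i by (simp add: sample_space_eq)
  also have "\<dots> = (\<integral>m. (\<Sum>A | partition_on I A. of_nat (prod ((-) m) {0..<card A}) * (\<Prod>a\<in>A. ?w a)) \<partial>(poisson_count L TYPE('d::finite)))"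
    by (intro Bochner_Integration.integral_cong refl) (simp only: F_def fst_conv snd_conv T(2))
  also have "\<dots> = (\<Sum>A | partition_on I A. complex_of_real (?v ^ card A) * (\<Prod>a\<in>A. ?w a))"
  proof -
    have c: "integrable (poisson_count L TYPE('d::finite)) (\<lambda>m. of_nat (prod ((-) m) {0..<j}) * b)"
      "(\<integral>m. of_nat (prod ((-) m) {0..<j}) * b \<partial>(poisson_count L TYPE('d::finite))) = complex_of_real (?v ^ j) * b" for j and b :: complex
    proof -
      have e: "complex_of_nat n = complex_of_real (real n)" for n by simp
      show "integrable (poisson_count L TYPE('d::finite)) (\<lambda>m. of_nat (prod ((-) m) {0..<j}) * b)"
        unfolding e by (intro integrable_mult_left integrable_of_real poisson_factorial_moment vol_pos)
      have "(\<integral>m. complex_of_real (real (prod ((-) m) {0..<j})) \<partial>(poisson_count L TYPE('d::finite))) = complex_of_real (?v ^ j)"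
        unfolding integral_complex_of_real poisson_factorial_moment(2)[OF vol_pos] ..
      then show "(\<integral>m. of_nat (prod ((-) m) {0..<j}) * b \<partial>(poisson_count L TYPE('d::finite))) = complex_of_real (?v ^ j) * b"
        unfolding e by simp
    qed
    show ?thesis
      by (subst Bochner_Integration.integral_sum) (simp_all only: c)
  qed
  also have "\<dots> = (\<Sum>A | partition_on I A. \<Prod>a\<in>A. complex_of_real (moment mu (card a)) * delta_L L (\<Sum>l\<in>a. p l))"
  proof (intro sum.cong refl)
    fix A
    have "complex_of_real (?v ^ card A) * (\<Prod>a\<in>A. ?w a) = (\<Prod>a\<in>A. complex_of_real ?v * ?w a)"
      by (simp add: prod.distrib)
    also have "\<dots> = (\<Prod>a\<in>A. complex_of_real (moment mu (card a)) * delta_L L (\<Sum>l\<in>a. p l))"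
      by (intro prod.cong refl) (simp add: delta_L_def)
    finally show "complex_of_real (?v ^ card A) * (\<Prod>a\<in>A. ?w a) = (\<Prod>a\<in>A. complex_of_real (moment mu (card a)) * delta_L L (\<Sum>l\<in>a. p l))" .
  qed
  finally show "integral\<^sup>L (sample_space L mu) F
      = (\<Sum>A | partition_on I A. \<Prod>a\<in>A. complex_of_real (moment mu (card a)) * delta_L L (\<Sum>l\<in>a. p l))" .
qed

end

section \<open>Expansion of the resolvent chain\<close>

text \<open>Fubini's theorem for counting measure on \<open>K\<close>. The separated bound
  \<open>c k * G \<omega>\<close> gives integrability on the product space, and countability reduces
  joint measurability to that of each single term.\<close>

lemma integral_infsum_dominated:
  fixes f :: "'k \<Rightarrow> 'w \<Rightarrow> 'b::{real_normed_field,banach,second_countable_topology}"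
  assumes N: "sigma_finite_measure N" and K: "countable K"
    and c: "c summable_on K" and G: "integrable N G"
    and m: "\<And>k. k \<in> K \<Longrightarrow> f k \<in> borel_measurable N"
    and bd: "\<And>k \<omega>. k \<in> K \<Longrightarrow> norm (f k \<omega>) \<le> c k * G \<omega>"
  shows "(\<integral>\<omega>. infsum (\<lambda>k. f k \<omega>) K \<partial>N) = infsum (\<lambda>k. integral\<^sup>L N (f k)) K"
proof -
  interpret A: sigma_finite_measure "count_space K" by (rule sigma_finite_measure_count_space_countable[OF K])
  interpret B: sigma_finite_measure N by (rule N)
  interpret pair_sigma_finite "count_space K" N by unfold_locales
  have absc: "(\<lambda>k. norm (c k)) summable_on K"
    by (rule summable_on_iff_abs_summable_on_real[THEN iffD1, OF c])
  then have ci: "integrable (count_space K) c"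
    using abs_summable_equivalent[of c K] by (simp add: abs_summable_on_def)
  have mf: "case_prod f \<in> borel_measurable (count_space K \<Otimes>\<^sub>M N)"
    by (rule measurable_pair_measure_countable1[OF K]) (use m in simp)
  have "integrable (count_space K \<Otimes>\<^sub>M N) (case_prod f)"
  proof (rule Bochner_Integration.integrable_bound[OF integral_mult_pair(1)[OF ci G] mf], rule AE_I2)
    fix x assume "x \<in> space (count_space K \<Otimes>\<^sub>M N)"
    then have "fst x \<in> K" by (auto simp: space_pair_measure)
    then have "norm (f (fst x) (snd x)) \<le> c (fst x) * G (snd x)" by (rule bd)
    also have "\<dots> \<le> norm (c (fst x) * G (snd x))" by simp
    finally show "norm (case_prod f x) \<le> norm (c (fst x) * G (snd x))" by (simp add: case_prod_unfold)
  qed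
  from Fubini_integral[OF this]
  have fub: "(\<integral>\<omega>. (\<integral>k. f k \<omega> \<partial>count_space K) \<partial>N) = (\<integral>k. integral\<^sup>L N (f k) \<partial>count_space K)" .
  \<comment> \<open>Absolute summability is what identifies the Bochner integral over counting
    measure with \<open>infsum\<close>.\<close>
  have conv: "(\<integral>k. h k \<partial>count_space K) = infsum h K" if "(\<lambda>k. norm (h k)) summable_on K" for h :: "'k \<Rightarrow> 'b"
    using infsetsum_infsum[of h K] that abs_summable_equivalent[of h K] by (simp add: infsetsum_def)
  have "(\<lambda>k. norm (f k \<omega>)) summable_on K" for \<omega>
    by (rule summable_on_comparison_test[OF summable_on_cmult_left[OF c, of "G \<omega>"]]) (use bd in auto)
  then have l: "(\<integral>k. f k \<omega> \<partial>count_space K) = infsum (\<lambda>k. f k \<omega>) K" for \<omega>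
    by (rule conv)
  have "(\<lambda>k. norm (integral\<^sup>L N (f k))) summable_on K"
  proof (rule summable_on_comparison_test[OF summable_on_cmult_left[OF c, of "integral\<^sup>L N G"]])
    fix k assume k: "k \<in> K"
    have "norm (integral\<^sup>L N (f k)) \<le> (\<integral>\<omega>. norm (f k \<omega>) \<partial>N)" by (rule integral_norm_bound)
    also have "\<dots> \<le> (\<integral>\<omega>. c k * G \<omega> \<partial>N)"
    proof (rule Bochner_Integration.integral_mono)
      show "integrable N (\<lambda>\<omega>. norm (f k \<omega>))"
        by (rule Bochner_Integration.integrable_bound[of _ "\<lambda>\<omega>. c k * G \<omega>"])
           (use G m[OF k] bd[OF k] in \<open>auto intro: order_trans[OF _ abs_ge_self]\<close>)
    qed (use G bd[OF k] in auto)
    finally show "norm (integral\<^sup>L N (f k)) \<le> c k * integral\<^sup>L N G" by simp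
  qed simp
  from conv[OF this] fub l show ?thesis by simp
qed

section \<open>The potential and the resolvent on the Fourier side\<close>

text \<open>The convolution rule is Parseval for \<open>w\<close> and V times the character of
  \<open>p\<close>: as V is real, conjugation touches only the character, and the coefficient of the
  second function at \<open>q\<close> is conjugate to that of V at \<open>p - q\<close>.\<close>

lemma fourier_L_mult:
  fixes V :: "real^'d::finite \<Rightarrow> real"
  assumes L: "L > 0" and V: "V \<in> borel_measurable borel" "\<And>x. \<bar>V x\<bar> \<le> C"
    and w: "sq_integrable (leb_box L) w" and p: "p \<in> dual_L L"
  shows "((\<lambda>q. fourier_L L (\<lambda>x. complex_of_real (V x)) (p - q) * fourier_L L w q / L ^ CARD('d))
    has_sum fourier_L L (\<lambda>x. complex_of_real (V x) * w x) p) (dual_L L)"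
proof -
  interpret finite_measure "leb_box L :: (real^'d) measure" by (rule finite_measure_leb_box[OF L])
  let ?V = "\<lambda>x. complex_of_real (V x)"
  have Vm: "?V \<in> borel_measurable (leb_box L)"
    by (rule borel_measurable_leb_box) (use V in measurable)
  have sqV: "sq_integrable (leb_box L) ?V"
    by (rule sq_integrable_bounded[where C=C]) (use Vm V in auto)
  have sqh: "sq_integrable (leb_box L) (\<lambda>x. ?V x * chr p x)"
    by (rule sq_integrable_bounded_mult[where C=C]) (use Vm V sq_integrable_chr[OF L] in auto)
  have sqVw: "sq_integrable (leb_box L) (\<lambda>x. ?V x * w x)"
    by (rule sq_integrable_bounded_mult[where C=C]) (use Vm V w in auto)
  have "(\<integral>x. cnj (?V x * chr p x) * w x \<partial>leb_box L) = fourier_L L (\<lambda>x. ?V x * w x) p"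
    unfolding fourier_L_eq[OF L sqVw] by (simp add: mult_ac)
  moreover have "cnj (fourier_L L (\<lambda>x. ?V x * chr p x) q) = fourier_L L ?V (p - q)" for q
    unfolding fourier_L_eq[OF L sqh] fourier_L_eq[OF L sqV] Bochner_Integration.integral_cnj[symmetric]
    by (rule Bochner_Integration.integral_cong) (simp_all add: chr_diff_left mult_ac)
  ultimately show ?thesis
    using Parseval_box[OF L w sqh] by simp
qed

lemma sq_integrable_schwartz:
  assumes "schwartz B" "L > 0"
  shows "sq_integrable (leb_box L) (\<lambda>x. complex_of_real (B x))"
proof -
  interpret finite_measure "leb_box L :: (real^'a) measure" by (rule finite_measure_leb_box[OF assms(2)])
  obtain C where C: "\<And>x. \<bar>B x\<bar> \<le> C" using schwartz_bounded[OF assms(1)] by blast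
  have [measurable]: "B \<in> borel_measurable borel" by (rule schwartz_measurable[OF assms(1)])
  show ?thesis
    by (rule sq_integrable_bounded[where C=C]) (auto intro!: borel_measurable_leb_box simp: C)
qed

text \<open>The structure factor of the marked configuration, that is, the Fourier transform of the
  sum of point masses of weight v at the positions y.\<close>

definition struct_sum :: "'d sample \<Rightarrow> real^'d \<Rightarrow> complex" where
  "struct_sum \<omega> p = (\<Sum>\<gamma>\<in>{1..fst \<omega>}. complex_of_real (snd (snd \<omega>) \<gamma>) * cnj (chr p (fst (snd \<omega>) \<gamma>)))"

lemma cmod_struct_sum: "cmod (struct_sum \<omega> p) \<le> (\<Sum>\<gamma>\<in>{1..fst \<omega>}. \<bar>snd (snd \<omega>) \<gamma>\<bar>)"
  unfolding struct_sum_def by (intro order_trans[OF norm_sum] sum_mono) (simp add: norm_mult)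

lemma V_L_props:
  fixes B :: "real^'d::finite \<Rightarrow> real"
  assumes B: "schwartz B" and L: "L > 0"
  shows "V_L L B \<omega> \<in> borel_measurable borel"
    and "\<exists>C. \<forall>x. \<bar>V_L L B \<omega> x\<bar> \<le> C"
    and "p \<in> dual_L L \<Longrightarrow> fourier_L L (\<lambda>x. complex_of_real (V_L L B \<omega> x)) p
      = struct_sum \<omega> p * fourier_L L (\<lambda>x. complex_of_real (B x)) p"
proof -
  interpret finite_measure "leb_box L :: (real^'d) measure" by (rule finite_measure_leb_box[OF L])
  obtain C where C: "\<And>x. \<bar>B x\<bar> \<le> C" using schwartz_bounded[OF B] by blast
  have [measurable]: "B \<in> borel_measurable borel" by (rule schwartz_measurable[OF B])
  show m[measurable]: "V_L L B \<omega> \<in> borel_measurable borel"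
    unfolding V_L_def[abs_def] perext_wrap by measurable
  \<comment> \<open>A bound for one fixed realisation is enough here, since it only ensures that
    multiplication by the potential preserves square integrability.\<close>
  define C' where "C' = (\<Sum>\<gamma>\<in>{1..fst \<omega>}. \<bar>snd (snd \<omega>) \<gamma>\<bar> * C)"
  have bd: "\<bar>V_L L B \<omega> x\<bar> \<le> C'" for x
    unfolding V_L_def perext_wrap C'_def
    by (intro order_trans[OF sum_abs] sum_mono) (auto simp: abs_mult intro!: mult_left_mono C)
  then show "\<exists>C. \<forall>x. \<bar>V_L L B \<omega> x\<bar> \<le> C" by blast
  assume p: "p \<in> dual_L L"
  have sqV: "sq_integrable (leb_box L) (\<lambda>x. complex_of_real (V_L L B \<omega> x))"
    by (rule sq_integrable_bounded[where C=C'])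
       (auto intro!: borel_measurable_leb_box simp: bd)
  have int: "integrable (leb_box L) (\<lambda>x. cnj (chr p x) * complex_of_real (B (wrap L (x - y))))" for y
    by (intro sq_integrable_mult sq_integrable_cnj sq_integrable_chr L sq_integrable_bounded[where C=C])
       (auto intro!: borel_measurable_leb_box simp: C)
  have "fourier_L L (\<lambda>x. complex_of_real (V_L L B \<omega> x)) p
      = (\<integral>x. (\<Sum>\<gamma>\<in>{1..fst \<omega>}. complex_of_real (snd (snd \<omega>) \<gamma>) * (cnj (chr p x) * complex_of_real (B (wrap L (x - fst (snd \<omega>) \<gamma>))))) \<partial>leb_box L)"
    unfolding fourier_L_eq[OF L sqV] by (simp add: V_L_def perext_wrap sum_distrib_left mult_ac)
  also have "\<dots> = (\<Sum>\<gamma>\<in>{1..fst \<omega>}. complex_of_real (snd (snd \<omega>) \<gamma>) * (\<integral>x. cnj (chr p x) * complex_of_real (B (wrap L (x - fst (snd \<omega>) \<gamma>))) \<partial>leb_box L))"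
    by (subst Bochner_Integration.integral_sum) (auto intro!: integrable_mult_right int)
  also have "\<dots> = (\<Sum>\<gamma>\<in>{1..fst \<omega>}. complex_of_real (snd (snd \<omega>) \<gamma>) * (cnj (chr p (fst (snd \<omega>) \<gamma>)) * fourier_L L (\<lambda>x. complex_of_real (B x)) p))"
    unfolding fourier_L_eq[OF L sq_integrable_schwartz[OF B L]]
    by (intro sum.cong refl arg_cong2[where f="(*)"] integral_chr_translate[OF L p, of "\<lambda>x. complex_of_real (B x)"]) measurable
  finally show "fourier_L L (\<lambda>x. complex_of_real (V_L L B \<omega> x)) p
      = struct_sum \<omega> p * fourier_L L (\<lambda>x. complex_of_real (B x)) p"
    unfolding struct_sum_def sum_distrib_right by (simp only: mult.assoc)
qed

text \<open>The chosen function exists because 1 / (nu(p) - z) is a bounded multiplier, so the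
  prescribed coefficients are square summable and Riesz-Fischer applies.\<close>

lemma resolv_L_props:
  fixes f :: "real^'d::finite \<Rightarrow> complex"
  assumes L: "L > 0" and z: "z \<notin> complex_of_real ` {0..}" and f: "sq_integrable (leb_box L) f"
  shows "sq_integrable (leb_box L) (resolv_L L z f)"
    and "p \<in> dual_L L \<Longrightarrow> fourier_L L (resolv_L L z f) p = fourier_L L f p / (complex_of_real (nu p) - z)"
proof -
  obtain C where C: "\<And>k::real^'d. 1 / sqrt (cmod (complex_of_real (nu k) - z)) \<le> C"
    using resolvent_sqrt_decay[OF z L] by metis
  have "(\<lambda>p. (cmod (fourier_L L f p / (complex_of_real (nu p) - z)))\<^sup>2) summable_on dual_L L"
  proof (rule summable_on_comparison_test)
    show "(\<lambda>p. (cmod (fourier_L L f p))\<^sup>2 * (C\<^sup>2)\<^sup>2) summable_on dual_L L"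
      by (rule summable_on_cmult_left[OF fourier_sq_summable[OF L f]])
    fix p :: "real^'d"
    let ?r = "cmod (complex_of_real (nu p) - z)"
    have "(1 / sqrt ?r)\<^sup>2 \<le> C\<^sup>2" by (intro power_mono C) simp
    then have "1 / ?r \<le> C\<^sup>2" by (simp add: power_divide)
    then have "(1 / ?r)\<^sup>2 \<le> (C\<^sup>2)\<^sup>2" by (intro power_mono) auto
    then show "(cmod (fourier_L L f p / (complex_of_real (nu p) - z)))\<^sup>2 \<le> (cmod (fourier_L L f p))\<^sup>2 * (C\<^sup>2)\<^sup>2"
      using mult_left_mono[of "(1 / ?r)\<^sup>2" "(C\<^sup>2)\<^sup>2" "(cmod (fourier_L L f p))\<^sup>2"]
      by (simp add: norm_divide power_divide)
  qed simp
  from Riesz_Fischer_box[OF L this]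
  obtain g :: "real^'d \<Rightarrow> complex" where "sq_integrable (leb_box L) g"
      "\<And>p. p \<in> dual_L L \<Longrightarrow> fourier_L L g p = fourier_L L f p / (complex_of_real (nu p) - z)"
    by blast
  then have "\<exists>g. L2_on (box_L L) g \<and> (\<forall>p\<in>dual_L L. fourier_L L g p = fourier_L L f p / (complex_of_real (nu p) - z))"
    by (auto simp: L2_on_iff)
  from someI_ex[OF this] have "L2_on (box_L L) (resolv_L L z f)"
    "\<forall>p\<in>dual_L L. fourier_L L (resolv_L L z f) p = fourier_L L f p / (complex_of_real (nu p) - z)"
    unfolding resolv_L_def by auto
  then show "sq_integrable (leb_box L) (resolv_L L z f)"
    and "p \<in> dual_L L \<Longrightarrow> fourier_L L (resolv_L L z f) p = fourier_L L f p / (complex_of_real (nu p) - z)"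
    by (auto simp: L2_on_iff)
qed

text \<open>The resolvent chain is unrolled from the left, so
  that each step appends one momentum to the tuple.\<close>
lemma inner_resolv_chain_expansion:
  fixes V :: "real^'d::finite \<Rightarrow> real" and \<psi> f :: "real^'d \<Rightarrow> complex" and n :: nat
  assumes L: "L > 0" and z: "z \<notin> complex_of_real ` {0..}"
    and V: "V \<in> borel_measurable borel" "\<And>x. \<bar>V x\<bar> \<le> C"
    and decay: "\<And>p. p \<in> dual_L L \<Longrightarrow> cmod (fourier_L L (\<lambda>x. complex_of_real (V x)) p) \<le> CV * decay L p" and CV: "CV \<ge> 0"
    and \<psi>: "sq_integrable (leb_box L) \<psi>" and f: "sq_integrable (leb_box L) f"
  shows "inner_L L \<psi> (resolv_chain L z V n f) = 1 / complex_of_real (L ^ CARD('d)) ^ (n + 1) *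
    infsum (\<lambda>k. cnj (fourier_L L \<psi> (k 1)) * (\<Prod>l\<in>{1..n}. fourier_L L (\<lambda>x. complex_of_real (V x)) (k l - k (l + 1)))
      * fourier_L L f (k (n + 1)) * (\<Prod>j\<in>{1..n+1}. 1 / (complex_of_real (nu (k j)) - z))) (PiE {1..n+1} (\<lambda>_. dual_L L))"
proof -
  let ?D = "dual_L L :: (real^'d) set"
  let ?V = "fourier_L L (\<lambda>x. complex_of_real (V x))"
  let ?r = "\<lambda>k::real^'d. complex_of_real (nu k) - z"
  define v where "v = complex_of_real (L ^ CARD('d))"
  have v0: "v \<noteq> 0" using L by (simp add: v_def)
  define w where "w m = resolv_chain L z V m f" for m
  have w0: "w 0 = resolv_L L z f" by (simp add: w_def resolv_chain_def)
  have wSuc: "w (Suc m) = resolv_L L z (\<lambda>x. complex_of_real (V x) * w m x)" for m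
    by (simp add: w_def resolv_chain_def)
  have sqw: "sq_integrable (leb_box L) (w m)" for m
  proof (induction m)
    case 0
    then show ?case unfolding w0 by (rule resolv_L_props(1)[OF L z f])
  next
    case (Suc m)
    have "sq_integrable (leb_box L) (\<lambda>x. complex_of_real (V x) * w m x)"
      by (rule sq_integrable_bounded_mult[OF Suc, where C=C]) (use V in \<open>auto intro!: borel_measurable_leb_box\<close>)
    then show ?case unfolding wSuc by (rule resolv_L_props(1)[OF L z])
  qed
  have sqVw: "sq_integrable (leb_box L) (\<lambda>x. complex_of_real (V x) * w m x)" for m
    by (rule sq_integrable_bounded_mult[OF sqw, where C=C]) (use V in \<open>auto intro!: borel_measurable_leb_box\<close>)
  \<comment> \<open>Summability of the chain needs a resolvent weight at the last momentum too. It
    is the one belonging to the resolvent that produced \<open>w m\<close>, so it is separated from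
    a square-integrable source.\<close>
  have src: "\<exists>F. sq_integrable (leb_box L) F \<and> (\<forall>p\<in>?D. fourier_L L (w m) p = fourier_L L F p / ?r p)" for m
  proof (cases m)
    case 0
    then show ?thesis using resolv_L_props(2)[OF L z f] f w0 by auto
  next
    case (Suc m')
    then show ?thesis using resolv_L_props(2)[OF L z sqVw[of m']] sqVw[of m'] wSuc by auto
  qed
  have wstep: "fourier_L L (w (Suc m)) p = infsum (\<lambda>q. ?V (p - q) * fourier_L L (w m) q) ?D / (v * ?r p)" if p: "p \<in> ?D" for m p
  proof -
    have "fourier_L L (\<lambda>x. complex_of_real (V x) * w m x) p = infsum (\<lambda>q. ?V (p - q) * fourier_L L (w m) q / v) ?D"
      using fourier_L_mult[OF L V sqw[of m] p] by (simp add: infsumI v_def)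
    also have "\<dots> = infsum (\<lambda>q. ?V (p - q) * fourier_L L (w m) q) ?D / v"
      by (simp add: divide_inverse infsum_cmult_left')
    finally show ?thesis unfolding wSuc resolv_L_props(2)[OF L z sqVw p] by simp
  qed
  define P where "P j k = cnj (fourier_L L \<psi> (k 1)) * (\<Prod>l\<in>{1..j}. ?V (k l - k (l + 1)) / ?r (k l))" for j :: nat and k
  define S where "S j m = infsum (\<lambda>k. P j k * fourier_L L (w m) (k (Suc j))) (PiE {1..Suc j} (\<lambda>_. ?D))" for j m
  have summ: "(\<lambda>k. P j k * fourier_L L (w m) (k (Suc j))) summable_on PiE {1..Suc j} (\<lambda>_. ?D)" for j m
  proof -
    obtain F where F: "sq_integrable (leb_box L) F" "\<And>p. p \<in> ?D \<Longrightarrow> fourier_L L (w m) p = fourier_L L F p / ?r p"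
      using src[of m] by blast
    let ?g = "\<lambda>k. cmod (fourier_L L \<psi> (k 1)) * cmod (fourier_L L F (k (j + 1))) * (\<Prod>l\<in>{1..j}. decay L (k l - k (l + 1)))
      * (\<Prod>i\<in>{1..j+1}. 1 / cmod (?r (k i)))"
    have g: "?g summable_on PiE {1..j+1} (\<lambda>_. ?D)"
      by (rule resolvent_chain_summable[OF z L fourier_sq_summable[OF L \<psi>] fourier_sq_summable[OF L F(1)]]) auto
    have "(\<lambda>k. norm (P j k * fourier_L L (w m) (k (Suc j)))) summable_on PiE {1..Suc j} (\<lambda>_. ?D)"
    proof (rule summable_on_comparison_test)
      show "(\<lambda>k. CV ^ j * ?g k) summable_on PiE {1..Suc j} (\<lambda>_. ?D)"
        using summable_on_cmult_right[OF g, of "CV ^ j"] by simp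
      fix k assume k: "k \<in> PiE {1..Suc j} (\<lambda>_. ?D)"
      have kD: "k l \<in> ?D" if "l \<in> {1..Suc j}" for l using k that by (rule PiE_mem)
      have "(\<Prod>l\<in>{1..j}. cmod (?V (k l - k (l + 1)))) \<le> (\<Prod>l\<in>{1..j}. CV * decay L (k l - k (l + 1)))"
        by (intro prod_mono conjI decay dual_L_diff kD) auto
      then have le: "(\<Prod>l\<in>{1..j}. cmod (?V (k l - k (l + 1)))) \<le> CV ^ j * (\<Prod>l\<in>{1..j}. decay L (k l - k (l + 1)))"
        by (simp add: prod.distrib)
      have "norm (P j k * fourier_L L (w m) (k (Suc j)))
          = (\<Prod>l\<in>{1..j}. cmod (?V (k l - k (l + 1)))) * (cmod (fourier_L L \<psi> (k 1)) * cmod (fourier_L L F (k (j + 1))) * (\<Prod>i\<in>{1..j+1}. 1 / cmod (?r (k i))))"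
        using F(2)[OF kD[of "Suc j"]] by (simp add: P_def norm_mult norm_divide prod_norm[symmetric] prod_dividef)
      also have "\<dots> \<le> CV ^ j * (\<Prod>l\<in>{1..j}. decay L (k l - k (l + 1))) * (cmod (fourier_L L \<psi> (k 1)) * cmod (fourier_L L F (k (j + 1))) * (\<Prod>i\<in>{1..j+1}. 1 / cmod (?r (k i))))"
        by (intro mult_right_mono le mult_nonneg_nonneg prod_nonneg) auto
      also have "\<dots> = CV ^ j * ?g k" by (simp only: mult_ac)
      finally show "norm (P j k * fourier_L L (w m) (k (Suc j))) \<le> CV ^ j * ?g k" .
    qed simp
    then show ?thesis by (rule abs_summable_summable)
  qed
  \<comment> \<open>The convolution formula for \<open>w (Suc m)\<close> introduces a new summed
    momentum. Absolute summability over the longer tuples allows the iterated sum to be merged into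
    one sum, at the price of one volume factor.\<close>
  have step: "S j (Suc m) = S (Suc j) m / v" for j m
  proof -
    let ?h = "\<lambda>k. P (Suc j) k * fourier_L L (w m) (k (Suc (Suc j)))"
    let ?E = "PiE {1..Suc j} (\<lambda>_. ?D)"
    have hk: "?h (k(Suc (Suc j) := q)) = (P j k / ?r (k (Suc j))) * (?V (k (Suc j) - q) * fourier_L L (w m) q)" for k q
    proof -
      have "(\<Prod>l\<in>{1..j}. ?V ((k(Suc (Suc j) := q)) l - (k(Suc (Suc j) := q)) (l + 1)) / ?r ((k(Suc (Suc j) := q)) l))
          = (\<Prod>l\<in>{1..j}. ?V (k l - k (l + 1)) / ?r (k l))"
        by (intro prod.cong) auto
      then show ?thesis by (simp add: P_def)
    qed
    have bij: "bij_betw (\<lambda>(k, q). k(Suc (Suc j) := q)) (?E \<times> ?D) (PiE {1..Suc (Suc j)} (\<lambda>_. ?D))"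
      by (rule bij_betw_PiE_snoc)
    have s2: "(\<lambda>(k, q). ?h (k(Suc (Suc j) := q))) summable_on (?E \<times> ?D)"
      using summable_on_reindex_bij_betw[OF bij, of ?h] summ[of "Suc j" m] by (simp add: case_prod_unfold)
    have "S (Suc j) m = infsum (\<lambda>(k, q). ?h (k(Suc (Suc j) := q))) (?E \<times> ?D)"
      unfolding S_def using infsum_reindex_bij_betw[OF bij, of ?h] by (simp only: case_prod_unfold)
    also have "\<dots> = infsum (\<lambda>k. infsum (\<lambda>q. ?h (k(Suc (Suc j) := q))) ?D) ?E"
      by (rule infsum_Sigma'_banach[OF s2, symmetric])
    also have "\<dots> = infsum (\<lambda>k. v * (P j k * fourier_L L (w (Suc m)) (k (Suc j)))) ?E"
    proof (rule infsum_cong)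
      fix k assume k: "k \<in> ?E"
      then have "k (Suc j) \<in> ?D" by (rule PiE_mem) simp
      from wstep[OF this, of m]
      show "infsum (\<lambda>q. ?h (k(Suc (Suc j) := q))) ?D = v * (P j k * fourier_L L (w (Suc m)) (k (Suc j)))"
        unfolding hk infsum_cmult_right' using v0 by simp
    qed
    also have "\<dots> = v * S j (Suc m)" unfolding S_def by (rule infsum_cmult_right')
    finally show ?thesis using v0 by simp
  qed
  have iter: "S j m = S (j + m) 0 / v ^ m" for j m
    by (induction m arbitrary: j) (simp_all add: step)
  have "inner_L L \<psi> (w n) = infsum (\<lambda>p. cnj (fourier_L L \<psi> p) * fourier_L L (w n) p / v) ?D"
    using Parseval_box[OF L sqw[of n] \<psi>] by (simp add: inner_L_eq[OF \<psi> sqw] infsumI v_def)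
  also have "\<dots> = infsum (\<lambda>p. cnj (fourier_L L \<psi> p) * fourier_L L (w n) p) ?D / v"
    by (simp add: divide_inverse infsum_cmult_left')
  also have "infsum (\<lambda>p. cnj (fourier_L L \<psi> p) * fourier_L L (w n) p) ?D = S 0 n"
  proof -
    \<comment> \<open>A single momentum as a tuple of length one; outside its index set an
      extensional function is \<open>undefined\<close>.\<close>
    have "bij_betw (\<lambda>q. (\<lambda>_. undefined)(Suc 0 := q)) ?D (PiE {1..Suc 0} (\<lambda>_. ?D))"
      by (rule bij_betw_byWitness[where f'="\<lambda>k. k (Suc 0)"])
         (auto simp: PiE_def extensional_def fun_eq_iff)
    from infsum_reindex_bij_betw[OF this, of "\<lambda>k. P 0 k * fourier_L L (w n) (k (Suc 0))"]
    show ?thesis by (simp add: S_def P_def)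
  qed
  also have "S 0 n = S n 0 / v ^ n" using iter[of 0 n] by simp
  also have "S n 0 = infsum (\<lambda>k. cnj (fourier_L L \<psi> (k 1)) * (\<Prod>l\<in>{1..n}. ?V (k l - k (l + 1)))
      * fourier_L L f (k (n + 1)) * (\<Prod>j\<in>{1..n+1}. 1 / ?r (k j))) (PiE {1..n+1} (\<lambda>_. ?D))"
    unfolding S_def Suc_eq_plus1
  proof (rule infsum_cong)
    fix k assume k: "k \<in> PiE {1..n+1} (\<lambda>_. ?D)"
    have "k (n + 1) \<in> ?D" using k by (rule PiE_mem) simp
    then have "fourier_L L (w 0) (k (n + 1)) = fourier_L L f (k (n + 1)) / ?r (k (n + 1))"
      unfolding w0 by (rule resolv_L_props(2)[OF L z f])
    then show "P n k * fourier_L L (w 0) (k (n + 1)) = cnj (fourier_L L \<psi> (k 1)) * (\<Prod>l\<in>{1..n}. ?V (k l - k (l + 1)))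
      * fourier_L L f (k (n + 1)) * (\<Prod>j\<in>{1..n+1}. 1 / ?r (k j))"
      by (simp add: P_def prod_dividef)
  qed
  finally show ?thesis by (simp add: w_def v_def)
qed

theorem theorem1:
  fixes B :: "real^'d::finite \<Rightarrow> real"
    and mu :: "real measure"
    and n :: nat and L :: real and z :: complex
    and \<psi>1 \<psi>2 :: "real^'d \<Rightarrow> complex"
  assumes B_schwartz: "schwartz B"
    and B_supp: "bounded {x. B x \<noteq> 0} \<or> (\<forall>j x. B (reflect_j j x) = B x)"
    and mu_prob: "prob_space mu" and mu_sets: "sets mu = sets borel"
    and mu_moments: "\<forall>k::nat. integrable mu (\<lambda>v. v ^ k)"
    and L_pos: "L > 0"
    and z_notin: "z \<notin> complex_of_real ` {0..}"
    and psi1: "L2_on UNIV \<psi>1" and psi2: "L2_on UNIV \<psi>2"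
  shows "T_nL L mu B n z \<psi>1 \<psi>2 =
    (1 / complex_of_real (vol_L L TYPE('d)) ^ (n + 1)) *
    infsum (\<lambda>k. (\<Sum>A\<in>{A. partition_on {1..n} A}. P_AL L mu B A k) *
                 cnj (fourier_L L \<psi>1 (k 1)) * fourier_L L \<psi>2 (k (n + 1)) *
                 (\<Prod>j\<in>{1..n+1}. 1 / (complex_of_real (nu (k j)) - z)))
           (PiE {1..n+1} (\<lambda>_. dual_L L))"
proof -
  interpret poisson_sample L mu
    by (rule poisson_sample.intro) (use L_pos mu_prob mu_sets mu_moments in blast)+
  let ?D = "dual_L L :: (real^'d) set"
  let ?E = "PiE {1..n+1} (\<lambda>_. ?D)"
  let ?B = "fourier_L L (\<lambda>x. complex_of_real (B x))"
  let ?r = "\<lambda>k::real^'d. complex_of_real (nu k) - z"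
  let ?N = "sample_space L mu :: 'd sample measure"
  let ?c = "1 / complex_of_real (vol_L L TYPE('d)) ^ (n + 1)"
  have sq1: "sq_integrable (leb_box L) \<psi>1" by (rule L2_on_box_of_UNIV[OF psi1])
  have sq2: "sq_integrable (leb_box L) \<psi>2" by (rule L2_on_box_of_UNIV[OF psi2])
  obtain CB where CB: "CB \<ge> 0" "\<And>p. p \<in> ?D \<Longrightarrow> cmod (?B p) \<le> CB * decay L p"
    using fourier_L_schwartz_decay[OF B_schwartz L_pos, folded decay_def] by blast
  \<comment> \<open>The summand is split into a deterministic factor \<open>Kk k\<close> and a
    random factor \<open>X k\<close>. The latter has the bound \<open>G\<close>, which does not
    depend on \<open>k\<close>.\<close>
  define Kk where "Kk k = (\<Prod>l\<in>{1..n}. ?B (k l - k (l + 1))) *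
    (cnj (fourier_L L \<psi>1 (k 1)) * fourier_L L \<psi>2 (k (n + 1)) * (\<Prod>j\<in>{1..n+1}. 1 / ?r (k j)))" for k
  define X where "X k \<omega> = (\<Prod>l\<in>{1..n}. struct_sum \<omega> (k l - k (l + 1)))" for k :: "nat \<Rightarrow> real^'d" and \<omega>
  define G where "G \<omega> = (\<Prod>l\<in>{1..n}. \<Sum>\<gamma>\<in>{1..fst \<omega>}. \<bar>snd (snd \<omega>) \<gamma>\<bar>)" for \<omega> :: "'d sample"
  have kD: "k l - k (l + 1) \<in> ?D" if "k \<in> ?E" "l \<in> {1..n}" for k l
    by (intro dual_L_diff PiE_mem[OF that(1)]) (use that(2) in auto)
  \<comment> \<open>The identity holds for every realisation, so the integrand of
    \<open>T_nL\<close> may be replaced by a sum whose terms are visibly measurable in the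
    sample.\<close>
  have pointwise: "inner_L L (perext L \<psi>1) (resolv_chain L z (V_L L B \<omega>) n (perext L \<psi>2)) = ?c * infsum (\<lambda>k. Kk k * X k \<omega>) ?E" for \<omega>
  proof -
    note V = V_L_props[OF B_schwartz L_pos, where \<omega>=\<omega>]
    obtain C where C: "\<And>x. \<bar>V_L L B \<omega> x\<bar> \<le> C" using V(2) by blast
    let ?s = "\<Sum>\<gamma>\<in>{1..fst \<omega>}. \<bar>snd (snd \<omega>) \<gamma>\<bar>"
    have dec: "cmod (fourier_L L (\<lambda>x. complex_of_real (V_L L B \<omega> x)) p) \<le> (?s * CB) * decay L p" if "p \<in> ?D" for p
      unfolding V(3)[OF that] norm_mult mult.assoc
      by (intro mult_mono cmod_struct_sum CB(2) that sum_nonneg) auto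
    have "inner_L L (perext L \<psi>1) (resolv_chain L z (V_L L B \<omega>) n (perext L \<psi>2)) = ?c *
      infsum (\<lambda>k. cnj (fourier_L L (perext L \<psi>1) (k 1)) * (\<Prod>l\<in>{1..n}. fourier_L L (\<lambda>x. complex_of_real (V_L L B \<omega> x)) (k l - k (l + 1)))
        * fourier_L L (perext L \<psi>2) (k (n + 1)) * (\<Prod>j\<in>{1..n+1}. 1 / ?r (k j))) ?E"
      unfolding vol_L_def
      by (rule inner_resolv_chain_expansion[OF L_pos z_notin V(1) C dec])
         (auto simp: sq_integrable_perext[OF L_pos] sq1 sq2 CB intro!: mult_nonneg_nonneg sum_nonneg)
    also have "infsum (\<lambda>k. cnj (fourier_L L (perext L \<psi>1) (k 1)) * (\<Prod>l\<in>{1..n}. fourier_L L (\<lambda>x. complex_of_real (V_L L B \<omega> x)) (k l - k (l + 1)))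
        * fourier_L L (perext L \<psi>2) (k (n + 1)) * (\<Prod>j\<in>{1..n+1}. 1 / ?r (k j))) ?E = infsum (\<lambda>k. Kk k * X k \<omega>) ?E"
    proof (rule infsum_cong)
      fix k assume k: "k \<in> ?E"
      have "(\<Prod>l\<in>{1..n}. fourier_L L (\<lambda>x. complex_of_real (V_L L B \<omega> x)) (k l - k (l + 1))) = X k \<omega> * (\<Prod>l\<in>{1..n}. ?B (k l - k (l + 1)))"
        unfolding X_def prod.distrib[symmetric] by (intro prod.cong refl V(3) kD[OF k])
      then show "cnj (fourier_L L (perext L \<psi>1) (k 1)) * (\<Prod>l\<in>{1..n}. fourier_L L (\<lambda>x. complex_of_real (V_L L B \<omega> x)) (k l - k (l + 1)))
        * fourier_L L (perext L \<psi>2) (k (n + 1)) * (\<Prod>j\<in>{1..n+1}. 1 / ?r (k j)) = Kk k * X k \<omega>"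
        unfolding Kk_def fourier_L_perext[OF L_pos] by (simp only: mult_ac)
    qed
    finally show ?thesis .
  qed
  have Ksum: "(\<lambda>k. cmod (Kk k)) summable_on ?E"
  proof (rule summable_on_comparison_test)
    let ?g = "\<lambda>k. cmod (fourier_L L \<psi>1 (k 1)) * cmod (fourier_L L \<psi>2 (k (n + 1))) * (\<Prod>l\<in>{1..n}. decay L (k l - k (l + 1)))
      * (\<Prod>i\<in>{1..n+1}. 1 / cmod (?r (k i)))"
    have "?g summable_on ?E"
      by (rule resolvent_chain_summable[OF z_notin L_pos fourier_sq_summable[OF L_pos sq1] fourier_sq_summable[OF L_pos sq2]]) auto
    then show "(\<lambda>k. CB ^ n * ?g k) summable_on ?E" by (rule summable_on_cmult_right)
    fix k assume k: "k \<in> ?E"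
    have "(\<Prod>l\<in>{1..n}. cmod (?B (k l - k (l + 1)))) \<le> (\<Prod>l\<in>{1..n}. CB * decay L (k l - k (l + 1)))"
      by (intro prod_mono conjI CB(2) kD[OF k]) auto
    then have le: "(\<Prod>l\<in>{1..n}. cmod (?B (k l - k (l + 1)))) \<le> CB ^ n * (\<Prod>l\<in>{1..n}. decay L (k l - k (l + 1)))"
      by (simp add: prod.distrib)
    have "cmod (Kk k) = (\<Prod>l\<in>{1..n}. cmod (?B (k l - k (l + 1)))) * (cmod (fourier_L L \<psi>1 (k 1)) * cmod (fourier_L L \<psi>2 (k (n + 1))) * (\<Prod>i\<in>{1..n+1}. 1 / cmod (?r (k i))))"
      unfolding Kk_def norm_mult complex_mod_cnj prod_norm[symmetric] norm_divide norm_one ..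
    also have "\<dots> \<le> CB ^ n * (\<Prod>l\<in>{1..n}. decay L (k l - k (l + 1))) * (cmod (fourier_L L \<psi>1 (k 1)) * cmod (fourier_L L \<psi>2 (k (n + 1))) * (\<Prod>i\<in>{1..n+1}. 1 / cmod (?r (k i))))"
      by (intro mult_right_mono le mult_nonneg_nonneg prod_nonneg) auto
    also have "\<dots> = CB ^ n * ?g k" by (simp only: mult_ac)
    finally show "cmod (Kk k) \<le> CB ^ n * ?g k" .
  qed simp
  have E: "X k \<in> borel_measurable ?N" "integral\<^sup>L ?N (X k)
      = (\<Sum>A | partition_on {1..n} A. \<Prod>a\<in>A. complex_of_real (moment mu (card a)) * delta_L L (\<Sum>l\<in>a. k l - k (l + 1)))"
    if "k \<in> ?E" for k
    using expectation_prod(1,3)[of "{1..n}" "\<lambda>l. k l - k (l + 1)"] kD[OF that]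
    unfolding X_def[abs_def] struct_sum_def by auto
  have "T_nL L mu B n z \<psi>1 \<psi>2 = ?c * (\<integral>\<omega>. infsum (\<lambda>k. Kk k * X k \<omega>) ?E \<partial>?N)"
    unfolding T_nL_def pointwise by simp
  also have "(\<integral>\<omega>. infsum (\<lambda>k. Kk k * X k \<omega>) ?E \<partial>?N) = infsum (\<lambda>k. integral\<^sup>L ?N (\<lambda>\<omega>. Kk k * X k \<omega>)) ?E"
  proof (rule integral_infsum_dominated[where c="\<lambda>k. cmod (Kk k)" and G=G])
    show "sigma_finite_measure ?N"
    proof -
      interpret pair_sigma_finite "poisson_count L TYPE('d)" "mark_space TYPE('d::finite) L mu" by (rule pair_Q)
      show ?thesis unfolding sample_space_eq by unfold_locales
    qed
    show "countable ?E" by (intro countable_PiE) (auto intro: countable_dual_L)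
    show "(\<lambda>k. cmod (Kk k)) summable_on ?E" by (rule Ksum)
    show "integrable ?N G"
      unfolding G_def[abs_def] by (rule abs_moment_integrable) simp
    show "(\<lambda>\<omega>. Kk k * X k \<omega>) \<in> borel_measurable ?N" if "k \<in> ?E" for k
      using E(1)[OF that] by measurable
    show "cmod (Kk k * X k \<omega>) \<le> cmod (Kk k) * G \<omega>" for k \<omega>
      unfolding norm_mult X_def G_def prod_norm[symmetric]
      by (intro mult_left_mono prod_mono conjI cmod_struct_sum) auto
  qed
  also have "\<dots> = infsum (\<lambda>k. (\<Sum>A\<in>{A. partition_on {1..n} A}. P_AL L mu B A k) *
                 cnj (fourier_L L \<psi>1 (k 1)) * fourier_L L \<psi>2 (k (n + 1)) *
                 (\<Prod>j\<in>{1..n+1}. 1 / ?r (k j))) ?E"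
  proof (rule infsum_cong)
    fix k assume k: "k \<in> ?E"
    have "(\<Sum>A\<in>{A. partition_on {1..n} A}. P_AL L mu B A k) = integral\<^sup>L ?N (X k) * (\<Prod>l\<in>{1..n}. ?B (k l - k (l + 1)))"
      unfolding E(2)[OF k] sum_distrib_right
    proof (intro sum.cong refl)
      fix A assume "A \<in> {A. partition_on {1..n} A}"
      \<comment> \<open>The product of profile coefficients is the same for all partitions; here it
        is regrouped by the blocks of \<open>A\<close> to match \<open>P_AL\<close>.\<close>
      then have "(\<Prod>l\<in>{1..n}. ?B (k l - k (l + 1))) = (\<Prod>a\<in>A. \<Prod>l\<in>a. ?B (k l - k (l + 1)))"
        by (intro prod.partition) auto
      then show "P_AL L mu B A k = (\<Prod>a\<in>A. complex_of_real (moment mu (card a)) * delta_L L (\<Sum>l\<in>a. k l - k (l + 1))) * (\<Prod>l\<in>{1..n}. ?B (k l - k (l + 1)))"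
        by (simp only: P_AL_def prod.distrib)
    qed
    then show "integral\<^sup>L ?N (\<lambda>\<omega>. Kk k * X k \<omega>) = (\<Sum>A\<in>{A. partition_on {1..n} A}. P_AL L mu B A k) *
                 cnj (fourier_L L \<psi>1 (k 1)) * fourier_L L \<psi>2 (k (n + 1)) * (\<Prod>j\<in>{1..n+1}. 1 / ?r (k j))"
      by (simp add: Kk_def mult_ac)
  qed
  finally show ?thesis .
qed

end
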